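(* Assume the generalized Riemann hypothesis (GRH) for Dirichlet $L$-functions. Let $X$ be large and let $x$ satisfy $\log X\le x\le \exp\big((\log X)^{1/2}\big)$. Then, as $X\to\infty$, $$\max_{\substack{X<d\le 2X\\ d\in\mathcal F}}\ \sum_{n\le x}\chi_d(n)\ \ge\ \Psi\bigg(x,\ \Big(\frac14+o(1)\Big)\frac{\log X\,\log_2X}{\max\{\log_2x-\log_3X,\ \log_3X\}}\bigg),$$ where the $o(1)$ term tends to $0$ as $X\to\infty$, uniformly in $x$ in the stated range.
   Context: $\mathcal F$ denotes the set of fundamental discriminants, and for $d\in\mathcal F$, $\chi_d(n)=\left(\frac{d}{n}\right)$ is the associated real primitive (Kronecker symbol) character. $\log_j$ denotes the $j$-fold iterated logarithm ($\log_2=\log\log$, $\log_3=\log\log\log$). $\Psi(x,y)$ denotes the number of positive integers $n\le x$ all of whose prime factors are $\le y$. *)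

theory Defs
  imports "HOL-Analysis.Analysis" "HOL-Number_Theory.Number_Theory" "HOL-Computational_Algebra.Squarefree"
begin

definition dirichlet_char :: "nat \<Rightarrow> (nat \<Rightarrow> complex) \<Rightarrow> bool" where
  "dirichlet_char q chi \<longleftrightarrow> q > 0 \<and> chi 1 = 1 \<and>
     (\<forall>m n. chi (m * n) = chi m * chi n) \<and>
     (\<forall>n. chi (n + q) = chi n) \<and>
     (\<forall>n. chi n = 0 \<longleftrightarrow> \<not> coprime n q)"

definition GRH :: bool where
  "GRH \<longleftrightarrow> (\<forall>q chi. dirichlet_char q chi \<longrightarrow>
     (\<exists>L. L holomorphic_on (- {1}) \<and>
        (\<forall>s. Re s > 1 \<longrightarrow> (\<lambda>n. chi (Suc n) / of_nat (Suc n) powr s) sums L s) \<and>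
        (\<forall>s. Re s > 1/2 \<and> s \<noteq> 1 \<longrightarrow> L s \<noteq> 0)))"

definition fundamental_disc :: "int \<Rightarrow> bool" where
  "fundamental_disc d \<longleftrightarrow> d \<noteq> 1 \<and>
     ((d mod 4 = 1 \<and> squarefree d) \<or>
      (\<exists>m. d = 4 * m \<and> (m mod 4 = 2 \<or> m mod 4 = 3) \<and> squarefree m))"

definition kronecker_prime :: "int \<Rightarrow> nat \<Rightarrow> int" where
  "kronecker_prime d p =
     (if p = 2 then (if even d then 0 else if d mod 8 = 1 \<or> d mod 8 = 7 then 1 else -1)
      else Legendre d (int p))"

definition kronecker :: "int \<Rightarrow> nat \<Rightarrow> int" where
  "kronecker d n = (\<Prod>p\<in>prime_factors n. kronecker_prime d p ^ multiplicity p n)"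

definition Psi :: "real \<Rightarrow> real \<Rightarrow> nat" where
  "Psi x y = card {n::nat. 1 \<le> n \<and> real n \<le> x \<and> (\<forall>p\<in>prime_factors n. real p \<le> y)}"

end

theory Submission
  imports Defs "HOL-Complex_Analysis.Complex_Analysis" "HOL-Real_Asymp.Real_Asymp"
begin

text \<open>
  The average of \<open>\<Sum>n\<le>x. \<chi>\<^sub>d(n)\<close> is taken over primes \<open>d \<equiv> 1\<close> modulo 4 in \<open>(X, 2X]\<close> with the nonnegative weight
  \<open>w(d) * (\<Prod>p\<le>y. 1 + \<chi>\<^sub>d(p))\<close>, which is supported on those \<open>d\<close> with \<open>\<chi>\<^sub>d(p) = 1\<close> for all \<open>p \<le> y\<close>. There every
  \<open>y\<close>-smooth \<open>n\<close> contributes exactly 1. Expanding the product, a non-smooth \<open>n\<close> contributes sums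
  \<open>\<Sum>d. w(d) \<chi>\<^sub>d(m)\<close>, which are nonnegative if \<open>m\<close> is a square and save a power of \<open>X\<close> under GRH otherwise. As
  there are only \<open>2 ^ \<pi>(y) = X powr o(1)\<close> of them, the average exceeds \<open>\<Psi>(x, y) - 1\<close>, and character sums
  are integers. Since GRH bounds depend on the modulus only logarithmically, this works for \<open>y\<close> up to a constant times
  \<open>log X * loglog X\<close>, so \<open>\<epsilon> = 0\<close> is admissible in the theorem.

  The prime sums use the weights \<open>mangoldt m * ln m ^ k * m powr (-\<sigma>)\<close>, that is, the Taylor coefficients of \<open>L'/L\<close>
  at a large \<open>\<sigma>\<close>. GRH makes \<open>log L\<close> holomorphic on a disc around \<open>\<sigma>\<close> reaching beyond the line \<open>Re s = 1\<close>, so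
  Borel--Caratheodory and Cauchy's inequality bound these coefficients without contour shifts. With
  \<open>\<sigma>\<close> of size \<open>(log X)\<^sup>2\<close> and \<open>k\<close> of size \<open>(log X) ^ 3\<close> the weight concentrates on \<open>(X, 2X]\<close>.
\<close>

section \<open>Logarithmic derivatives and Dirichlet series\<close>

text \<open>\<open>GRH\<close> as stated excludes zeros but gives no growth bounds and says nothing
  at \<open>s = 1\<close>. So explicit continuations of polynomial growth are built by summation by
  parts, identified with the functions in \<open>GRH\<close> by analytic continuation, and the value
  at 1 is treated separately. Growth enters the coefficient bounds only through a logarithm, so
  large discs and moduli as large as exp(l^4) are affordable. Put a = \<sigma> - 1 and l = k / a.
  The pole of zeta, at distance a from the centre, gives the main term k! / a^(k+1). A circle of
  radius a + 1/4 gives an error smaller by about exp(-k / (4 a)) = exp(-l / 4). Against the density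
  of primes the weight peaks at ln m = l with variance l / a in ln m. Power-saving tails outside a
  fixed window around l therefore force a to be a large multiple of l^2, hence k of order l^3. The
  symbol \<open>kronecker d n\<close> is treated as a character in its upper argument d, of modulus
  8 n once combined with a character modulo 4 that selects the discriminants.\<close>

text \<open>The function g / (2 A' - g) maps the disc into the unit disc because Re g < A', so the
  Schwarz lemma applies. Taking A' > A makes this inequality strict; A' tends to A at the
  end.\<close>

lemma borel_caratheodory:
  assumes hol: "g holomorphic_on ball z R" and r: "0 < r" "r < R" and A: "A > 0"
    and g0: "g z = 0" and Re: "\<And>w. w \<in> ball z R \<Longrightarrow> Re (g w) \<le> A"
    and w: "w \<in> cball z r"
  shows "norm (g w) \<le> 2 * A * r / (R - r)"
proof -
  have R: "R > 0" using r by simp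
  have bd: "norm (g w) \<le> 2 * A' * r / (R - r)" if A': "A' > A" for A'
  proof -
    have less: "norm (g u) < norm (2 * A' - g u)" if "u \<in> ball z R" for u
    proof -
      have "Re (g u) < A'" using Re[OF that] A' by simp
      hence "(norm (g u))\<^sup>2 < (norm (2 * A' - g u))\<^sup>2"
        using mult_strict_left_mono[of "Re (g u)" A' A'] A A' unfolding cmod_power2
        by (simp add: power2_eq_square algebra_simps)
      thus ?thesis by (rule power2_less_imp_less) simp
    qed
    define h where "h = (\<lambda>u::complex. g (z + R * u) / (2 * A' - g (z + R * u)))"
    have im: "z + R * u \<in> ball z R" if "norm u < 1" for u :: complex
      using that R by (simp add: dist_norm norm_mult)
    have nz: "2 * A' - g (z + R * u) \<noteq> 0" if "norm u < 1" for u :: complex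
      using less[OF im[OF that]] by auto
    have "h holomorphic_on ball 0 1"
      unfolding h_def
      by (intro holomorphic_intros holomorphic_on_compose_gen[OF _ hol, unfolded o_def])
         (use im nz in auto)
    moreover have "h 0 = 0" by (simp add: h_def g0)
    moreover have "norm (h u) < 1" if "norm u < 1" for u :: complex
      using less[OF im[OF that]] nz[OF that] by (simp add: h_def norm_divide divide_simps)
    moreover define u where "u = (w - z) / R"
    have nu: "norm u \<le> r / R"
      using w R by (simp add: u_def norm_divide dist_norm norm_minus_commute divide_right_mono)
    have nu1: "norm u < 1" using nu r R by (smt (verit) divide_less_eq_1_pos)
    ultimately have "norm (h u) \<le> norm u"
      using Schwarz_Lemma(1)[of h u] by blast
    hence hu: "norm (h u) \<le> r / R" using nu by simp
    have wu: "z + R * u = w" using R by (simp add: u_def)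
    have "norm (g w) = norm (h u) * norm (2 * A' - g w)"
      using nz[OF nu1] by (simp add: h_def wu norm_divide)
    also have "\<dots> \<le> (r / R) * (2 * A' + norm (g w))"
    proof (rule mult_mono[OF hu])
      show "norm (2 * A' - g w) \<le> 2 * A' + norm (g w)"
        using norm_triangle_ineq4[of "2 * A'" "g w"] A A' by simp
    qed (use r R A A' in auto)
    finally show ?thesis using r R by (simp add: field_simps)
  qed
  have "((\<lambda>A'. 2 * A' * r / (R - r)) \<longlongrightarrow> 2 * A * r / (R - r)) (at_right A)"
    using r by (intro tendsto_intros) auto
  moreover have "eventually (\<lambda>A'. norm (g w) \<le> 2 * A' * r / (R - r)) (at_right A)"
    using bd by (auto simp: eventually_at_filter)
  ultimately show ?thesis by (rule tendsto_lowerbound) simp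
qed

text \<open>On the zero-free disc let g = log (f / f z), whose real part is at most ln B.
  Borel-Caratheodory turns this one-sided bound into one for |g| on the circle of radius r. As f' /
  f = g', Cauchy's inequality for the derivative of order k + 1 of g finishes.\<close>

lemma higher_deriv_logderiv_bound:
  assumes hol: "f holomorphic_on ball z R" and nz: "\<And>w. w \<in> ball z R \<Longrightarrow> f w \<noteq> 0"
    and r: "0 < r" "r < R" and B: "B > 1"
    and bd: "\<And>w. w \<in> ball z R \<Longrightarrow> norm (f w) \<le> B * norm (f z)"
  shows "norm ((deriv ^^ k) (\<lambda>w. deriv f w / f w) z) \<le> fact (Suc k) * (2 * ln B * r / (R - r)) / r ^ Suc k"
proof -
  obtain g0 where g0: "g0 holomorphic_on ball z R" "\<And>w. w \<in> ball z R \<Longrightarrow> exp (g0 w) = f w"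
    using holomorphic_logarithm_exists[of "ball z R" f z] hol nz r by (metis convex_ball open_ball centre_in_ball order_less_trans)
  define g where "g = (\<lambda>w. g0 w - g0 z)"
  have z: "z \<in> ball z R" using r by simp
  have hg: "g holomorphic_on ball z R" unfolding g_def by (intro holomorphic_intros g0)
  have eg: "exp (g w) = f w / f z" if "w \<in> ball z R" for w
    using g0(2) that z by (simp add: g_def exp_diff)
  have Reg: "Re (g w) \<le> ln B" if "w \<in> ball z R" for w
  proof -
    have "exp (Re (g w)) = norm (f w) / norm (f z)"
      using eg[OF that] by (metis norm_exp_eq_Re norm_divide)
    also have "\<dots> \<le> B" using bd[OF that] nz[OF z] by (simp add: field_simps)
    finally show ?thesis using B by (simp add: ln_ge_iff)
  qed
  have nb: "norm (g w) \<le> 2 * ln B * r / (R - r)" if "w \<in> cball z r" for w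
    by (rule borel_caratheodory[OF hg r _ _ Reg that]) (use B in \<open>auto simp: g_def\<close>)
  have dg: "deriv f w / f w = deriv g w" if "w \<in> ball z R" for w
  proof -
    have "(g0 has_field_derivative deriv g0 w) (at w)"
      using g0(1) that by (simp add: holomorphic_derivI)
    hence d1: "((\<lambda>w. exp (g0 w)) has_field_derivative exp (g0 w) * deriv g0 w) (at w)"
      by (auto intro!: derivative_eq_intros)
    have "(f has_field_derivative exp (g0 w) * deriv g0 w) (at w)"
      by (rule has_field_derivative_transform_within_open[OF d1 _ that]) (use g0(2) in auto)
    hence "deriv f w = f w * deriv g0 w" using DERIV_imp_deriv g0(2) that by force
    moreover have "deriv g w = deriv g0 w"
      unfolding g_def using g0(1) that
      by (subst deriv_diff) (auto intro: holomorphic_on_imp_differentiable_at)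
    ultimately show ?thesis using nz[OF that] by simp
  qed
  have "(deriv ^^ k) (\<lambda>w. deriv f w / f w) z = (deriv ^^ k) (deriv g) z"
    by (rule higher_deriv_cong_ev) (use dg z in \<open>auto intro!: eventually_nhds_in_open[THEN eventually_mono, of "ball z R"]\<close>)
  also have "\<dots> = (deriv ^^ Suc k) g z" by (simp only: funpow_Suc_right o_apply)
  also have "norm \<dots> \<le> fact (Suc k) * (2 * ln B * r / (R - r)) / r ^ Suc k"
  proof (rule Cauchy_inequality)
    show "g holomorphic_on ball z r" by (rule holomorphic_on_subset[OF hg]) (use r in auto)
    show "continuous_on (cball z r) g"
      by (rule holomorphic_on_imp_continuous_on[OF holomorphic_on_subset[OF hg]]) (use r in auto)
  qed (use nb r in \<open>auto simp: dist_norm\<close>)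
  finally show ?thesis .
qed

section \<open>Dirichlet series in a half-plane of absolute convergence\<close>

lemma norm_nat_powr: "norm (of_nat n powr (s::complex)) = real n powr Re s"
  by (simp add: norm_powr_real_powr)

text \<open>The index starts at 0 harmlessly, since \<open>0 powr s = 0\<close>.\<close>

definition dseries :: "(nat \<Rightarrow> complex) \<Rightarrow> complex \<Rightarrow> complex" where
  "dseries a s = (\<Sum>n. a n * of_nat n powr (-s))"

lemma dseries_term_bound:
  assumes "Re s \<ge> 2"
  shows "norm (a n * of_nat n powr (-s)) \<le> norm (a n) / real n ^ 2"
proof (cases "n = 0")
  case False
  have "real n powr (- Re s) \<le> real n powr (-2)"
    using False assms by (intro powr_mono) auto
  hence "norm (a n) * real n powr (- Re s) \<le> norm (a n) * real n powr (-2)"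
    by (intro mult_left_mono) auto
  moreover have "norm (a n * of_nat n powr (-s)) = norm (a n) * real n powr (- Re s)"
    by (simp only: norm_mult norm_nat_powr) simp
  moreover have "real n powr (-2) = 1 / real n ^ 2"
    using False by (simp add: powr_minus_divide)
  ultimately show ?thesis by simp
qed auto

lemma dseries_abs_summable:
  assumes "summable (\<lambda>n. norm (a n) / real n ^ 2)" "Re s \<ge> 2"
  shows "summable (\<lambda>n. norm (a n * of_nat n powr (-s)))"
  by (rule summable_comparison_test'[OF assms(1), of 0]) (use dseries_term_bound[OF assms(2)] in simp)

lemma dseries_uniform_limit:
  assumes "summable (\<lambda>n. norm (a n) / real n ^ 2)"
  shows "uniform_limit {s. Re s > 2} (\<lambda>N s. \<Sum>n<N. a n * of_nat n powr (-s)) (dseries a) sequentially"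
  unfolding dseries_def
  by (rule Weierstrass_m_test[OF _ assms]) (use dseries_term_bound in auto)

lemma dseries_holomorphic:
  assumes "summable (\<lambda>n. norm (a n) / real n ^ 2)"
  shows "dseries a holomorphic_on {s. Re s > 2}"
proof (rule holomorphic_uniform_sequence[where f = "\<lambda>N s. \<Sum>n<N. a n * of_nat n powr (-s)"])
  show op: "open {s. Re s > 2}" by (simp add: open_halfspace_Re_gt)
  show "(\<lambda>s. \<Sum>n<N. a n * of_nat n powr - s) holomorphic_on {s. 2 < Re s}" for N
    by (intro holomorphic_intros)
  show "\<exists>d>0. cball x d \<subseteq> {s. 2 < Re s} \<and>
       uniform_limit (cball x d) (\<lambda>N s. \<Sum>n<N. a n * of_nat n powr - s) (dseries a) sequentially"
    if x: "x \<in> {s. Re s > 2}" for x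
  proof -
    obtain d where "d > 0" "cball x d \<subseteq> {s. Re s > 2}"
      using op x unfolding open_contains_cball by blast
    thus ?thesis using uniform_limit_on_subset[OF dseries_uniform_limit[OF assms]] by blast
  qed
qed

lemma higher_deriv_nat_powr:
  assumes "n > 0"
  shows "(deriv ^^ k) (\<lambda>s::complex. of_nat n powr (-s)) = (\<lambda>s. (- of_real (ln (real n))) ^ k * of_nat n powr (-s))"
proof (induction k)
  case (Suc k)
  have "deriv (\<lambda>s. (- complex_of_real (ln (real n))) ^ k * of_nat n powr (-s)) s =
      (- complex_of_real (ln (real n))) ^ Suc k * of_nat n powr (-s)" for s
  proof (rule DERIV_imp_deriv)
    have "((\<lambda>s. exp (- s * Ln (of_nat n))) has_field_derivative - Ln (of_nat n) * exp (- s * Ln (of_nat n))) (at s)"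
      by (auto intro!: derivative_eq_intros)
    hence "((\<lambda>s. of_nat n powr (-s)) has_field_derivative - of_real (ln (real n)) * of_nat n powr (-s)) (at s)"
      using assms by (simp add: powr_def Ln_of_nat)
    from DERIV_cmult[OF this, of "(- complex_of_real (ln (real n))) ^ k"]
    show "((\<lambda>s. (- complex_of_real (ln (real n))) ^ k * of_nat n powr (-s)) has_field_derivative
      (- complex_of_real (ln (real n))) ^ Suc k * of_nat n powr (-s)) (at s)"
      by (simp add: mult_ac)
  qed
  with Suc show ?case by simp
qed simp

lemma dseries_higher_deriv:
  assumes "summable (\<lambda>n. norm (a n) / real n ^ 2)" "Re s > 2"
  shows "(\<lambda>n. (- of_real (ln (real n))) ^ k * a n * of_nat n powr (-s)) sums (deriv ^^ k) (dseries a) s"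
proof -
  have op: "open {s. Re s > 2}" by (simp add: open_halfspace_Re_gt)
  have "(\<lambda>N. (deriv ^^ k) (\<lambda>s. \<Sum>n<N. a n * of_nat n powr (-s)) s) \<longlonglongrightarrow> (deriv ^^ k) (dseries a) s"
    by (rule higher_deriv_complex_uniform_limit[OF dseries_uniform_limit[OF assms(1)]])
       (use op assms in \<open>auto intro!: holomorphic_intros always_eventually\<close>)
  moreover have "(deriv ^^ k) (\<lambda>s. \<Sum>n<N. a n * of_nat n powr (-s)) s =
      (\<Sum>n<N. (- of_real (ln (real n))) ^ k * a n * of_nat n powr (-s))" for N
  proof -
    have "(deriv ^^ k) (\<lambda>s. \<Sum>n<N. a n * of_nat n powr (-s)) s =
        (\<Sum>n<N. (deriv ^^ k) (\<lambda>s. a n * of_nat n powr (-s)) s)"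
    proof (induction N)
      case (Suc N)
      have "(deriv ^^ k) (\<lambda>s. (\<Sum>n<N. a n * of_nat n powr (-s)) + a N * of_nat N powr (-s)) s =
         (deriv ^^ k) (\<lambda>s. \<Sum>n<N. a n * of_nat n powr (-s)) s + (deriv ^^ k) (\<lambda>s. a N * of_nat N powr (-s)) s"
        by (rule higher_deriv_add[of _ UNIV]) (auto intro!: holomorphic_intros)
      thus ?case using Suc by simp
    qed simp
    also have "\<dots> = (\<Sum>n<N. (- of_real (ln (real n))) ^ k * a n * of_nat n powr (-s))"
    proof (rule sum.cong)
      fix n show "(deriv ^^ k) (\<lambda>s. a n * of_nat n powr (-s)) s = (- of_real (ln (real n))) ^ k * a n * of_nat n powr (-s)"
      proof (cases "n = 0")
        case False
        have "(deriv ^^ k) (\<lambda>s. a n * of_nat n powr (-s)) s = a n * (deriv ^^ k) (\<lambda>s. of_nat n powr (-s)) s"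
          by (rule higher_deriv_cmult[of _ UNIV]) (auto intro!: holomorphic_intros)
        thus ?thesis using False by (simp add: higher_deriv_nat_powr)
      qed (simp add: higher_deriv_const)
    qed simp
    finally show ?thesis .
  qed
  ultimately show ?thesis unfolding sums_def by simp
qed

text \<open>Reindexing by the bijection from (d, e) to (d * e, d). It serves both the Dirichlet
  convolution in \<open>dseries_mangoldt_mult\<close> and the Lambert series in
  \<open>lambert_bound\<close>.\<close>

lemma has_sum_divisors_regroup:
  fixes g :: "nat \<times> nat \<Rightarrow> 'a :: {topological_comm_monoid_add,t3_space}"
  assumes "(g has_sum S) ({1..} \<times> {1..})"
  shows "((\<lambda>n. \<Sum>d | d dvd n. g (d, n div d)) has_sum S) {1..}"
proof -
  have "((\<lambda>(n, d). g (d, n div d)) has_sum S) (SIGMA n:{1..}. {d. d dvd n})"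
    using assms
    by (subst has_sum_reindex_bij_witness[where i = "\<lambda>(d, e). (d * e, d)" and j = "\<lambda>(n, d). (d, n div d)"
          and h = g and T = "{1..} \<times> {1..}" and s' = S])
       (auto simp: Suc_le_eq intro!: Nat.gr0I)
  thus ?thesis
    by (rule has_sum_SigmaD) (auto intro!: has_sum_finite)
qed

lemma has_sum_prod_nat:
  fixes f h :: "nat \<Rightarrow> 'a :: {real_normed_field, banach}"
  assumes f: "summable (\<lambda>n. norm (f n))" "f 0 = 0" and h: "summable (\<lambda>n. norm (h n))" "h 0 = 0"
  shows "((\<lambda>(d, e). f d * h e) has_sum (suminf f * suminf h)) ({1..} \<times> {1..})"
proof -
  have hs: "(f has_sum suminf f) {1..}" if "summable (\<lambda>n. norm (f n))" "f 0 = 0" for f :: "nat \<Rightarrow> 'b :: {real_normed_vector, banach}"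
  proof -
    have "(f has_sum suminf f) UNIV"
      using that by (intro norm_summable_imp_has_sum) (auto intro: summable_norm_cancel summable_sums)
    also have "?this \<longleftrightarrow> (f has_sum suminf f) {1..}"
      by (rule has_sum_cong_neutral) (use that in \<open>auto simp: not_le\<close>)
    finally show ?thesis .
  qed
  have nf: "((\<lambda>n. norm (f n)) has_sum (\<Sum>n. norm (f n))) {1..}"
    and nh: "((\<lambda>n. norm (h n)) has_sum (\<Sum>n. norm (h n))) {1..}"
    using hs[of "\<lambda>n. norm (f n)"] hs[of "\<lambda>n. norm (h n)"] f h by auto
  have "(\<lambda>(d, e). norm (f d) * norm (h e)) summable_on ({1..} \<times> {1..})"
    by (rule summable_on_SigmaI[where g = "\<lambda>d. norm (f d) * (\<Sum>n. norm (h n))"])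
       (use has_sum_cmult_right[OF nh] summable_on_cmult_left[OF has_sum_imp_summable[OF nf]] in auto)
  hence "(\<lambda>(d, e). f d * h e) abs_summable_on ({1..} \<times> {1..})"
    by (simp add: norm_mult case_prod_unfold)
  hence summ: "(\<lambda>(d, e). f d * h e) summable_on ({1..} \<times> {1..})"
    by (rule abs_summable_summable)
  show ?thesis
    by (rule has_sum_SigmaI[where g = "\<lambda>d. f d * suminf h"])
       (use summ hs f h in \<open>auto intro!: has_sum_cmult_right has_sum_cmult_left\<close>)
qed

lemma ln_le_sqrt:
  assumes "n > 0" shows "ln (real n) \<le> 2 * real n powr (1/2)"
proof -
  have "ln (real n) = 2 * ln (real n powr (1/2))" using assms by (simp add: ln_powr)
  also have "\<dots> \<le> 2 * real n powr (1/2)" using assms ln_le_minus_one[of "real n powr (1/2)"] by simp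
  finally show ?thesis .
qed

lemma summable_log_sq: "summable (\<lambda>n. ln (real n) / real n ^ 2)"
proof (rule summable_comparison_test')
  show "summable (\<lambda>n. 2 * real n powr (-(3/2)))"
    by (intro summable_mult) (simp add: summable_real_powr_iff)
  show "norm (ln (real n) / real n ^ 2) \<le> 2 * real n powr (-(3/2))" if "n \<ge> 1" for n
  proof -
    have "ln (real n) / real n ^ 2 \<le> 2 * real n powr (1/2) / real n powr 2"
      using ln_le_sqrt[of n] that by (auto intro!: divide_right_mono)
    also have "\<dots> = 2 * (real n powr (1/2) / real n powr 2)" by simp
    also have "\<dots> = 2 * real n powr (-(3/2))" by (simp flip: powr_diff del: powr_numeral)
    finally show ?thesis using that by simp
  qed
qed

lemma summable_inverse_sq: "summable (\<lambda>n. 1 / real n ^ 2)"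
  using inverse_power_summable[of 2, where ?'a = real] by (simp add: field_simps)

section \<open>Completely multiplicative coefficients\<close>

text \<open>Covers real characters as well as the constant 1, which belongs to zeta and takes the
  value 1 at 0; so \<open>chi 0 = 0\<close> cannot be demanded.\<close>

locale cmult_fun =
  fixes chi :: "nat \<Rightarrow> complex"
  assumes mult: "chi (m * n) = chi m * chi n" and one: "chi 1 = 1" and norm_le: "norm (chi n) \<le> 1"
begin

definition wchi :: "(nat \<Rightarrow> real) \<Rightarrow> nat \<Rightarrow> complex" where
  "wchi a n = of_real (a n) * chi n"

lemma summable_wchi:
  assumes "\<And>n. n > 0 \<Longrightarrow> \<bar>a n\<bar> \<le> ln (real n) + 1"
  shows "summable (\<lambda>n. norm (wchi a n) / real n ^ 2)"
proof (rule summable_comparison_test'[where N = 1])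
  show "summable (\<lambda>n. ln (real n) / real n ^ 2 + 1 / real n ^ 2)"
    by (intro summable_add summable_log_sq summable_inverse_sq)
  show "norm (norm (wchi a n) / real n ^ 2) \<le> ln (real n) / real n ^ 2 + 1 / real n ^ 2" if "n \<ge> 1" for n
  proof -
    have "norm (wchi a n) \<le> (ln (real n) + 1) * 1" unfolding wchi_def norm_mult
      using assms[of n] norm_le[of n] that by (intro mult_mono) auto
    thus ?thesis by (simp add: add_divide_distrib[symmetric] divide_right_mono)
  qed
qed

lemma wchi_1: "wchi (\<lambda>_. 1) = chi"
  by (auto simp: wchi_def)

lemma
  shows summable_chi: "summable (\<lambda>n. norm (chi n) / real n ^ 2)"
    and summable_chi_ln: "summable (\<lambda>n. norm (wchi (\<lambda>n. ln (real n)) n) / real n ^ 2)"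
    and summable_chi_mangoldt: "summable (\<lambda>n. norm (wchi mangoldt n) / real n ^ 2)"
proof -
  have "\<bar>mangoldt n :: real\<bar> \<le> ln (real n) + 1" if "n > 0" for n
    using mangoldt_le[OF that] by simp
  from summable_wchi[of mangoldt, OF this] 
  show "summable (\<lambda>n. norm (wchi mangoldt n) / real n ^ 2)" .
qed (use summable_wchi[of "\<lambda>_. 1"] summable_wchi[of "\<lambda>n. ln (real n)"] in \<open>auto simp: wchi_1\<close>)

text \<open>The divisor sum of \<open>mangoldt\<close> is ln n, and complete multiplicativity turns
  chi d * chi (n div d) into chi n, which leaves the sum. This is how \<open>mangoldt\<close> gets
  into the logarithmic derivative.\<close>

lemma dseries_mangoldt_mult:
  assumes "Re s \<ge> 2"
  shows "dseries (wchi mangoldt) s * dseries chi s = dseries (wchi (\<lambda>n. ln (real n))) s"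
proof -
  have "((\<lambda>(d, e). (wchi mangoldt d * of_nat d powr (-s)) * (chi e * of_nat e powr (-s))) has_sum
      (dseries (wchi mangoldt) s * dseries chi s)) ({1..} \<times> {1..})"
    unfolding dseries_def
    by (rule has_sum_prod_nat)
       (use assms in \<open>auto intro!: dseries_abs_summable summable_chi summable_chi_mangoldt\<close>)
  hence "((\<lambda>n. \<Sum>d | d dvd n. (wchi mangoldt d * of_nat d powr (-s)) * (chi (n div d) * of_nat (n div d) powr (-s)))
    has_sum (dseries (wchi mangoldt) s * dseries chi s)) {1..}"
    by (auto dest!: has_sum_divisors_regroup simp del: One_nat_def)
  also have "?this \<longleftrightarrow> ((\<lambda>n. wchi (\<lambda>n. ln (real n)) n * of_nat n powr (-s)) has_sum
    (dseries (wchi mangoldt) s * dseries chi s)) {1..}"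
  proof (rule has_sum_cong)
    fix n :: nat assume n: "n \<in> {1..}"
    have "(\<Sum>d | d dvd n. (wchi mangoldt d * of_nat d powr (-s)) * (chi (n div d) * of_nat (n div d) powr (-s)))
       = (\<Sum>d | d dvd n. of_real (mangoldt d) * (chi n * of_nat n powr (-s)))"
    proof (rule sum.cong)
      fix d assume "d \<in> {d. d dvd n}"
      then obtain e where e: "n = d * e" by auto
      have d: "d > 0" "e > 0" using n e by (auto intro!: Nat.gr0I)
      have "(of_nat (d * e) :: complex) powr (-s) = of_nat d powr (-s) * of_nat e powr (-s)"
        by (simp add: powr_times_real)
      thus "(wchi mangoldt d * of_nat d powr (-s)) * (chi (n div d) * of_nat (n div d) powr (-s))
         = of_real (mangoldt d) * (chi n * of_nat n powr (-s))"
        using e d by (simp add: wchi_def mult)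
    qed auto
    also have "\<dots> = wchi (\<lambda>n. ln (real n)) n * of_nat n powr (-s)"
      using n mangoldt_sum[of n, where ?'a = complex] by (simp add: wchi_def flip: sum_distrib_right)
    finally show "(\<Sum>d | d dvd n. (wchi mangoldt d * of_nat d powr (-s)) * (chi (n div d) * of_nat (n div d) powr (-s)))
       = wchi (\<lambda>n. ln (real n)) n * of_nat n powr (-s)" .
  qed
  also have "\<dots> \<longleftrightarrow> ((\<lambda>n. wchi (\<lambda>n. ln (real n)) n * of_nat n powr (-s)) has_sum
    (dseries (wchi mangoldt) s * dseries chi s)) UNIV"
    by (rule has_sum_cong_neutral) (auto simp: not_le)
  finally show ?thesis unfolding dseries_def
    by (auto dest!: has_sum_imp_sums simp: sums_iff)
qed

text \<open>The terms from n = 2 on are dominated by the telescoping series \<open>T\<close> of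
  total 1/2, against the leading term 1. Needed at the centre of the disc in
  \<open>kweight_sum_bound\<close>.\<close>

lemma dseries_chi_bound:
  assumes s: "Re s \<ge> 3"
  shows "norm (dseries chi s) \<ge> 1 / 2"
proof -
  have sm: "summable (\<lambda>n. norm (chi n * of_nat n powr (-s)))"
    by (rule dseries_abs_summable) (use s summable_chi in auto)
  have "dseries chi s = chi 0 * of_nat 0 powr (-s) + (chi 1 * of_nat 1 powr (-s) + (\<Sum>n. chi (Suc (Suc n)) * of_nat (Suc (Suc n)) powr (-s)))"
    unfolding dseries_def using summable_norm_cancel[OF sm]
    using suminf_split_initial_segment[of "\<lambda>n. chi n * of_nat n powr (-s)" 2]
    by (simp add: numeral_2_eq_2)
  hence *: "dseries chi s = 1 + (\<Sum>n. chi (n + 2) * of_nat (n + 2) powr (-s))"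
    by (simp add: one[simplified] numeral_2_eq_2)
  define T where "T = (\<lambda>n. 1 / 2 * (1 / real (Suc n) - 1 / real (Suc (Suc n))))"
  have T: "T sums (1 / 2 * (1 / real (Suc 0) - 0))"
    unfolding T_def
    by (intro sums_mult telescope_sums') real_asymp
  have "norm (\<Sum>n. chi (n + 2) * of_nat (n + 2) powr (-s)) \<le> (\<Sum>n. T n)"
  proof (rule norm_suminf_le[OF _ sums_summable[OF T]])
    fix n
    have "norm (chi (n + 2) * of_nat (n + 2) powr (-s)) \<le> 1 * real (n + 2) powr (-3)"
      unfolding norm_mult norm_nat_powr using s norm_le[of "n + 2"]
      by (intro mult_mono powr_mono) auto
    also have "\<dots> = 1 / real (n + 2) ^ 3"
      by (simp add: powr_minus_divide powr_numeral)
    also have "\<dots> \<le> 1 / (2 * real (n + 1) * real (n + 2))"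
    proof (rule divide_left_mono)
      have "2 * real (n + 1) \<le> real (n + 2) * real (n + 2)" by (simp add: algebra_simps)
      thus "2 * real (n + 1) * real (n + 2) \<le> real (n + 2) ^ 3"
        unfolding power3_eq_cube by (rule mult_right_mono) simp
    qed auto
    also have "\<dots> = T n" by (simp add: T_def divide_simps)
    finally show "norm (chi (n + 2) * of_nat (n + 2) powr (-s)) \<le> T n" .
  qed
  also have "\<dots> = 1 / 2" using T by (simp add: sums_iff)
  finally show ?thesis
    using norm_triangle_ineq2[of 1 "- (\<Sum>n. chi (n + 2) * of_nat (n + 2) powr (-s))"]
    unfolding * by simp
qed

end

section \<open>Weighted von Mangoldt sums as Taylor coefficients\<close>

lemma higher_deriv_inverse_shift:
  fixes s c :: complex
  assumes "s \<noteq> c"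
  shows "(deriv ^^ k) (\<lambda>s. 1 / (s - c)) s = (-1) ^ k * fact k / (s - c) ^ Suc k"
  using assms
proof (induction k arbitrary: s)
  case (Suc k)
  have "(deriv ^^ Suc k) (\<lambda>s. 1 / (s - c)) s = deriv (\<lambda>s. (-1) ^ k * fact k / (s - c) ^ Suc k) s"
    unfolding funpow.simps o_apply
    by (rule deriv_cong_ev)
       (use Suc in \<open>auto intro!: eventually_mono[OF eventually_nhds_in_open[of "-{c}" s]]\<close>)
  also have "\<dots> = (-1) ^ Suc k * fact (Suc k) / (s - c) ^ Suc (Suc k)"
  proof (rule DERIV_imp_deriv)
    have "((\<lambda>s. (-1) ^ k * fact k * inverse ((s - c) ^ Suc k)) has_field_derivative
       (-1) ^ k * fact k * (- (inverse ((s - c) ^ Suc k) * (of_nat (Suc k) * (s - c) ^ k) * inverse ((s - c) ^ Suc k)))) (at s)"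
      using Suc.prems by (auto intro!: derivative_eq_intros simp del: power_Suc)
    also have "(-1) ^ k * fact k * (- (inverse ((s - c) ^ Suc k) * (of_nat (Suc k) * (s - c) ^ k) * inverse ((s - c) ^ Suc k)))
       = (-1) ^ Suc k * fact (Suc k) / (s - c) ^ Suc (Suc k)"
    proof -
      have "a * (- (inverse (u ^ Suc k) * (n * u ^ k) * inverse (u ^ Suc k))) = - a * n / u ^ Suc (Suc k)"
        if "u \<noteq> 0" for a n u :: complex
        using that by (simp add: field_simps)
      from this[of "s - c" "(-1) ^ k * fact k" "of_nat (Suc k)"] Suc.prems show ?thesis by simp
    qed
    finally show "((\<lambda>s. (-1) ^ k * fact k / (s - c) ^ Suc k) has_field_derivative
       (-1) ^ Suc k * fact (Suc k) / (s - c) ^ Suc (Suc k)) (at s)"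
      by (simp only: divide_inverse)
  qed
  finally show ?case .
qed simp

definition kweight :: "real \<Rightarrow> nat \<Rightarrow> nat \<Rightarrow> real" where
  "kweight \<sigma> k m = mangoldt m * ln (real m) ^ k * real m powr (-\<sigma>)"

lemma kweight_nonneg: "kweight \<sigma> k m \<ge> 0"
  unfolding kweight_def
  by (cases "m = 0") (auto intro!: mult_nonneg_nonneg mangoldt_nonneg)

context cmult_fun
begin

text \<open>Here \<kappa> is the order of the pole at 1: 0 for nonprincipal characters and 1 for
  zeta. The factor (s - 1)^\<kappa> removes the pole from F, and its logarithmic derivative later
  yields the main term.\<close>

lemma logderiv_dseries:
  assumes F: "\<And>s. Re s > 2 \<Longrightarrow> F s = (s - 1) ^ \<kappa> * dseries chi s" and s: "Re s > 3"
  shows "deriv F s / F s = of_nat \<kappa> / (s - 1) - dseries (wchi mangoldt) s"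
proof -
  have op: "open {s. Re s > 2}" by (simp add: open_halfspace_Re_gt)
  have L0: "dseries chi s \<noteq> 0" using dseries_chi_bound[of s] s by auto
  have s1: "s - 1 \<noteq> 0" using s by auto
  have "(\<lambda>n. (- of_real (ln (real n))) ^ 1 * chi n * of_nat n powr (-s)) sums (deriv ^^ 1) (dseries chi) s"
    by (rule dseries_higher_deriv) (use summable_chi s in auto)
  hence "(\<lambda>n. - (wchi (\<lambda>n. ln (real n)) n * of_nat n powr (-s))) sums deriv (dseries chi) s"
    by (simp add: wchi_def)
  hence "deriv (dseries chi) s = - dseries (wchi (\<lambda>n. ln (real n))) s"
    unfolding dseries_def
    using suminf_minus[OF summable_norm_cancel[OF dseries_abs_summable[OF summable_chi_ln, of s]]] s
    by (simp add: sums_iff)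
  hence dL: "deriv (dseries chi) s = - dseries (wchi mangoldt) s * dseries chi s"
    using dseries_mangoldt_mult[of s] s by simp
  have "(dseries chi has_field_derivative deriv (dseries chi) s) (at s)"
    by (rule holomorphic_derivI[OF dseries_holomorphic[OF summable_chi] op]) (use s in auto)
  hence "((\<lambda>s. (s - 1) ^ \<kappa> * dseries chi s) has_field_derivative
     of_nat \<kappa> * (s - 1) ^ (\<kappa> - 1) * dseries chi s + (s - 1) ^ \<kappa> * deriv (dseries chi) s) (at s)"
    by (auto intro!: derivative_eq_intros)
  hence "(F has_field_derivative
     of_nat \<kappa> * (s - 1) ^ (\<kappa> - 1) * dseries chi s + (s - 1) ^ \<kappa> * deriv (dseries chi) s) (at s)"
    by (rule has_field_derivative_transform_within_open[OF _ op]) (use s F in auto)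
  hence "deriv F s = of_nat \<kappa> * (s - 1) ^ (\<kappa> - 1) * dseries chi s + (s - 1) ^ \<kappa> * deriv (dseries chi) s"
    by (rule DERIV_imp_deriv)
  also have "\<dots> = (of_nat \<kappa> / (s - 1) - dseries (wchi mangoldt) s) * F s"
    using s1 s by (cases \<kappa>) (simp_all add: dL F field_simps)
  finally show ?thesis using L0 s1 s by (simp add: F)
qed

lemma kweight_sums:
  assumes "\<sigma> > 2"
  shows "(\<lambda>m. of_real (kweight \<sigma> k m) * chi m) sums ((-1) ^ k * (deriv ^^ k) (dseries (wchi mangoldt)) (of_real \<sigma>))"
proof -
  have "(\<lambda>n. (- of_real (ln (real n))) ^ k * wchi mangoldt n * of_nat n powr (- of_real \<sigma>)) sums
    (deriv ^^ k) (dseries (wchi mangoldt)) (of_real \<sigma>)"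
    by (rule dseries_higher_deriv) (use summable_chi_mangoldt assms in auto)
  from sums_mult[OF this, of "(-1) ^ k"]
  show ?thesis
  proof (rule sums_cong[THEN iffD1, rotated])
    fix n
    have "complex_of_real (real n powr - \<sigma>) = of_nat n powr (- of_real \<sigma>)"
      by (simp flip: powr_of_real)
    moreover have "(-1::complex) ^ k * (- of_real (ln (real n))) ^ k = of_real (ln (real n) ^ k)"
      by (simp flip: power_mult_distrib)
    ultimately show "(-1) ^ k * ((- of_real (ln (real n))) ^ k * wchi mangoldt n * of_nat n powr (- of_real \<sigma>)) =
      of_real (kweight \<sigma> k n) * chi n"
      by (simp add: kweight_def wchi_def mult_ac)
  qed
qed

text \<open>The open disc of radius \<sigma> - 5/8 stays in Re s > 5/8, the circle of radius
  \<sigma> - 3/4 reaches Re s = 3/4. The difference 1/8 of the radii turns the factor 2 of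
  Borel-Caratheodory into 16, and |F| \<ge> 1/2 at the centre explains ln (2 M).\<close>

lemma kweight_sum_bound:
  fixes \<sigma> M :: real
  assumes hol: "F holomorphic_on {s. Re s > 1/2}" and nz: "\<And>s. Re s > 1/2 \<Longrightarrow> F s \<noteq> 0"
    and F: "\<And>s. Re s > 2 \<Longrightarrow> F s = (s - 1) ^ \<kappa> * dseries chi s"
    and \<sigma>: "\<sigma> > 3"
    and M: "M \<ge> 1" "\<And>s. s \<in> ball (of_real \<sigma>) (\<sigma> - 5/8) \<Longrightarrow> norm (F s) \<le> M"
  shows "norm ((\<Sum>m. of_real (kweight \<sigma> k m) * chi m) - of_nat \<kappa> * fact k / of_real (\<sigma> - 1) ^ Suc k)
           \<le> fact (Suc k) * (16 * \<sigma> * ln (2 * M)) / (\<sigma> - 3/4) ^ Suc k"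
proof -
  have sub: "Re w > 1/2" if "w \<in> ball (of_real \<sigma>) (\<sigma> - 5/8)" for w
  proof -
    have "\<sigma> - Re w \<le> norm (of_real \<sigma> - w)" using complex_Re_le_cmod[of "of_real \<sigma> - w"] by simp
    thus ?thesis using that by (simp add: dist_norm)
  qed
  have "norm (dseries chi (of_real \<sigma>)) \<ge> 1 / 2"
    by (rule dseries_chi_bound) (use \<sigma> in auto)
  moreover have "norm ((complex_of_real \<sigma> - 1) ^ \<kappa>) \<ge> 1"
  proof -
    have "norm (complex_of_real \<sigma> - 1) \<ge> 1"
      using complex_Re_le_cmod[of "complex_of_real \<sigma> - 1"] \<sigma> by simp
    thus ?thesis unfolding norm_power by (rule one_le_power)
  qed
  ultimately have F\<sigma>: "norm (F (of_real \<sigma>)) \<ge> 1 / 2"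
    using \<sigma> mult_mono[of 1 "norm ((complex_of_real \<sigma> - 1) ^ \<kappa>)" "1/2" "norm (dseries chi (of_real \<sigma>))"]
    by (simp add: F norm_mult)
  have "norm ((deriv ^^ k) (\<lambda>w. deriv F w / F w) (of_real \<sigma>)) \<le>
    fact (Suc k) * (2 * ln (2 * M) * (\<sigma> - 3/4) / ((\<sigma> - 5/8) - (\<sigma> - 3/4))) / (\<sigma> - 3/4) ^ Suc k"
  proof (rule higher_deriv_logderiv_bound)
    show "F holomorphic_on ball (of_real \<sigma>) (\<sigma> - 5/8)"
      by (rule holomorphic_on_subset[OF hol]) (use sub in auto)
    fix w assume w: "w \<in> ball (complex_of_real \<sigma>) (\<sigma> - 5/8)"
    show "F w \<noteq> 0" using sub[OF w] nz by auto
    have "norm (F w) \<le> 2 * M * (1 / 2)" using M w by auto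
    also have "\<dots> \<le> 2 * M * norm (F (of_real \<sigma>))" using F\<sigma> M by (intro mult_left_mono) auto
    finally show "norm (F w) \<le> 2 * M * norm (F (of_real \<sigma>))" .
  qed (use M \<sigma> in auto)
  also have "\<dots> = fact (Suc k) * (16 * (\<sigma> - 3/4) * ln (2 * M)) / (\<sigma> - 3/4) ^ Suc k"
  proof -
    have "2 * l * x / ((\<sigma> - 5/8) - (\<sigma> - 3/4)) = 16 * x * l" for l x :: real by simp
    thus ?thesis by (simp only:)
  qed
  also have "\<dots> \<le> fact (Suc k) * (16 * \<sigma> * ln (2 * M)) / (\<sigma> - 3/4) ^ Suc k"
    using M \<sigma> by (intro divide_right_mono mult_left_mono mult_right_mono) auto
  finally have bd: "norm ((deriv ^^ k) (\<lambda>w. deriv F w / F w) (of_real \<sigma>)) \<le> \<dots>" .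
  have op: "open {s. Re s > 3}" by (simp add: open_halfspace_Re_gt)
  have "(deriv ^^ k) (\<lambda>w. deriv F w / F w) (of_real \<sigma>) =
        (deriv ^^ k) (\<lambda>s. of_nat \<kappa> * (1 / (s - 1)) - dseries (wchi mangoldt) s) (of_real \<sigma>)"
    by (rule higher_deriv_cong_ev)
       (use logderiv_dseries[OF F] \<sigma> in \<open>auto intro!: eventually_mono[OF eventually_nhds_in_open[OF op]]\<close>)
  also have "\<dots> = (deriv ^^ k) (\<lambda>s. of_nat \<kappa> * (1 / (s - 1))) (of_real \<sigma>) - (deriv ^^ k) (dseries (wchi mangoldt)) (of_real \<sigma>)"
    by (rule higher_deriv_diff[OF _ _ op])
       (use \<sigma> in \<open>auto intro!: holomorphic_intros holomorphic_on_subset[OF dseries_holomorphic[OF summable_chi_mangoldt]]\<close>)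
  also have "(deriv ^^ k) (\<lambda>s. of_nat \<kappa> * (1 / (s - 1))) (complex_of_real \<sigma>) =
     of_nat \<kappa> * (deriv ^^ k) (\<lambda>s. 1 / (s - 1)) (of_real \<sigma>)"
    by (rule higher_deriv_cmult[OF _ _ op])
       (use \<sigma> in \<open>auto intro!: holomorphic_intros\<close>)
  also have "(deriv ^^ k) (\<lambda>s. 1 / (s - 1)) (complex_of_real \<sigma>) = (-1) ^ k * fact k / (of_real \<sigma> - 1) ^ Suc k"
    by (rule higher_deriv_inverse_shift) (use \<sigma> in \<open>auto simp: complex_eq_iff\<close>)
  finally have "(deriv ^^ k) (\<lambda>w. deriv F w / F w) (of_real \<sigma>) =
    of_nat \<kappa> * ((-1) ^ k * fact k / (of_real \<sigma> - 1) ^ Suc k) - (deriv ^^ k) (dseries (wchi mangoldt)) (of_real \<sigma>)" .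
  moreover have "(\<Sum>m. of_real (kweight \<sigma> k m) * chi m) = (-1) ^ k * (deriv ^^ k) (dseries (wchi mangoldt)) (of_real \<sigma>)"
    using kweight_sums[of \<sigma> k] \<sigma> by (simp add: sums_iff)
  moreover have "e * D - n * f / Q = - (e * (n * (e * f / Q) - D))" if "e * e = 1" for e D n f Q :: complex
  proof -
    have "- (e * (n * (e * f / Q) - D)) = e * D - (e * e) * (n * f / Q)" by (simp add: algebra_simps)
    thus ?thesis using that by simp
  qed
  moreover have "(-1) ^ k * (-1) ^ k = (1 :: complex)" by (simp flip: power_mult_distrib)
  ultimately have "(\<Sum>m. of_real (kweight \<sigma> k m) * chi m) - of_nat \<kappa> * fact k / of_real (\<sigma> - 1) ^ Suc k
    = - ((-1) ^ k * (deriv ^^ k) (\<lambda>w. deriv F w / F w) (of_real \<sigma>))"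
    by (simp only: of_real_diff of_real_1)
  hence "norm ((\<Sum>m. of_real (kweight \<sigma> k m) * chi m) - of_nat \<kappa> * fact k / of_real (\<sigma> - 1) ^ Suc k)
    = norm ((deriv ^^ k) (\<lambda>w. deriv F w / F w) (of_real \<sigma>))"
    by (simp add: norm_mult norm_power)
  thus ?thesis using bd by simp
qed

end

section \<open>Real characters and nonvanishing at 1\<close>

text \<open>Mean value bound along the segment from u to v, where |z^(-s-1)| is largest at
  u.\<close>

lemma nat_powr_diff_bound:
  fixes s :: complex and u v :: real
  assumes s: "Re s > 0" and u: "0 < u" "u \<le> v"
  shows "norm (of_real v powr (-s) - of_real u powr (-s)) \<le> norm s * u powr (- Re s - 1) * (v - u)"
proof -
  define S where "S = closed_segment (complex_of_real u) (of_real v)"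
  have S: "\<exists>x. z = of_real x \<and> u \<le> x \<and> x \<le> v" if "z \<in> S" for z
  proof -
    have "z \<in> of_real ` {u..v}"
      using that u by (simp only: S_def closed_segment_of_real closed_segment_eq_real_ivl if_True)
    thus ?thesis by auto
  qed
  have "norm (of_real v powr (-s) - of_real u powr (-s)) \<le> (norm s * u powr (- Re s - 1)) * norm (of_real v - complex_of_real u)"
  proof (rule field_differentiable_bound[where S = S and f' = "\<lambda>z. - s * z powr (- s - 1)"])
    fix z assume "z \<in> S"
    then obtain x where x: "z = of_real x" "u \<le> x" "x \<le> v" using S by blast
    have "z \<notin> \<real>\<^sub>\<le>\<^sub>0" using x u by auto
    thus "((\<lambda>z. z powr (-s)) has_field_derivative - s * z powr (- s - 1)) (at z within S)"
      using has_field_derivative_at_within[OF has_field_derivative_powr[of z "-s"]] by simp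
    have "norm (z powr (- s - 1)) = x powr (- Re s - 1)"
      using x u by (simp add: norm_powr_real_powr)
    also have "\<dots> \<le> u powr (- Re s - 1)"
      using x u s by (intro powr_mono2') auto
    finally show "norm (- s * z powr (- s - 1)) \<le> norm s * u powr (- Re s - 1)"
      by (simp add: norm_mult mult_left_mono)
  qed (auto simp: S_def)
  also have "norm (of_real v - complex_of_real u) = v - u"
    using u by (simp flip: of_real_diff)
  finally show ?thesis .
qed

text \<open>This is zeta(3/2). Both continuations have terms of size n^(-Re s - 1), which is at most
  n^(-3/2) on Re s > 1/2.\<close>

definition Z32 :: real where "Z32 = (\<Sum>n. real n powr (-3/2))"

lemma summable_Z32: "summable (\<lambda>n. real n powr (-3/2))"
  by (simp add: summable_real_powr_iff)

lemma Z32_nonneg: "Z32 \<ge> 0"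
  unfolding Z32_def by (rule suminf_nonneg[OF summable_Z32]) auto

text \<open>Weierstrass test on small closed discs. Quadratic growth in s is good enough, since only
  its logarithm reaches \<open>kerr\<close>.\<close>

lemma series_continuation:
  fixes f :: "nat \<Rightarrow> complex \<Rightarrow> complex"
  assumes hol: "\<And>n. f n holomorphic_on {s. Re s > 1/2}"
    and bd: "\<And>n s. Re s > 1/2 \<Longrightarrow> norm (f n s) \<le> C * (norm s + 1) ^ 2 * real n powr (-3/2)"
  shows "(\<lambda>s. \<Sum>n. f n s) holomorphic_on {s. Re s > 1/2}"
    and "Re s > 1/2 \<Longrightarrow> summable (\<lambda>n. f n s)"
    and "Re s > 1/2 \<Longrightarrow> norm (\<Sum>n. f n s) \<le> C * (norm s + 1) ^ 2 * Z32"
proof -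
  have C: "C \<ge> 0" using order_trans[OF norm_ge_zero bd[of 1 1]] by simp
  have op: "open {s. Re s > 1/2}" by (rule open_halfspace_Re_gt)
  show "(\<lambda>s. \<Sum>n. f n s) holomorphic_on {s. Re s > 1/2}"
  proof (rule holomorphic_uniform_sequence[OF op, where f = "\<lambda>N s. \<Sum>n<N. f n s"])
    fix x :: complex assume "x \<in> {s. Re s > 1/2}"
    then obtain d where d: "d > 0" "cball x d \<subseteq> {s. Re s > 1/2}"
      using op unfolding open_contains_cball by blast
    have "uniform_limit (cball x d) (\<lambda>N s. \<Sum>n<N. f n s) (\<lambda>s. \<Sum>n. f n s) sequentially"
    proof (rule Weierstrass_m_test)
      show "summable (\<lambda>n. C * (norm x + d + 1) ^ 2 * real n powr (-3/2))"
        by (intro summable_mult summable_Z32)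
      fix n s assume s: "s \<in> cball x d"
      have "norm s \<le> norm x + d"
        using s norm_triangle_ineq2[of s x] unfolding mem_cball dist_norm norm_minus_commute[of x s] by linarith
      hence "C * (norm s + 1) ^ 2 * real n powr (-3/2) \<le> C * (norm x + d + 1) ^ 2 * real n powr (-3/2)"
        by (intro mult_right_mono mult_left_mono power_mono C add_right_mono) simp_all
      thus "norm (f n s) \<le> C * (norm x + d + 1) ^ 2 * real n powr (-3/2)"
        using order_trans[OF bd[of s n]] s d(2) by blast
    qed
    thus "\<exists>d>0. cball x d \<subseteq> {s. 1 / 2 < Re s} \<and>
            uniform_limit (cball x d) (\<lambda>N s. \<Sum>n<N. f n s) (\<lambda>s. \<Sum>n. f n s) sequentially"
      using d by blast
  qed (intro holomorphic_intros hol)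
  show "summable (\<lambda>n. f n s)" if "Re s > 1/2"
    by (rule summable_comparison_test'[where N = 0, OF summable_mult[OF summable_Z32]])
       (use bd[OF that] in auto)
  show "norm (\<Sum>n. f n s) \<le> C * (norm s + 1) ^ 2 * Z32" if "Re s > 1/2"
    unfolding Z32_def
    by (subst suminf_mult[OF summable_Z32, symmetric], rule norm_suminf_le[OF bd[OF that]])
       (intro summable_mult summable_Z32)
qed

lemma sum_by_parts:
  fixes a g :: "nat \<Rightarrow> 'a :: comm_ring_1"
  shows "(\<Sum>j<N. a j * g j) = (\<Sum>j<N. a j) * g N + (\<Sum>j<N. (\<Sum>i<Suc j. a i) * (g j - g (Suc j)))"
  by (induction N) (auto simp: algebra_simps)

section \<open>Monotonicity of the sequence in Monsky's argument\<close>

text \<open>The AM-GM inequality 1 + y^2 + ... + y^(2n-2) \<ge> n y^(n-1), multiplied by y.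
  Induction in steps of two peels off the first and the last term, whose sum is at least twice their
  geometric mean.\<close>

lemma two_step_geometric:
  fixes y :: real
  assumes "0 < y"
  shows "(\<Sum>i<n. y ^ (2 * i)) * y \<ge> real n * y ^ n"
proof (induction n rule: induct_nat_012)
  case (ge2 n)
  have "(\<Sum>i<Suc (Suc n). y ^ (2 * i)) = 1 + (\<Sum>i<Suc n. y ^ (2 * Suc i))"
    by (subst sum.lessThan_Suc_shift) simp
  also have "(\<Sum>i<Suc n. y ^ (2 * Suc i)) = y\<^sup>2 * (\<Sum>i<n. y ^ (2 * i)) + y ^ (2 * n + 2)"
    by (simp add: sum_distrib_left power_add power2_eq_square mult_ac)
  finally have "(\<Sum>i<Suc (Suc n). y ^ (2 * i)) * y = y\<^sup>2 * ((\<Sum>i<n. y ^ (2 * i)) * y) + (1 + y ^ (2 * n + 2)) * y"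
    by (simp add: algebra_simps)
  also have "y\<^sup>2 * ((\<Sum>i<n. y ^ (2 * i)) * y) \<ge> y\<^sup>2 * (real n * y ^ n)"
    using ge2 by (intro mult_left_mono) auto
  moreover have "1 + y ^ (2 * n + 2) \<ge> 2 * y ^ (n + 1)"
    using zero_le_power2[of "1 - y ^ (n + 1)"]
    by (simp add: power2_eq_square algebra_simps flip: power_add mult_2)
  hence "(1 + y ^ (2 * n + 2)) * y \<ge> 2 * y ^ (n + 1) * y"
    using assms by (intro mult_right_mono) auto
  ultimately show ?case by (simp add: algebra_simps power2_eq_square)
qed (use assms in auto)

text \<open>Multiply \<open>two_step_geometric\<close> at y = sqrt x for n and for Suc n. After
  cancellation a factor y < 1 is left on the larger side.\<close>

lemma geometric_product_bound:
  fixes x :: real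
  assumes x: "0 < x" "x < 1"
  shows "real n * real (Suc n) * x ^ n \<le> (\<Sum>i<n. x ^ i) * (\<Sum>i<Suc n. x ^ i)"
proof -
  define y where "y = sqrt x"
  have y: "0 < y" "y < 1" "x = y\<^sup>2" using x by (auto simp: y_def)
  have e: "(\<Sum>i<n. x ^ i) = (\<Sum>i<n. y ^ (2 * i))" for n
    by (simp add: y power_mult)
  have "(real n * y ^ n) * (real (Suc n) * y ^ Suc n) \<le> ((\<Sum>i<n. x ^ i) * y) * ((\<Sum>i<Suc n. x ^ i) * y)"
    unfolding e using y by (intro mult_mono two_step_geometric mult_nonneg_nonneg sum_nonneg) auto
  hence "(real n * real (Suc n) * x ^ n) * y \<le> ((\<Sum>i<n. x ^ i) * (\<Sum>i<Suc n. x ^ i) * y) * y"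
    by (simp add: y power_mult mult_ac flip: power_mult_distrib) (simp add: power2_eq_square power_mult_distrib mult_ac)
  hence "real n * real (Suc n) * x ^ n \<le> (\<Sum>i<n. x ^ i) * (\<Sum>i<Suc n. x ^ i) * y"
    using y by simp
  also have "\<dots> \<le> (\<Sum>i<n. x ^ i) * (\<Sum>i<Suc n. x ^ i)"
    using y x by (intro mult_left_le mult_nonneg_nonneg sum_nonneg) auto
  finally show ?thesis .
qed

text \<open>With s n = 1 + x + ... + x^(n-1), the quantity (1 - x) (b n - b (n+1)) equals 1 / (n
  (n+1)) - x^n / (s n * s (n+1)), so \<open>geometric_product_bound\<close> is exactly what is
  needed.\<close>

lemma monsky_decreasing:
  fixes x :: real
  assumes x: "0 < x" "x < 1" and n: "n > 0"
  defines "b \<equiv> (\<lambda>n. 1 / (real n * (1 - x)) - x ^ n / (1 - x ^ n))"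
  shows "b (Suc n) \<le> b n"
proof -
  define s where "s = (\<lambda>n. \<Sum>i<n. x ^ i)"
  have s: "1 - x ^ n = (1 - x) * s n" for n
    using x by (simp add: s_def one_diff_power_eq)
  have pos: "s n > 0" "s (Suc n) > 0"
    using x n by (auto simp: s_def intro!: sum_pos simp del: sum.lessThan_Suc)
  have rel: "s (Suc n) = 1 + x * s n" unfolding s_def
    by (subst sum.lessThan_Suc_shift) (simp add: sum_distrib_left)
  have "x ^ n / s n - x ^ Suc n / s (Suc n) = x ^ n / (s n * s (Suc n))"
    using pos by (simp add: field_simps rel)
  also have "\<dots> \<le> 1 / (real n * real (Suc n))"
    using geometric_product_bound[OF x, of n] n pos by (simp add: s_def field_simps del: of_nat_Suc sum.lessThan_Suc)
  also have "\<dots> = 1 / real n - 1 / real (Suc n)" using n by (simp add: field_simps)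
  finally have "(x ^ n / s n - x ^ Suc n / s (Suc n)) / (1 - x) \<le> (1 / real n - 1 / real (Suc n)) / (1 - x)"
    using x by (intro divide_right_mono) auto
  thus ?thesis using x by (simp add: b_def s diff_divide_distrib mult.commute del: power_Suc of_nat_Suc)
qed

section \<open>Real characters: cancellation over a period and divisor sums\<close>

text \<open>Boundedness leaves only the values -1, 0 and 1, so nonprincipal means that -1
  occurs.\<close>

locale real_nonprincipal_char =
  fixes q :: nat and c :: "nat \<Rightarrow> int"
  assumes q: "q > 0" and one: "c 1 = 1" and mult: "c (m * n) = c m * c n"
    and periodic: "c (n + q) = c n" and zero_iff: "c n = 0 \<longleftrightarrow> \<not> coprime n q"
    and abs_le: "\<bar>c n\<bar> \<le> 1" and nonprincipal: "\<exists>m. c m = -1"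
begin

text \<open>If c m = -1 then c 0 = c (0 * m) = - c 0. Hence sums may start at index 0.\<close>

lemma c0: "c 0 = 0"
  using nonprincipal mult[of 0] by (metis mult_zero_left mult_cancel_right1 mult.commute one_neq_neg_one)

lemma c_mod: "c (n mod q) = c n"
proof -
  have "c (a + q * k) = c a" for a k
    by (induction k) (use periodic[of "a + q * _"] in \<open>auto simp: add_ac\<close>)
  from this[of "n mod q" "n div q"] show ?thesis by simp
qed

text \<open>Multiplication by an m with c m = -1 permutes the residues modulo q and negates the
  sum.\<close>

lemma sum_period: "(\<Sum>j<q. c j) = 0"
proof -
  obtain m where m: "c m = -1" using nonprincipal by blast
  have cop: "coprime m q" using zero_iff[of m] m by simp
  have inj: "inj_on (\<lambda>j. (m * j) mod q) {..<q}"
    using cop by (intro inj_onI) (metis cong_def cong_less_modulus_unique_nat cong_mult_lcancel_nat lessThan_iff)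
  moreover have "(\<lambda>j. (m * j) mod q) ` {..<q} \<subseteq> {..<q}" using q by auto
  ultimately have im: "(\<lambda>j. (m * j) mod q) ` {..<q} = {..<q}"
    by (intro card_subset_eq) (auto simp: card_image)
  have "(\<Sum>j<q. c j) = (\<Sum>j<q. c ((m * j) mod q))"
    using sum.reindex[OF inj, of c] im by simp
  also have "\<dots> = - (\<Sum>j<q. c j)"
    by (simp add: c_mod mult m sum_negf)
  finally show ?thesis by simp
qed

lemma partial_sum_bound: "\<bar>\<Sum>j<n. c j\<bar> \<le> int q"
proof (induction n rule: less_induct)
  case (less n)
  show ?case
  proof (cases "n \<le> q")
    case True
    have "\<bar>\<Sum>j<n. c j\<bar> \<le> (\<Sum>j<n. 1)"
      by (rule order_trans[OF sum_abs]) (intro sum_mono abs_le)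
    thus ?thesis using True by simp
  next
    case False
    have "(\<Sum>j<n. c j) = (\<Sum>j<q. c j) + (\<Sum>j=q..<n. c j)"
      using False by (metis atLeast0LessThan le_cases sum.atLeastLessThan_concat zero_le)
    also have "(\<Sum>j=q..<n. c j) = (\<Sum>j<n - q. c (j + q))"
      using False by (subst sum.atLeastLessThan_shift_0) (auto simp: atLeast0LessThan add_ac)
    finally have "(\<Sum>j<n. c j) = (\<Sum>j<n - q. c j)" by (simp add: sum_period periodic)
    thus ?thesis using less[of "n - q"] False q by simp
  qed
qed

text \<open>These are the coefficients of zeta(s) L(s, c).\<close>

definition r :: "nat \<Rightarrow> int" where "r n = (\<Sum>d | d dvd n. c d)"

lemma r_1: "r (Suc 0) = 1"
  using one by (simp add: r_def)

text \<open>Every divisor of \<open>p ^ k * m\<close> is uniquely p^i * d with i \<le> k and d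
  dividing m; i is recovered as the multiplicity of p. The inductions in \<open>r_nonneg\<close> and
  \<open>r_square\<close> strip one full prime power at a time.\<close>

lemma r_prime_power_mult:
  assumes p: "prime p" and m: "m > 0" "\<not> p dvd m"
  shows "r (p ^ k * m) = (\<Sum>i\<le>k. c p ^ i) * r m"
proof -
  have cpow: "c (p ^ i) = c p ^ i" for i
    by (induction i) (use one in \<open>auto simp: mult\<close>)
  have "r (p ^ k * m) = (\<Sum>(i, d) \<in> {..k} \<times> {d. d dvd m}. c (p ^ i * d))"
    unfolding r_def case_prod_unfold
  proof (rule sum.reindex_bij_betw[symmetric])
    show "bij_betw (\<lambda>p'. p ^ fst p' * snd p') ({..k} \<times> {d. d dvd m}) {d. d dvd p ^ k * m}"
    proof (rule bij_betwI')
      fix x y assume x: "x \<in> {..k} \<times> {d. d dvd m}" and y: "y \<in> {..k} \<times> {d. d dvd m}"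
      have nd: "\<not> p dvd snd z" "snd z \<noteq> 0" if "z \<in> {..k} \<times> {d. d dvd m}" for z
        using that m dvd_trans by auto
      have "multiplicity p (p ^ fst z * snd z) = fst z" if "z \<in> {..k} \<times> {d. d dvd m}" for z
        using nd[OF that] p
        by (simp add: prime_elem_multiplicity_mult_distrib not_dvd_imp_multiplicity_0)
      hence "p ^ fst x * snd x = p ^ fst y * snd y \<Longrightarrow> fst x = fst y" using x y by metis
      thus "(p ^ fst x * snd x = p ^ fst y * snd y) = (x = y)"
        using p by (auto simp: prod_eq_iff prime_gt_0_nat)
    next
      fix y assume "y \<in> {d. d dvd p ^ k * m}"
      hence "y dvd p ^ k * m" by simp
      then obtain a b where ab: "y = a * b" "a dvd p ^ k" "b dvd m" using division_decomp by blast
      then obtain i where "i \<le> k" "a = p ^ i" using p divides_primepow_nat by blast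
      thus "\<exists>x\<in>{..k} \<times> {d. d dvd m}. y = p ^ fst x * snd x" using ab by force
    qed (auto intro!: mult_dvd_mono le_imp_power_dvd)
  qed
  also have "\<dots> = (\<Sum>i\<le>k. \<Sum>d | d dvd m. c p ^ i * c d)"
    using m by (subst sum.cartesian_product) (simp add: mult cpow)
  also have "\<dots> = (\<Sum>i\<le>k. c p ^ i) * r m"
    by (simp add: r_def sum_product)
  finally show ?thesis .
qed

lemma c_cases: "c n = -1 \<or> c n = 0 \<or> c n = 1"
  using abs_le[of n] by linarith

text \<open>According to the value of \<open>c p\<close> the sum is k + 1, is 1, or alternates
  between 1 and 0. In a square all exponents are even, which is the second case.\<close>

lemma geometric_sum_ge: "(\<Sum>i\<le>k. c p ^ i) \<ge> 0" "even k \<Longrightarrow> (\<Sum>i\<le>k. c p ^ i) \<ge> 1"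
proof -
  have *: "(\<Sum>i\<le>k. (-1) ^ i) = (if even k then 1 else 0 :: int)" for k
    by (induction k) auto
  have 0: "(\<Sum>i\<le>k. 0 ^ i) = (1 :: int)" by (induction k) auto
  show "(\<Sum>i\<le>k. c p ^ i) \<ge> 0" "even k \<Longrightarrow> (\<Sum>i\<le>k. c p ^ i) \<ge> 1"
    using c_cases[of p] * 0 by auto
qed

lemma r_nonneg: "n > 0 \<Longrightarrow> r n \<ge> 0"
proof (induction n rule: less_induct)
  case (less n)
  show ?case
  proof (cases "n = 1")
    case False
    then obtain p where p: "prime p" "p dvd n" using prime_factor_nat by blast
    obtain m where m: "n = p ^ multiplicity p n * m" "\<not> p dvd m"
      using multiplicity_decompose'[of n p] less.prems p by (metis not_prime_unit gr_implies_not0)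
    have "multiplicity p n > 0" using p less.prems by (simp add: prime_multiplicity_gt_zero_iff)
    hence "p ^ multiplicity p n > 1" using p by (intro one_less_power prime_gt_1_nat)
    moreover have "m > 0" using m less.prems by (auto intro!: Nat.gr0I)
    ultimately have "m < n" using m(1) by (metis mult_less_cancel2 nat_mult_1)
    hence "r m \<ge> 0" using less.IH \<open>m > 0\<close> by blast
    thus ?thesis
      using r_prime_power_mult[OF p(1) \<open>m > 0\<close> m(2), of "multiplicity p n"] geometric_sum_ge(1) m(1) by (metis mult_nonneg_nonneg)
  qed (simp add: r_1)
qed

lemma r_square: "n > 0 \<Longrightarrow> r (n\<^sup>2) \<ge> 1"
proof (induction n rule: less_induct)
  case (less n)
  show ?case
  proof (cases "n = 1")
    case False
    then obtain p where p: "prime p" "p dvd n" using prime_factor_nat by blast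
    obtain m where m: "n = p ^ multiplicity p n * m" "\<not> p dvd m"
      using multiplicity_decompose'[of n p] less.prems p by (metis not_prime_unit gr_implies_not0)
    have "multiplicity p n > 0" using p less.prems by (simp add: prime_multiplicity_gt_zero_iff)
    hence "p ^ multiplicity p n > 1" using p by (intro one_less_power prime_gt_1_nat)
    moreover have "m > 0" using m less.prems by (auto intro!: Nat.gr0I)
    ultimately have "m < n" using m(1) by (metis mult_less_cancel2 nat_mult_1)
    hence "r (m\<^sup>2) \<ge> 1" using less.IH \<open>m > 0\<close> by blast
    moreover have "(\<Sum>i\<le>2 * multiplicity p n. c p ^ i) \<ge> 1" by (rule geometric_sum_ge(2)) simp
    moreover have "n\<^sup>2 = p ^ (2 * multiplicity p n) * m\<^sup>2"
      by (subst m(1)) (simp add: power_mult_distrib power_mult mult.commute)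
    moreover have "\<not> p dvd m\<^sup>2" using m p prime_dvd_power by blast
    ultimately show ?thesis
      using r_prime_power_mult[OF p(1), of "m\<^sup>2" "2 * multiplicity p n"] \<open>m > 0\<close>
        mult_mono[of 1 "\<Sum>i\<le>2 * multiplicity p n. c p ^ i" 1 "r (m\<^sup>2)"] by simp
  qed (simp add: r_1)
qed

end

section \<open>Nonvanishing at 1\<close>

context real_nonprincipal_char
begin

text \<open>Monsky's argument: if \<open>L(1, c) = 0\<close>, then subtracting \<open>L(1, c) / (1 - x)\<close> from the Lambert series
  \<open>\<Sum>n. c n * x ^ n / (1 - x ^ n)\<close> leaves a sum against a decreasing sequence, hence bounded by \<open>q\<close>; but the series equals
  \<open>\<Sum>n. r n * x ^ n\<close> with \<open>r n \<ge> 0\<close> and \<open>r n \<ge> 1\<close> at squares.\<close>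

lemma lambert_bound:
  assumes lim: "(\<lambda>N. \<Sum>j<N. real_of_int (c j) / real j) \<longlonglongrightarrow> 0"
    and x: "0 < x" "x < 1"
  shows "(\<Sum>m=1..M. x ^ (m\<^sup>2)) \<le> real q"
proof -
  define g where "g = (\<lambda>d. x ^ d / (1 - x ^ d))"
  define S where "S = (\<Sum>d. of_int (c d) * g d)"
  have xd: "x ^ d < 1" if "d \<ge> 1" for d :: nat
    using x that by (simp add: power_less_one_iff)
  have inner: "((\<lambda>e. x ^ (d * e)) has_sum g d) {1..}" if "d \<ge> 1" for d :: nat
    using has_sum_geometric_from_1[of "x ^ d"] x xd[OF that] by (simp add: g_def power_mult)
  have g_le: "g d \<le> x ^ d / (1 - x)" if "d \<ge> 1" for d
    unfolding g_def using x power_decreasing[of 1 d x] that xd[OF that] by (intro divide_left_mono) auto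
  have g0: "g d \<ge> 0" for d
    using x xd[of d] by (cases "d = 0") (auto simp: g_def)
  have sg: "summable g"
  proof (rule summable_comparison_test'[where N = 1])
    show "summable (\<lambda>d. x ^ d / (1 - x))" using x by (intro summable_divide summable_geometric) auto
  qed (use g_le g0 in auto)
  have cg: "\<bar>of_int (c d) * g d\<bar> \<le> g d" for d
    using abs_le[of d] g0[of d] by (simp add: abs_mult mult_left_le_one_le)
  have scg: "summable (\<lambda>d. norm (of_int (c d) * g d))"
    by (rule summable_comparison_test'[OF sg, of 0]) (use cg in auto)
  have sumsS: "(\<lambda>d. of_int (c d) * g d) sums S"
    unfolding S_def by (rule summable_sums[OF summable_norm_cancel[OF scg]])
  have hsS: "((\<lambda>d. of_int (c d) * g d) has_sum S) {1..}"
  proof -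
    have "((\<lambda>d. of_int (c d) * g d) has_sum S) UNIV"
      by (rule norm_summable_imp_has_sum[OF scg sumsS])
    also have "?this \<longleftrightarrow> ?thesis"
      by (rule has_sum_cong_neutral) (auto simp: c0 not_le)
    finally show ?thesis .
  qed
  have "g summable_on UNIV"
    using sg g0 by (intro norm_summable_imp_summable_on) auto
  hence "g summable_on {1..}" by (rule summable_on_subset_banach) auto
  hence "(\<lambda>(d, e). x ^ (d * e)) summable_on ({1..} \<times> {1..})"
    using inner x by (intro summable_on_SigmaI[where g = g]) auto
  hence "(\<lambda>p. norm (case p of (d, e) \<Rightarrow> real_of_int (c d) * x ^ (d * e))) summable_on ({1..} \<times> {1..})"
  proof (rule summable_on_comparison_test)
    fix p :: "nat \<times> nat"
    show "norm (case p of (d, e) \<Rightarrow> real_of_int (c d) * x ^ (d * e)) \<le> (case p of (d, e) \<Rightarrow> x ^ (d * e))"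
      using abs_le[of "fst p"] x by (cases p) (simp add: abs_mult mult_left_le_one_le)
  qed simp
  hence "(\<lambda>(d, e). real_of_int (c d) * x ^ (d * e)) summable_on ({1..} \<times> {1..})"
    by (rule abs_summable_summable)
  hence "((\<lambda>(d, e). real_of_int (c d) * x ^ (d * e)) has_sum S) ({1..} \<times> {1..})"
    by (intro has_sum_SigmaI[where g = "\<lambda>d. of_int (c d) * g d"])
       (use hsS has_sum_cmult_right[OF inner] in auto)
  hence "((\<lambda>n. \<Sum>d | d dvd n. (case (d, n div d) of (d, e) \<Rightarrow> real_of_int (c d) * x ^ (d * e))) has_sum S) {1..}"
    by (rule has_sum_divisors_regroup)
  also have "?this \<longleftrightarrow> ((\<lambda>n. real_of_int (r n) * x ^ n) has_sum S) {1..}"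
    by (rule has_sum_cong) (auto simp: r_def sum_distrib_right intro!: sum.cong)
  finally have hsr: "((\<lambda>n. real_of_int (r n) * x ^ n) has_sum S) {1..}" .
  have inj: "inj_on (\<lambda>m::nat. m\<^sup>2) {1..M}"
    by (auto simp: inj_on_def power2_eq_iff_nonneg)
  have "(\<Sum>m=1..M. x ^ (m\<^sup>2)) \<le> (\<Sum>m=1..M. real_of_int (r (m\<^sup>2)) * x ^ (m\<^sup>2))"
  proof (rule sum_mono)
    fix m assume "m \<in> {1..M}"
    hence "1 \<le> real_of_int (r (m\<^sup>2))" using r_square[of m] by simp
    thus "x ^ (m\<^sup>2) \<le> real_of_int (r (m\<^sup>2)) * x ^ (m\<^sup>2)"
      using x mult_right_mono[of 1 "real_of_int (r (m\<^sup>2))" "x ^ (m\<^sup>2)"] by simp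
  qed
  also have "\<dots> = (\<Sum>n\<in>(\<lambda>m. m\<^sup>2) ` {1..M}. real_of_int (r n) * x ^ n)"
    by (subst sum.reindex[OF inj]) simp
  also have "\<dots> \<le> S"
    by (rule finite_sum_le_has_sum[OF hsr]) (use r_nonneg x in \<open>auto simp: Suc_le_eq\<close>)
  also have "S \<le> real q"
  proof -
    define b where "b = (\<lambda>n. 1 / (real n * (1 - x)) - x ^ n / (1 - x ^ n))"
    have dec: "b (Suc n) \<le> b n" if "n > 0" for n
      unfolding b_def by (rule monsky_decreasing[OF x that])
    have blim: "b \<longlonglongrightarrow> 0"
    proof -
      have "(\<lambda>n. 1 / real n * (1 / (1 - x)) - x ^ n / (1 - x ^ n)) \<longlonglongrightarrow> 0 * (1 / (1 - x)) - 0 / (1 - 0)"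
        by (intro tendsto_intros LIMSEQ_power_zero lim_1_over_n) (use x in auto)
      thus ?thesis by (simp add: b_def)
    qed
    have b0: "b n \<ge> 0" if "n > 0" for n
    proof -
      have "decseq (\<lambda>m. b (n + m))" using dec that by (intro decseq_SucI) auto
      moreover have "(\<lambda>m. b (n + m)) \<longlonglongrightarrow> 0"
        using LIMSEQ_ignore_initial_segment[OF blim, of n] by (simp add: add.commute)
      ultimately show ?thesis using decseq_ge[of "\<lambda>m. b (n + m)" 0 0] by simp
    qed
    have b1: "b 1 = 1" using x by (simp add: b_def divide_simps)
    define A where "A = (\<lambda>n. real_of_int (\<Sum>j<n. c j))"
    have A: "\<bar>A n\<bar> \<le> real q" for n
      using partial_sum_bound[of n] unfolding A_def by (metis of_int_abs of_int_le_iff of_int_of_nat_eq)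
    have A1: "A 1 = 0" by (simp add: A_def c0)
    have tel: "(\<Sum>j=1..<N. b j - b (Suc j)) = 1 - b N" if "N \<ge> 1" for N
      using sum_Suc_diff'[of 1 N "\<lambda>j. - b j"] that b1 by simp
    have bd: "- (\<Sum>j<N. of_int (c j) * b j) \<le> real q" if N: "N \<ge> 1" for N
    proof -
      have "(\<Sum>j<N. of_int (c j) * b j) = A N * b N + (\<Sum>j<N. A (Suc j) * (b j - b (Suc j)))"
        unfolding A_def of_int_sum by (rule sum_by_parts)
      \<comment> \<open>The term j = 0 contains \<open>b 0\<close>, a division by zero outside the
        range of \<open>dec\<close>. It drops out because A 1 = c 0 = 0, and the remaining sum
        starts from b 1 = 1.\<close>
      also have "(\<Sum>j<N. A (Suc j) * (b j - b (Suc j))) = (\<Sum>j=1..<N. A (Suc j) * (b j - b (Suc j)))"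
        using N A1 by (subst lessThan_atLeast0, subst sum.atLeast_Suc_lessThan) auto
      finally have "\<bar>\<Sum>j<N. of_int (c j) * b j\<bar> \<le> \<bar>A N * b N\<bar> + \<bar>\<Sum>j=1..<N. A (Suc j) * (b j - b (Suc j))\<bar>"
        by simp
      also have "\<bar>A N * b N\<bar> \<le> real q * b N"
        using A[of N] b0[of N] N by (simp add: abs_mult mult_right_mono)
      also have "\<bar>\<Sum>j=1..<N. A (Suc j) * (b j - b (Suc j))\<bar> \<le> (\<Sum>j=1..<N. real q * (b j - b (Suc j)))"
      proof (rule order_trans[OF sum_abs sum_mono])
        fix j assume "j \<in> {1..<N}"
        thus "\<bar>A (Suc j) * (b j - b (Suc j))\<bar> \<le> real q * (b j - b (Suc j))"
          using A[of "Suc j"] dec[of j] by (simp add: abs_mult mult_right_mono)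
      qed
      also have "\<dots> = real q * (1 - b N)"
        using tel[OF N] by (simp flip: sum_distrib_left)
      finally show ?thesis by (simp add: algebra_simps)
    qed
    \<comment> \<open>The assumption on L(1, c) enters here: it sends the part of b with 1 / (j (1 -
      x)) to 0, leaving only the Lambert series.\<close>
    have "(\<lambda>N. - (\<Sum>j<N. of_int (c j) * b j)) \<longlonglongrightarrow> - (0 / (1 - x) - S)"
    proof -
      have "(\<lambda>N. - ((\<Sum>j<N. real_of_int (c j) / real j) / (1 - x) - (\<Sum>j<N. of_int (c j) * g j))) \<longlonglongrightarrow> - (0 / (1 - x) - S)"
        using x by (intro tendsto_intros lim sumsS[unfolded sums_def]) auto
      moreover have "(\<Sum>j<N. of_int (c j) * b j) = (\<Sum>j<N. real_of_int (c j) / real j) / (1 - x) - (\<Sum>j<N. of_int (c j) * g j)" for N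
        by (simp add: b_def g_def sum_divide_distrib right_diff_distrib flip: sum_subtractf)
      ultimately show ?thesis by simp
    qed
    hence "- (0 / (1 - x) - S) \<le> real q"
      by (rule tendsto_upperbound) (use bd in \<open>auto simp: eventually_sequentially\<close>)
    thus ?thesis by simp
  qed
  finally show ?thesis .
qed

text \<open>As x tends to 1 from the left, q + 1 terms x^(m^2) tend to the total q + 1, exceeding
  the bound q that \<open>lambert_bound\<close> gives uniformly in x.\<close>

lemma L_one_nonzero: "\<not> (\<lambda>N. \<Sum>j<N. real_of_int (c j) / real j) \<longlonglongrightarrow> 0"
proof
  assume lim: "(\<lambda>N. \<Sum>j<N. real_of_int (c j) / real j) \<longlonglongrightarrow> 0"
  have "((\<lambda>x::real. \<Sum>m=1..Suc q. x ^ (m\<^sup>2)) \<longlongrightarrow> (\<Sum>m=1..Suc q. 1 ^ (m\<^sup>2))) (at_left 1)"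
    by (intro tendsto_intros)
  moreover have "eventually (\<lambda>x::real. (\<Sum>m=1..Suc q. x ^ (m\<^sup>2)) \<le> real q) (at_left 1)"
    using eventually_at_left_real[of 0 1] by (rule eventually_mono[OF _ lambert_bound[OF lim]]) auto
  ultimately have "(\<Sum>m=1..Suc q. 1 ^ (m\<^sup>2)) \<le> real q"
    by (rule tendsto_upperbound) simp
  thus False by simp
qed

section \<open>Continuation of L-functions and their zeros under GRH\<close>

text \<open>The L-series after summation by parts. The partial sums of c are bounded by q, so it
  converges absolutely on Re s > 1/2 with a bound linear in q; the function given by
  \<open>GRH\<close> comes with no such bound.\<close>

definition Lfun :: "complex \<Rightarrow> complex" where
  "Lfun s = (\<Sum>n. of_int (\<Sum>j<Suc n. c j) * (of_nat n powr (-s) - of_nat (Suc n) powr (-s)))"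

lemma
  shows Lfun_holomorphic: "Lfun holomorphic_on {s. Re s > 1/2}"
    and Lfun_bound: "Re s > 1/2 \<Longrightarrow> norm (Lfun s) \<le> real q * (norm s + 1) ^ 2 * Z32"
    and Lfun_limit: "Re s > 1/2 \<Longrightarrow> (\<lambda>N. \<Sum>n<N. of_int (c n) * of_nat n powr (-s)) \<longlonglongrightarrow> Lfun s"
proof -
  define f where "f = (\<lambda>n s. of_int (\<Sum>j<Suc n. c j) * (of_nat n powr (-s) - of_nat (Suc n) powr (-s)) :: complex)"
  have hol: "f n holomorphic_on {s. Re s > 1/2}" for n
    unfolding f_def by (intro holomorphic_intros)
  have A: "norm (of_int (\<Sum>j<n. c j) :: complex) \<le> real q" for n
    using partial_sum_bound[of n] unfolding norm_of_int by linarith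
  have bd: "norm (f n s) \<le> real q * (norm s + 1) ^ 2 * real n powr (-3/2)" if s: "Re s > 1/2" for n s
  proof (cases "n = 0")
    case False
    have "norm (of_real (real (Suc n)) powr (-s) - of_real (real n) powr (-s)) \<le>
      norm s * real n powr (- Re s - 1) * (real (Suc n) - real n)"
      by (rule nat_powr_diff_bound) (use s False in auto)
    also have "\<dots> = norm s * real n powr (- Re s - 1)" by simp
    also have "\<dots> \<le> (norm s + 1) ^ 2 * real n powr (-3/2)"
    proof (rule mult_mono)
      show "norm s \<le> (norm s + 1) ^ 2" by (simp add: power2_eq_square algebra_simps)
      show "real n powr (- Re s - 1) \<le> real n powr (-3/2)"
        using s False by (intro powr_mono) auto
    qed auto
    finally have "norm (of_nat n powr (-s) - of_nat (Suc n) powr (-s)) \<le> (norm s + 1) ^ 2 * real n powr (-3/2)"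
      by (simp add: norm_minus_commute)
    hence "norm (f n s) \<le> real q * ((norm s + 1) ^ 2 * real n powr (-3/2))"
      unfolding f_def norm_mult by (intro mult_mono A) auto
    thus ?thesis by (simp add: mult.assoc)
  qed (simp add: f_def c0)
  have L: "Lfun = (\<lambda>s. \<Sum>n. f n s)" by (simp add: Lfun_def f_def fun_eq_iff)
  show "Lfun holomorphic_on {s. Re s > 1/2}" unfolding L
    by (rule series_continuation(1)[OF hol bd])
  show "norm (Lfun s) \<le> real q * (norm s + 1) ^ 2 * Z32" if "Re s > 1/2" unfolding L
    by (rule series_continuation(3)[OF hol bd that])
  show "(\<lambda>N. \<Sum>n<N. of_int (c n) * of_nat n powr (-s)) \<longlonglongrightarrow> Lfun s" if s: "Re s > 1/2"
  proof -
    have "(\<lambda>N. of_int (\<Sum>j<N. c j) * of_nat N powr (-s)) \<longlonglongrightarrow> 0"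
    proof (rule Lim_null_comparison)
      show "\<forall>\<^sub>F N in sequentially. norm (of_int (\<Sum>j<N. c j) * of_nat N powr (-s)) \<le> real q * real N powr (- Re s)"
        unfolding norm_mult norm_nat_powr uminus_complex.sel
        by (intro always_eventually allI mult_right_mono A) auto
      show "(\<lambda>N. real q * real N powr (- Re s)) \<longlonglongrightarrow> 0"
        using s by (intro tendsto_mult_right_zero tendsto_neg_powr filterlim_real_sequentially) auto
    qed
    moreover have "(\<lambda>N. \<Sum>n<N. f n s) \<longlonglongrightarrow> Lfun s"
      unfolding L
      by (rule summable_LIMSEQ, rule series_continuation(2)[OF hol bd s])
    ultimately have "(\<lambda>N. of_int (\<Sum>j<N. c j) * of_nat N powr (-s) + (\<Sum>n<N. f n s)) \<longlonglongrightarrow> 0 + Lfun s"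
      by (rule tendsto_add)
    moreover have "(\<Sum>n<N. of_int (c n) * of_nat n powr (-s)) = of_int (\<Sum>j<N. c j) * of_nat N powr (-s) + (\<Sum>n<N. f n s)" for N
      unfolding f_def of_int_sum by (rule sum_by_parts)
    ultimately show ?thesis by simp
  qed
qed

sublocale cmult_fun "\<lambda>n. of_int (c n)"
proof
  show "norm (of_int (c n) :: complex) \<le> 1" for n
    using abs_le[of n] unfolding norm_of_int by linarith
qed (use one in \<open>auto simp: mult\<close>)

lemma Lfun_eq_dseries:
  assumes "Re s > 2"
  shows "Lfun s = dseries (\<lambda>n. of_int (c n)) s"
proof -
  have "(\<lambda>n. of_int (c n) * of_nat n powr (-s)) sums Lfun s"
    unfolding sums_def by (rule Lfun_limit) (use assms in auto)
  thus ?thesis by (simp add: dseries_def sums_iff)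
qed

lemma Lfun_one_nonzero: "Lfun 1 \<noteq> 0"
proof
  assume "Lfun 1 = 0"
  hence "(\<lambda>N. \<Sum>n<N. of_int (c n) * of_nat n powr (-1)) \<longlonglongrightarrow> complex_of_real 0"
    using Lfun_limit[of 1] by simp
  moreover have "(\<Sum>n<N. of_int (c n) * of_nat n powr (-1)) = complex_of_real (\<Sum>j<N. real_of_int (c j) / real j)" for N
    by (simp add: powr_minus field_simps)
  ultimately have "(\<lambda>N. complex_of_real (\<Sum>j<N. real_of_int (c j) / real j)) \<longlonglongrightarrow> complex_of_real 0"
    by simp
  hence "(\<lambda>N. \<Sum>j<N. real_of_int (c j) / real j) \<longlonglongrightarrow> 0"
    unfolding tendsto_of_real_iff .
  thus False using L_one_nonzero by blast
qed

end

lemma connected_halfplane_punctured: "connected ({s::complex. Re s > 1/2} - {1})"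
  by (intro connected_open_delete convex_connected convex_halfspace_Re_gt open_halfspace_Re_gt) simp

text \<open>Identity theorem starting from Re s > 2, with 1 removed because G may be singular there.
  It carries nonvanishing from the functions in \<open>GRH\<close> to the explicit
  continuations.\<close>

lemma halfplane_agree:
  assumes "F holomorphic_on {s. Re s > 1/2}" "G holomorphic_on - {1}"
    and eq: "\<And>s. Re s > 2 \<Longrightarrow> F s = G s"
    and s: "Re s > 1/2" "s \<noteq> 1"
  shows "F s = G s"
proof (rule analytic_continuation_open[where f = F and g = G and z = s and s = "{s. Re s > 2}" and s' = "{s. Re s > 1/2} - {1}"])
  show "open {s::complex. Re s > 2}" "open ({s::complex. Re s > 1/2} - {1})"
    by (intro open_halfspace_Re_gt open_delete)+
  show "{s::complex. Re s > 2} \<noteq> {}" by (auto intro!: exI[of _ 3])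
  show "{s::complex. Re s > 2} \<subseteq> {s. Re s > 1/2} - {1}" by auto
  show "F holomorphic_on {s. Re s > 1/2} - {1}" "G holomorphic_on {s. Re s > 1/2} - {1}"
    using holomorphic_on_subset[OF assms(1), of "{s. Re s > 1/2} - {1}"]
      holomorphic_on_subset[OF assms(2), of "{s. Re s > 1/2} - {1}"] by auto
qed (use eq s connected_halfplane_punctured in auto)

text \<open>Away from 1 this is \<open>GRH\<close>; at 1 it is Monsky's argument.\<close>

lemma (in real_nonprincipal_char) Lfun_nonzero:
  assumes GRH and s: "Re s > 1/2"
  shows "Lfun s \<noteq> 0"
proof (cases "s = 1")
  case False
  have "dirichlet_char q (\<lambda>n. of_int (c n))"
    unfolding dirichlet_char_def using q one mult periodic zero_iff by auto
  then obtain L where L: "L holomorphic_on (- {1})"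
    "\<And>s. Re s > 1 \<Longrightarrow> (\<lambda>n. of_int (c (Suc n)) / of_nat (Suc n) powr s) sums L s"
    "\<And>s. Re s > 1/2 \<Longrightarrow> s \<noteq> 1 \<Longrightarrow> L s \<noteq> 0"
    using \<open>GRH\<close> unfolding GRH_def by blast
  have "Lfun s = L s" if "Re s > 2" for s
  proof -
    have "(\<lambda>n. of_int (c (Suc n)) * of_nat (Suc n) powr (-s)) sums L s"
      using L(2)[of s] that by (simp add: powr_minus field_simps)
    hence "(\<lambda>n. of_int (c n) * of_nat n powr (-s)) sums L s"
      by (subst (asm) sums_Suc_iff) simp
    thus ?thesis using Lfun_eq_dseries[OF that] by (simp add: dseries_def sums_iff)
  qed
  from halfplane_agree[OF Lfun_holomorphic L(1) this s False] L(3)[OF s False] show ?thesis by simp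
qed (use Lfun_one_nonzero in simp)

lemma ball_halfplane:
  assumes "s \<in> ball (complex_of_real \<sigma>) (\<sigma> - 5/8)" "\<sigma> > 3"
  shows "Re s > 1/2" "norm s \<le> 2 * \<sigma>"
proof -
  have "\<sigma> - Re s \<le> norm (of_real \<sigma> - s)" using complex_Re_le_cmod[of "of_real \<sigma> - s"] by simp
  thus "Re s > 1/2" using assms by (simp add: dist_norm)
  have "norm s \<le> norm (complex_of_real \<sigma>) + norm (of_real \<sigma> - s)"
    using norm_triangle_ineq4[of "of_real \<sigma>" "of_real \<sigma> - s"] by simp
  thus "norm s \<le> 2 * \<sigma>" using assms by (simp add: dist_norm)
qed

text \<open>The bound of \<open>kweight_sum_bound\<close> for M = 1 + Q (2 \<sigma> + 1)^2 Z32,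
  where |s| \<le> 2 \<sigma> on the disc. Q is the modulus of the character, and 1 for zeta.\<close>

definition kerr :: "real \<Rightarrow> nat \<Rightarrow> real \<Rightarrow> real" where
  "kerr \<sigma> k Q = fact (Suc k) * (16 * \<sigma> * ln (2 * (1 + Q * (2 * \<sigma> + 1) ^ 2 * Z32))) / (\<sigma> - 3/4) ^ Suc k"

lemma (in real_nonprincipal_char) kweight_char_sum:
  assumes GRH and \<sigma>: "\<sigma> > 3"
  shows "summable (\<lambda>m. kweight \<sigma> k m * c m)" "\<bar>\<Sum>m. kweight \<sigma> k m * c m\<bar> \<le> kerr \<sigma> k q"
proof -
  have "norm ((\<Sum>m. of_real (kweight \<sigma> k m) * complex_of_int (c m)) - of_nat 0 * fact k / of_real (\<sigma> - 1) ^ Suc k)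
    \<le> fact (Suc k) * (16 * \<sigma> * ln (2 * (1 + real q * (2 * \<sigma> + 1) ^ 2 * Z32))) / (\<sigma> - 3/4) ^ Suc k"
  proof (rule kweight_sum_bound[where F = Lfun])
    fix s assume s: "s \<in> ball (complex_of_real \<sigma>) (\<sigma> - 5/8)"
    have "norm (Lfun s) \<le> real q * (norm s + 1) ^ 2 * Z32"
      by (rule Lfun_bound) (use ball_halfplane[OF s \<sigma>] in simp)
    also have "\<dots> \<le> real q * (2 * \<sigma> + 1) ^ 2 * Z32"
      using ball_halfplane[OF s \<sigma>] Z32_nonneg
      by (intro mult_right_mono mult_left_mono power_mono) auto
    finally show "norm (Lfun s) \<le> 1 + real q * (2 * \<sigma> + 1) ^ 2 * Z32" by simp
  qed (use Lfun_holomorphic Lfun_nonzero[OF \<open>GRH\<close>] Lfun_eq_dseries \<sigma> Z32_nonneg in auto)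
  hence "norm (\<Sum>m. of_real (kweight \<sigma> k m) * complex_of_int (c m)) \<le> kerr \<sigma> k q"
    by (simp add: kerr_def)
  moreover have sm: "(\<lambda>m. complex_of_real (kweight \<sigma> k m * c m)) sums (\<Sum>m. of_real (kweight \<sigma> k m) * complex_of_int (c m))"
    using kweight_sums[of \<sigma> k] \<sigma> by (simp add: sums_iff)
  moreover from sm show s: "summable (\<lambda>m. kweight \<sigma> k m * c m)"
    using summable_complex_of_real sums_summable by blast
  moreover have "(\<Sum>m. of_real (kweight \<sigma> k m) * complex_of_int (c m)) = of_real (\<Sum>m. kweight \<sigma> k m * c m)"
    using sm suminf_of_real[OF s, where ?'a = complex] by (simp add: sums_iff)
  ultimately show "\<bar>\<Sum>m. kweight \<sigma> k m * c m\<bar> \<le> kerr \<sigma> k q" by simp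
qed

section \<open>The zeta function and the localised weights\<close>

text \<open>First-order Taylor remainder of z^(1-s) from n to n + 1. The powers n^(1-s) telescope
  from the initial 1, so 1 plus the sum of all terms is (s - 1) zeta(s).\<close>

definition zeta_term :: "nat \<Rightarrow> complex \<Rightarrow> complex" where
  "zeta_term n s = (if n = 0 then 0
     else (s - 1) * of_nat n powr (-s) - of_nat n powr (1 - s) + of_nat (Suc n) powr (1 - s))"

definition pole_free_zeta :: "complex \<Rightarrow> complex" where
  "pole_free_zeta s = 1 + (\<Sum>n. zeta_term n s)"

text \<open>Removing the linear part of z^(1-s) at n gives \<open>h\<close>, whose increment is the
  term. The derivative of \<open>h\<close> is itself a difference of powers, so the mean value bound
  is used twice and gains n^(-Re s - 1).\<close>

lemma zeta_term_bound:
  assumes s: "Re s > 1/2"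
  shows "norm (zeta_term n s) \<le> 1 * (norm s + 1) ^ 2 * real n powr (-3/2)"
proof (cases "n = 0")
  case False
  define S where "S = closed_segment (complex_of_real (real n)) (of_real (real (Suc n)))"
  define h where "h = (\<lambda>z. z powr (1 - s) - (1 - s) * of_nat n powr (-s) * z)"
  have "norm (h (of_real (real (Suc n))) - h (of_real (real n))) \<le>
    (norm (1 - s) * (norm s * real n powr (- Re s - 1))) * norm (complex_of_real (real (Suc n)) - of_real (real n))"
  proof (rule field_differentiable_bound[where S = S and f' = "\<lambda>z. (1 - s) * (z powr (-s) - of_nat n powr (-s))"])
    fix z assume "z \<in> S"
    hence "z \<in> of_real ` {real n..real (Suc n)}"
      by (simp add: S_def closed_segment_of_real closed_segment_eq_real_ivl del: of_real_of_nat_eq of_nat_Suc)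
    then obtain x where x: "z = of_real x" "real n \<le> x" "x \<le> real (Suc n)" by auto
    have zn: "z \<notin> \<real>\<^sub>\<le>\<^sub>0" using x False by auto
    have "((\<lambda>z. z powr (1 - s) - (1 - s) * of_nat n powr (-s) * z) has_field_derivative
        (1 - s) * z powr (-s) - (1 - s) * of_nat n powr (-s)) (at z)"
    proof -
      have e: "1 - s - 1 = - s" by simp
      show ?thesis
        using DERIV_diff[OF has_field_derivative_powr[OF zn, of "1 - s"] DERIV_cmult_Id[of "(1 - s) * of_nat n powr (-s)"]]
        unfolding e .
    qed
    thus "(h has_field_derivative (1 - s) * (z powr (-s) - of_nat n powr (-s))) (at z within S)"
      unfolding h_def right_diff_distrib by (rule has_field_derivative_at_within)
    have "norm (z powr (-s) - of_nat n powr (-s)) \<le> norm s * real n powr (- Re s - 1) * (x - real n)"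
      using nat_powr_diff_bound[of s "real n" x] s x False by simp
    also have "\<dots> \<le> norm s * real n powr (- Re s - 1) * 1"
      using x by (intro mult_left_mono) auto
    finally show "norm ((1 - s) * (z powr (-s) - of_nat n powr (-s))) \<le> norm (1 - s) * (norm s * real n powr (- Re s - 1))"
      unfolding norm_mult by (intro mult_left_mono) auto
  qed (auto simp: S_def)
  also have "norm (complex_of_real (real (Suc n)) - of_real (real n)) = 1" by simp
  also have "norm (1 - s) * (norm s * real n powr (- Re s - 1)) * 1 \<le> ((norm s + 1) * ((norm s + 1) * real n powr (-3/2))) * 1"
  proof (intro mult_right_mono mult_mono)
    show "norm (1 - s) \<le> norm s + 1" using norm_triangle_ineq4[of 1 s] by simp
    show "real n powr (- Re s - 1) \<le> real n powr (-3/2)"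
      using s False by (intro powr_mono) auto
  qed auto
  also have "h (of_real (real (Suc n))) - h (of_real (real n)) = zeta_term n s"
    using False by (simp add: h_def zeta_term_def algebra_simps)
  finally show ?thesis by (simp add: power2_eq_square mult_ac)
qed (simp add: zeta_term_def)

lemma pole_free_zeta_holomorphic: "pole_free_zeta holomorphic_on {s. Re s > 1/2}"
  unfolding pole_free_zeta_def
proof (intro holomorphic_intros series_continuation(1)[OF _ zeta_term_bound])
  show "zeta_term n holomorphic_on {s. Re s > 1/2}" for n
    unfolding zeta_term_def by (cases "n = 0") (auto intro!: holomorphic_intros)
qed

lemma
  assumes s: "Re s > 1/2"
  shows zeta_term_summable: "summable (\<lambda>n. zeta_term n s)"
    and pole_free_zeta_bound: "norm (pole_free_zeta s) \<le> 1 + (norm s + 1) ^ 2 * Z32"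
proof -
  have hol: "zeta_term n holomorphic_on {s. Re s > 1/2}" for n
    unfolding zeta_term_def by (cases "n = 0") (auto intro!: holomorphic_intros)
  show "summable (\<lambda>n. zeta_term n s)"
    by (rule series_continuation(2)[OF hol zeta_term_bound s])
  have "norm (\<Sum>n. zeta_term n s) \<le> 1 * (norm s + 1) ^ 2 * Z32"
    by (rule series_continuation(3)[OF hol zeta_term_bound s])
  thus "norm (pole_free_zeta s) \<le> 1 + (norm s + 1) ^ 2 * Z32"
    using norm_triangle_ineq[of 1 "\<Sum>n. zeta_term n s"] by (simp add: pole_free_zeta_def)
qed

interpretation one_cmult: cmult_fun "\<lambda>_. 1"
  by standard auto

lemma pole_free_zeta_eq:
  assumes s: "Re s > 2"
  shows "pole_free_zeta s = (s - 1) * dseries (\<lambda>_. 1) s"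
proof -
  have part: "1 + (\<Sum>n<Suc N. zeta_term n s) = (s - 1) * (\<Sum>n<Suc N. 1 * of_nat n powr (-s)) + of_nat (Suc N) powr (1 - s)" for N
    by (induction N) (simp_all add: zeta_term_def algebra_simps)
  have "(\<lambda>N. \<Sum>n<N. zeta_term n s) \<longlonglongrightarrow> (\<Sum>n. zeta_term n s)"
    using zeta_term_summable[of s] s by (intro summable_LIMSEQ) auto
  hence "(\<lambda>N. 1 + (\<Sum>n<Suc N. zeta_term n s)) \<longlonglongrightarrow> pole_free_zeta s"
    unfolding pole_free_zeta_def by (intro tendsto_intros LIMSEQ_Suc)
  moreover have "(\<lambda>N. (s - 1) * (\<Sum>n<Suc N. 1 * of_nat n powr (-s)) + of_nat (Suc N) powr (1 - s)) \<longlonglongrightarrow>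
     (s - 1) * dseries (\<lambda>_. 1) s + 0"
  proof (intro tendsto_intros LIMSEQ_Suc)
    show "(\<lambda>N. \<Sum>n<N. 1 * of_nat n powr (-s)) \<longlonglongrightarrow> dseries (\<lambda>_. 1) s"
      unfolding dseries_def
      by (rule summable_LIMSEQ, rule summable_norm_cancel, rule dseries_abs_summable[OF one_cmult.summable_chi])
         (use s in auto)
    show "(\<lambda>N. of_nat N powr (1 - s)) \<longlonglongrightarrow> 0"
    proof (rule Lim_null_comparison)
      show "\<forall>\<^sub>F N in sequentially. norm (of_nat N powr (1 - s)) \<le> real N powr (1 - Re s)"
        by (intro always_eventually allI) (simp add: norm_nat_powr)
      show "(\<lambda>N. real N powr (1 - Re s)) \<longlonglongrightarrow> 0"
        using s by (intro tendsto_neg_powr filterlim_real_sequentially) auto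
    qed
  qed
  ultimately show ?thesis unfolding part using LIMSEQ_unique by fastforce
qed

lemma pole_free_zeta_nonzero:
  assumes GRH and s: "Re s > 1/2"
  shows "pole_free_zeta s \<noteq> 0"
proof (cases "s = 1")
  case True
  \<comment> \<open>All terms vanish at 1, so the value there is 1, the residue of zeta.\<close>
  have "zeta_term n 1 = 0" for n
    by (simp add: zeta_term_def flip: of_nat_Suc)
  thus ?thesis using True by (simp add: pole_free_zeta_def)
next
  case False
  have "dirichlet_char 1 (\<lambda>_. 1)" by (simp add: dirichlet_char_def)
  then obtain L where L: "L holomorphic_on (- {1})"
    "\<And>s. Re s > 1 \<Longrightarrow> (\<lambda>n. 1 / of_nat (Suc n) powr s) sums L s"
    "\<And>s. Re s > 1/2 \<Longrightarrow> s \<noteq> 1 \<Longrightarrow> L s \<noteq> 0"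
    using \<open>GRH\<close> unfolding GRH_def by blast
  have "pole_free_zeta s = (s - 1) * L s" if "Re s > 2" for s
  proof -
    have "(\<lambda>n. 1 * of_nat (Suc n) powr (-s)) sums L s"
      using L(2)[of s] that by (simp add: powr_minus field_simps)
    hence "(\<lambda>n. 1 * of_nat n powr (-s)) sums L s"
      by (subst (asm) sums_Suc_iff) simp
    thus ?thesis using pole_free_zeta_eq[OF that] by (simp add: dseries_def sums_iff)
  qed
  moreover have "(\<lambda>s. (s - 1) * L s) holomorphic_on - {1}" by (intro holomorphic_intros L(1))
  ultimately have "pole_free_zeta s = (s - 1) * L s"
    using halfplane_agree[OF pole_free_zeta_holomorphic _ _ s False] by blast
  thus ?thesis using L(3)[OF s False] False by simp
qed

lemma kweight_main_sum:
  assumes GRH and \<sigma>: "\<sigma> > 3"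
  shows "summable (kweight \<sigma> k)" "\<bar>(\<Sum>m. kweight \<sigma> k m) - fact k / (\<sigma> - 1) ^ Suc k\<bar> \<le> kerr \<sigma> k 1"
proof -
  have "norm ((\<Sum>m. complex_of_real (kweight \<sigma> k m) * 1) - of_nat 1 * fact k / of_real (\<sigma> - 1) ^ Suc k)
    \<le> fact (Suc k) * (16 * \<sigma> * ln (2 * (1 + 1 * (2 * \<sigma> + 1) ^ 2 * Z32))) / (\<sigma> - 3/4) ^ Suc k"
  proof (rule one_cmult.kweight_sum_bound[where F = pole_free_zeta])
    fix s assume s: "s \<in> ball (complex_of_real \<sigma>) (\<sigma> - 5/8)"
    have "norm (pole_free_zeta s) \<le> 1 + (norm s + 1) ^ 2 * Z32"
      by (rule pole_free_zeta_bound) (use ball_halfplane[OF s \<sigma>] in simp)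
    also have "\<dots> \<le> 1 + (2 * \<sigma> + 1) ^ 2 * Z32"
      using ball_halfplane[OF s \<sigma>] Z32_nonneg
      by (intro add_left_mono mult_right_mono power_mono) auto
    finally show "norm (pole_free_zeta s) \<le> 1 + 1 * (2 * \<sigma> + 1) ^ 2 * Z32" by simp
  qed (use pole_free_zeta_holomorphic pole_free_zeta_nonzero[OF \<open>GRH\<close>] pole_free_zeta_eq \<sigma> Z32_nonneg in auto)
  hence bd: "norm ((\<Sum>m. of_real (kweight \<sigma> k m)) - complex_of_real (fact k / (\<sigma> - 1) ^ Suc k)) \<le> kerr \<sigma> k 1"
    by (simp add: kerr_def)
  have sm: "(\<lambda>m. complex_of_real (kweight \<sigma> k m)) sums (\<Sum>m. of_real (kweight \<sigma> k m))"
    using one_cmult.kweight_sums[of \<sigma> k] \<sigma> by (simp add: sums_iff)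
  thus s: "summable (kweight \<sigma> k)"
    using summable_complex_of_real sums_summable by blast
  have "(\<Sum>m. of_real (kweight \<sigma> k m)) = complex_of_real (\<Sum>m. kweight \<sigma> k m)"
    using sm suminf_of_real[OF s, where ?'a = complex] by (simp add: sums_iff)
  thus "\<bar>(\<Sum>m. kweight \<sigma> k m) - fact k / (\<sigma> - 1) ^ Suc k\<bar> \<le> kerr \<sigma> k 1"
    using bd by (simp only: norm_of_real flip: of_real_diff)
qed

text \<open>Exponential tilting: for every \<open>\<tau>\<close> the peak of \<open>u ^ k * exp (- (a - \<tau>) * u)\<close> is explicit.\<close>

lemma tilt:
  fixes a l u \<tau> :: real and k :: nat
  assumes k: "real k = a * l" and a: "a > 0" and l: "l > 0" and u: "u \<ge> 0" and \<tau>: "\<bar>\<tau>\<bar> \<le> a / 2"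
  shows "u ^ k * exp (- a * u) \<le> (l / exp 1) ^ k * exp (\<tau> * l + 2 * \<tau>\<^sup>2 * l / a - \<tau> * u)"
proof (cases "u = 0")
  case True
  have "k > 0" using k a l by (metis mult_pos_pos of_nat_0_less_iff)
  thus ?thesis using True l by (simp add: zero_power)
next
  case False
  hence u: "u > 0" using u by simp
  define t where "t = \<tau> / a"
  have t: "\<bar>t\<bar> \<le> 1/2" using \<tau> a by (simp add: t_def abs_div_pos[symmetric] field_simps)
  have t1: "1 - t > 0" using t by linarith
  have lnt: "- ln (1 - t) \<le> t + 2 * t\<^sup>2"
    using abs_ln_one_plus_x_minus_x_bound[of "-t"] t by (simp add: abs_le_iff)
  have "ln (u * (1 - t) / l) \<le> u * (1 - t) / l - 1"
    using u t1 l by (intro ln_le_minus_one) auto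
  hence "ln u \<le> ln l - ln (1 - t) + u * (1 - t) / l - 1"
    using u t1 l by (simp add: ln_div ln_mult)
  also have "\<dots> \<le> ln l + (t + 2 * t\<^sup>2) + u * (1 - t) / l - 1"
    using lnt by simp
  finally have "k * ln u \<le> k * (ln l + (t + 2 * t\<^sup>2) + u * (1 - t) / l - 1)"
    by (rule mult_left_mono) simp
  also have "\<dots> = k * (ln l - 1) + a * l * (t + 2 * t\<^sup>2) + a * u * (1 - t)"
    using l by (simp add: k field_simps)
  also have "\<dots> = k * (ln l - 1) + (\<tau> * l + 2 * \<tau>\<^sup>2 * l / a - \<tau> * u) + a * u"
    using a by (simp add: t_def field_simps power2_eq_square)
  finally have "exp (k * ln u - a * u) \<le> exp (k * (ln l - 1) + (\<tau> * l + 2 * \<tau>\<^sup>2 * l / a - \<tau> * u))"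
    by simp
  moreover have "exp (k * ln u - a * u) = u ^ k * exp (- a * u)"
    using u by (simp add: exp_diff exp_minus exp_of_nat_mult divide_inverse)
  moreover have "exp (k * (ln l - 1)) = (l / exp 1) ^ k"
    using l by (simp add: exp_of_nat_mult exp_diff)
  ultimately show ?thesis by (simp add: exp_add)
qed

section \<open>Discarding prime powers and integers outside the window\<close>

text \<open>Majorant for the discarded part: m^(-3) for integers outside the window, m^(-3/4) for
  proper prime powers. The latter still converges, because squares of primes contribute
  p^(-3/2).\<close>

definition tail_fun :: "nat \<Rightarrow> real" where
  "tail_fun m = mangoldt m * ((if prime m then 0 else real m powr (-3/4)) + real m powr (-3))"

lemma tail_fun_nonneg: "tail_fun m \<ge> 0"
  unfolding tail_fun_def by (intro mult_nonneg_nonneg mangoldt_nonneg) auto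

text \<open>Prime powers are written p^(j+1), and j = 0 contributes nothing. For j \<ge> 1 the
  factor p^(-3(j+1)/4) splits into p^(-3/2), summable against ln p, and p^(-3(j-1)/4), at most the
  same power of 2.\<close>

lemma summable_prime_power_part: "summable (\<lambda>m. mangoldt m * (if prime m then 0 else real m powr (-3/4)))"
proof -
  define f where "f = (\<lambda>m::nat. mangoldt m * (if prime m then 0 else real m powr (-3/4)) :: real)"
  have f0: "f m \<ge> 0" for m
    unfolding f_def by (intro mult_nonneg_nonneg mangoldt_nonneg) auto
  define P where "P = {p::nat. prime p}"
  define C where "C = 1 / (1 - 2 powr (-3/4 :: real))"
  have two: "2 powr (-3/4 :: real) < 1" by (simp add: powr_less_one)
  have fpow: "f (p ^ Suc j) \<le> ln (real p) * real p powr (-3/2) * (2 powr (-3/4)) ^ (j - 1) * (if j = 0 then 0 else 1)" if "p \<in> P" for p j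
  proof (cases "j = 0")
    case False
    have p: "prime p" using that by (simp add: P_def)
    have p2: "real p \<ge> 2" using prime_ge_2_nat[OF p] by simp
    have "real (p ^ Suc j) powr (-3/4) = (real p powr real (Suc j)) powr (-3/4)"
      using p2 by (subst powr_realpow) auto
    also have "\<dots> = (real p powr (-3/4)) powr real (Suc j)"
      by (simp only: powr_powr mult.commute)
    also have "\<dots> = (real p powr (-3/4)) ^ Suc j"
      using p2 by (intro powr_realpow) simp
    also have "(real p powr (-3/4)) ^ Suc j = (real p powr (-3/4)) ^ (2 + (j - 1))"
      using False by (intro arg_cong[where f = "(^) _"]) simp
    also have "(real p powr (-3/4)) ^ (2 + (j - 1)) = real p powr (-3/2) * (real p powr (-3/4)) ^ (j - 1)"
      using p2 by (simp add: power_add power2_eq_square flip: powr_add)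
    also have "\<dots> \<le> real p powr (-3/2) * (2 powr (-3/4)) ^ (j - 1)"
      using p2 by (intro mult_left_mono power_mono powr_mono2') auto
    finally have "ln (real p) * real (p ^ Suc j) powr (-3/4) \<le> ln (real p) * (real p powr (-3/2) * (2 powr (-3/4)) ^ (j - 1))"
      using p2 by (intro mult_left_mono) auto
    moreover have "f (p ^ Suc j) \<le> ln (real p) * real (p ^ Suc j) powr (-3/4)"
      unfolding f_def mangoldt_primepow[OF p] using p2 by simp
    ultimately show ?thesis using False by (simp add: mult.assoc)
  next
    case True
    thus ?thesis using that by (simp add: f_def P_def)
  qed
  have geo: "((\<lambda>j. ln (real p) * real p powr (-3/2) * (2 powr (-3/4)) ^ (j - 1) * (if j = 0 then 0 else 1)) has_sum
      ln (real p) * real p powr (-3/2) * C) UNIV" if "p \<in> P" for p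
  proof -
    have p2: "real p \<ge> 2" using prime_ge_2_nat[of p] that by (simp add: P_def)
    have "(\<lambda>j. (2 powr (-3/4 :: real)) ^ j) sums C"
      unfolding C_def by (rule geometric_sums) (use two in simp)
    hence "(\<lambda>j. (2 powr (-3/4 :: real)) ^ (j - 1) * (if j = 0 then 0 else 1)) sums C"
      using sums_Suc[where f = "\<lambda>j. (2 powr (-3/4 :: real)) ^ (j - 1) * (if j = 0 then 0 else 1)" and l = C] by simp
    hence "((\<lambda>j. (2 powr (-3/4 :: real)) ^ (j - 1) * (if j = 0 then 0 else 1)) has_sum C) UNIV"
      by (rule sums_nonneg_imp_has_sum) auto
    from has_sum_cmult_right[OF this, of "ln (real p) * real p powr (-3/2)"] show ?thesis by (simp add: mult.assoc)
  qed
  have "summable (\<lambda>n. ln (real n) * real n powr (-3/2))"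
  proof (rule summable_comparison_test'[where N = 1])
    show "summable (\<lambda>n. 4 * real n powr (-5/4))" by (intro summable_mult) (simp add: summable_real_powr_iff)
    fix n :: nat assume n: "n \<ge> 1"
    have "ln (real n) = 4 * ln (real n powr (1/4))" using n by (simp add: ln_powr)
    also have "\<dots> \<le> 4 * real n powr (1/4)" using n ln_le_minus_one[of "real n powr (1/4)"] by simp
    finally have "ln (real n) * real n powr (-3/2) \<le> 4 * real n powr (1/4) * real n powr (-3/2)"
      by (intro mult_right_mono) auto
    also have "\<dots> = 4 * real n powr (-5/4)" by (simp flip: powr_add)
    finally show "norm (ln (real n) * real n powr (-3/2)) \<le> 4 * real n powr (-5/4)" using n by simp
  qed
  hence "(\<lambda>n. ln (real n) * real n powr (-3/2)) summable_on UNIV"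
  proof (intro norm_summable_imp_summable_on)
    assume s: "summable (\<lambda>n. ln (real n) * real n powr (-3/2))"
    have "norm (ln (real n) * real n powr (-3/2)) = ln (real n) * real n powr (-3/2)" for n
      by (cases "n = 0") auto
    thus "summable (\<lambda>n. norm (ln (real n) * real n powr (-3/2)))" using s by simp
  qed
  hence "(\<lambda>n. ln (real n) * real n powr (-3/2)) summable_on P"
    by (rule summable_on_subset_banach) auto
  hence "(\<lambda>n. ln (real n) * real n powr (-3/2) * C) summable_on P"
    by (rule summable_on_cmult_left)
  hence "(\<lambda>(p, j). ln (real p) * real p powr (-3/2) * (2 powr (-3/4)) ^ (j - 1) * (if j = 0 then 0 else 1)) summable_on P \<times> (UNIV :: nat set)"
    using geo prime_ge_1_nat by (intro summable_on_SigmaI[where g = "\<lambda>p. ln (real p) * real p powr (-3/2) * C"]) (auto simp: P_def)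
  hence "(\<lambda>(p, j). f (p ^ Suc j)) summable_on P \<times> (UNIV :: nat set)"
    by (rule summable_on_comparison_test) (use fpow f0 in \<open>auto simp del: power_Suc\<close>)
  hence "(\<lambda>x. f (case x of (p, j) \<Rightarrow> p ^ Suc j)) summable_on P \<times> (UNIV :: nat set)"
    by (simp add: case_prod_unfold)
  hence "f summable_on {n. primepow n}"
    using summable_on_reindex_bij_betw[OF bij_betw_primepows[where ?'a = nat, unfolded Collect_const_case_prod], of f]
    by (simp add: P_def case_prod_unfold)
  hence "f summable_on UNIV"
    by (rule summable_on_cong_neutral[THEN iffD1, rotated -1]) (auto simp: f_def mangoldt_def)
  thus ?thesis unfolding f_def by (rule summable_on_imp_summable)
qed

lemma tail_fun_summable: "summable tail_fun"
proof -
  have "summable (\<lambda>m. mangoldt m * real m powr (-3))"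
  proof (rule summable_comparison_test'[OF summable_log_sq, of 1])
    fix m :: nat assume m: "m \<ge> 1"
    have "mangoldt m * real m powr (-3) \<le> ln (real m) * real m powr (-2)"
      using m mangoldt_le[of m] by (intro mult_mono powr_mono) auto
    also have "\<dots> = ln (real m) / real m ^ 2" using m by (simp add: powr_minus_divide powr_numeral)
    finally show "norm (mangoldt m * real m powr (-3)) \<le> ln (real m) / real m ^ 2"
      by (simp add: mangoldt_nonneg abs_mult)
  qed
  from summable_add[OF summable_prime_power_part this]
  show ?thesis unfolding tail_fun_def[abs_def] distrib_left .
qed

text \<open>The window has logarithmic centre l and endpoint ratio 2; for l = ln X + ln 2 / 2 it is
  X < m \<le> 2 X.\<close>

definition good_primes :: "real \<Rightarrow> nat set" where
  "good_primes l = {m. prime m \<and> exp (l - ln 2 / 2) < real m \<and> real m \<le> exp (l + ln 2 / 2)}"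

lemma finite_good_primes: "finite (good_primes l)"
proof (rule finite_subset)
  show "good_primes l \<subseteq> {..nat \<lfloor>exp (l + ln 2 / 2)\<rfloor>}"
    unfolding good_primes_def by (auto simp: le_nat_floor)
qed simp

text \<open>Apply \<open>tilt\<close> with \<tau> = -12 l below the window, 12 l above it and -1/4
  for nonprimes. Missing the window by ln 2 / 2 gains 12 l * ln 2 / 2 \<ge> 4 l in the exponent. Of
  this, 2 l pays for a factor m^(-2) and l for the quadratic cost 2 (12 l)^2 l / a, whence the
  constant 288; a saving exp(-l) remains.\<close>

lemma kweight_tail:
  fixes a l :: real
  assumes l: "l \<ge> 1" and a: "a \<ge> 288 * l\<^sup>2" and k: "real k = a * l" and m: "m \<notin> good_primes l"
  shows "kweight (a + 1) k m \<le> 4 * (l / exp 1) ^ k * exp (- l / 5) * tail_fun m"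
proof (cases "m = 0")
  case False
  define P where "P = (l / exp 1) ^ k"
  have P: "P \<ge> 0" using l by (simp add: P_def)
  define u where "u = ln (real m)"
  have u: "u \<ge> 0" "real m = exp u" using False by (auto simp: u_def)
  have l2: "l\<^sup>2 \<ge> l" using l by (simp add: power2_eq_square)
  have a0: "a > 0" and al: "12 * l \<le> a / 2" "1 / 4 \<le> a / 2" using a l2 l by linarith+
  have mang: "mangoldt m \<ge> (0 :: real)" by (rule mangoldt_nonneg)
  have powr_m: "real m powr x = exp (x * u)" for x
    using u by (simp add: powr_def)
  have kw: "kweight (a + 1) k m = mangoldt m * ((u ^ k * exp (- a * u)) * exp (- u))"
    by (simp add: kweight_def powr_m u_def[symmetric] algebra_simps flip: exp_add)
  have tl: "u ^ k * exp (- a * u) \<le> P * exp (\<tau> * l + 2 * \<tau>\<^sup>2 * l / a - \<tau> * u)" if "\<bar>\<tau>\<bar> \<le> a / 2" for \<tau>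
    unfolding P_def by (rule tilt) (use k a0 l u that in auto)
  have sq: "2 * (12 * l)\<^sup>2 * l / a \<le> l"
    using mult_right_mono[OF a, of l] a0 l by (simp add: field_simps power2_eq_square)
  have ln2: "ln 2 \<ge> (2/3 :: real)" "ln 2 \<le> (1 :: real)"
    using ln2_ge_two_thirds ln_le_minus_one[of 2] by auto
  have ll: "l * ln 2 \<ge> l * (2/3)" using ln2 l by (intro mult_left_mono) auto
  have far: "kweight (a + 1) k m \<le> 4 * P * exp (- l / 5) * tail_fun m"
    if b: "u ^ k * exp (- a * u) \<le> P * exp (- l + 1 - 2 * u)"
  proof -
    have "exp (- l + 1) \<le> 4 * exp (- l / 5)"
    proof -
      have "exp (- l + 1) = exp 1 * exp (- l)" by (simp flip: exp_add)
      also have "\<dots> \<le> 4 * exp (- l / 5)" using exp_le l by (intro mult_mono) auto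
      finally show ?thesis .
    qed
    hence "P * (exp (- l + 1) * exp (- 2 * u)) \<le> P * (4 * exp (- l / 5) * exp (- 2 * u))"
      using P by (intro mult_left_mono mult_right_mono) auto
    hence "(u ^ k * exp (- a * u)) * exp (- u) \<le> P * (4 * exp (- l / 5) * exp (- 2 * u)) * exp (- u)"
      using b by (intro mult_right_mono) (auto simp flip: exp_add)
    also have "\<dots> = 4 * P * exp (- l / 5) * real m powr (-3)"
      by (simp add: powr_m flip: exp_add)
    finally have "kweight (a + 1) k m \<le> mangoldt m * (4 * P * exp (- l / 5) * real m powr (-3))"
      unfolding kw using mang by (rule mult_left_mono)
    also have "\<dots> = 4 * P * exp (- l / 5) * (mangoldt m * real m powr (-3))" by simp
    also have "\<dots> \<le> 4 * P * exp (- l / 5) * tail_fun m"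
      unfolding tail_fun_def using P mang by (intro mult_left_mono) auto
    finally show ?thesis .
  qed
  consider "u \<le> l - ln 2 / 2" | "u > l + ln 2 / 2" | "\<not> prime m" "u \<le> l + ln 2 / 2"
  proof -
    have "\<not> prime m \<or> u \<le> l - ln 2 / 2 \<or> u > l + ln 2 / 2"
      using m unfolding good_primes_def by (auto simp: u(2))
    thus ?thesis using that by fastforce
  qed
  hence "kweight (a + 1) k m \<le> 4 * P * exp (- l / 5) * tail_fun m"
  proof cases
    case 1
    have "u ^ k * exp (- a * u) \<le> P * exp (-12 * l * l + 2 * (12 * l)\<^sup>2 * l / a + 12 * l * u)"
      using tl[of "-12 * l"] al l by (simp add: power_mult_distrib)
    also have "\<dots> \<le> P * exp (- l + 1 - 2 * u)"
    proof -
      have "(12 * l + 2) * u \<le> (12 * l + 2) * (l - ln 2 / 2)"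
        using 1 l by (intro mult_left_mono) auto
      hence "-12 * l * l + l + 12 * l * u \<le> - l + 1 - 2 * u"
        using ll ln2 by (simp add: algebra_simps)
      thus ?thesis using sq P by (intro mult_left_mono) auto
    qed
    finally show ?thesis by (rule far)
  next
    case 2
    have "u ^ k * exp (- a * u) \<le> P * exp (12 * l * l + 2 * (12 * l)\<^sup>2 * l / a - 12 * l * u)"
      using tl[of "12 * l"] al l by (simp add: power_mult_distrib)
    also have "\<dots> \<le> P * exp (- l + 1 - 2 * u)"
    proof -
      have "(12 * l - 2) * (l + ln 2 / 2) \<le> (12 * l - 2) * u"
        using 2 l by (intro mult_left_mono) auto
      hence "12 * l * l + l - 12 * l * u \<le> - l + 1 - 2 * u"
        using ll ln2 by (simp add: algebra_simps)
      thus ?thesis using sq P by (intro mult_left_mono) auto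
    qed
    finally show ?thesis by (rule far)
  next
    case 3
    \<comment> \<open>The tilt -1/4 gains exp(-l/4). Its quadratic cost l / (8 a) is at most l / 20,
      which leaves exp(-l/5).\<close>
    have "2 * (1/4)\<^sup>2 * l / a \<le> l / 20"
    proof -
      have "l * 20 \<le> l * (8 * a)" using al l by (intro mult_left_mono) auto
      thus ?thesis using a0 by (simp add: field_simps power2_eq_square)
    qed
    hence "P * exp (- (1/4) * l + 2 * (- (1/4))\<^sup>2 * l / a - - (1/4) * u) \<le> P * exp (- l / 5 + u / 4)"
      using P by (intro mult_left_mono) auto
    with tl[of "- (1/4)"] al have "u ^ k * exp (- a * u) \<le> P * exp (- l / 5 + u / 4)" by simp
    hence "(u ^ k * exp (- a * u)) * exp (- u) \<le> P * exp (- l / 5 + u / 4) * exp (- u)"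
      by (rule mult_right_mono) simp
    also have "\<dots> = P * exp (- l / 5) * real m powr (-3/4)"
      by (simp add: powr_m flip: exp_add)
    finally have "kweight (a + 1) k m \<le> mangoldt m * (P * exp (- l / 5) * real m powr (-3/4))"
      unfolding kw using mang by (rule mult_left_mono)
    also have "\<dots> = P * exp (- l / 5) * (mangoldt m * real m powr (-3/4))" by simp
    also have "\<dots> \<le> P * exp (- l / 5) * tail_fun m"
      unfolding tail_fun_def using P mang 3 by (intro mult_left_mono) auto
    also have "\<dots> \<le> 4 * P * exp (- l / 5) * tail_fun m"
      using P tail_fun_nonneg by (intro mult_right_mono) auto
    finally show ?thesis .
  qed
  thus ?thesis by (simp add: P_def)
qed (use tail_fun_nonneg[of 0] l in \<open>auto simp: kweight_def\<close>)

lemma good_primes_sum_approx: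
  fixes a l :: real
  assumes l: "l \<ge> 1" and a: "a \<ge> 288 * l\<^sup>2" and k: "real k = a * l"
    and f: "\<And>m. \<bar>f m\<bar> \<le> 1" and s: "summable (\<lambda>m. kweight (a + 1) k m * f m)"
  shows "\<bar>(\<Sum>m. kweight (a + 1) k m * f m) - (\<Sum>m\<in>good_primes l. kweight (a + 1) k m * f m)\<bar>
     \<le> 4 * (l / exp 1) ^ k * exp (- l / 5) * (\<Sum>m. tail_fun m)"
proof -
  let ?g = "\<lambda>m. kweight (a + 1) k m * f m"
  have fin: "(\<lambda>m. if m \<in> good_primes l then ?g m else 0) sums (\<Sum>m\<in>good_primes l. ?g m)"
    by (rule sums_If_finite_set[OF finite_good_primes])
  have "(\<lambda>m. ?g m - (if m \<in> good_primes l then ?g m else 0)) sums ((\<Sum>m. ?g m) - (\<Sum>m\<in>good_primes l. ?g m))"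
    by (rule sums_diff[OF summable_sums[OF s] fin])
  hence eq: "(\<Sum>m. ?g m) - (\<Sum>m\<in>good_primes l. ?g m) = (\<Sum>m. ?g m - (if m \<in> good_primes l then ?g m else 0))"
    by (simp add: sums_iff)
  have sm: "summable (\<lambda>m. 4 * (l / exp 1) ^ k * exp (- l / 5) * tail_fun m)"
    by (intro summable_mult tail_fun_summable)
  have "norm (\<Sum>m. ?g m - (if m \<in> good_primes l then ?g m else 0)) \<le> (\<Sum>m. 4 * (l / exp 1) ^ k * exp (- l / 5) * tail_fun m)"
  proof (rule norm_suminf_le[OF _ sm])
    fix m
    show "norm (?g m - (if m \<in> good_primes l then ?g m else 0)) \<le> 4 * (l / exp 1) ^ k * exp (- l / 5) * tail_fun m"
    proof (cases "m \<in> good_primes l")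
      case True
      thus ?thesis using tail_fun_nonneg l by simp
    next
      case False
      have "\<bar>?g m\<bar> \<le> kweight (a + 1) k m * 1"
        unfolding abs_mult using f kweight_nonneg by (intro mult_mono) auto
      also have "\<dots> \<le> 4 * (l / exp 1) ^ k * exp (- l / 5) * tail_fun m"
        using kweight_tail[OF l a k False] by simp
      finally show ?thesis using False by simp
    qed
  qed
  thus ?thesis by (simp add: eq suminf_mult[OF tail_fun_summable])
qed

section \<open>Errors relative to the main term and choice of k and a\<close>

lemma power_div_exp_le_fact: "(real k / exp 1) ^ k \<le> fact k"
proof -
  have "(\<lambda>n. real k ^ n /\<^sub>R fact n) sums exp (real k)" by (rule exp_converges)
  hence "(\<Sum>n\<in>{k}. real k ^ n /\<^sub>R fact n) \<le> exp (real k)"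
    using sum_le_suminf[of "\<lambda>n. real k ^ n /\<^sub>R fact n" "{k}"] by (auto simp: sums_iff)
  hence "real k ^ k / fact k \<le> exp 1 ^ k"
    by (simp add: divide_inverse mult.commute flip: exp_of_nat_mult)
  thus ?thesis by (simp add: power_divide field_simps)
qed

text \<open>Compares the height (l / e)^k in the tail bounds with the main term. Only a factor a is
  lost, polynomial in l for the chosen parameters, so exponential savings survive.\<close>

lemma peak_le_main:
  fixes a l :: real
  assumes "a > 0" "l > 0" "real k = a * l"
  shows "(l / exp 1) ^ k \<le> a * (fact k / a ^ Suc k)"
proof -
  have "(l / exp 1) ^ k = (real k / exp 1) ^ k / a ^ k"
    using assms by (simp add: power_divide[symmetric])
  also have "\<dots> \<le> fact k / a ^ k"
    using assms by (intro divide_right_mono power_div_exp_le_fact) auto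
  finally show ?thesis using assms by simp
qed

text \<open>The radius a + 1/4 beats the distance a to the pole: (a / (a + 1/4))^k \<le> exp(- a l /
  (4 a + 1)) \<le> exp(- l / 5), the last step by a \<ge> 1.\<close>

lemma kerr_le_main:
  fixes a l :: real
  assumes a: "a \<ge> 1" and l: "l > 0" and k: "real k = a * l" and Q: "Q \<ge> 1"
  shows "kerr (a + 1) k Q \<le> fact k / a ^ Suc k * exp (- l / 5) *
           (real (Suc k) * (16 * (a + 1) * ln (2 * (1 + Q * (2 * (a + 1) + 1) ^ 2 * Z32))))"
proof -
  define L where "L = 16 * (a + 1) * ln (2 * (1 + Q * (2 * (a + 1) + 1) ^ 2 * Z32))"
  have "Q * (2 * (a + 1) + 1) ^ 2 * Z32 \<ge> 0" using Q Z32_nonneg by simp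
  hence L: "L \<ge> 0" unfolding L_def using a by (intro mult_nonneg_nonneg ln_ge_zero) auto
  have r: "a / (a + 1/4) \<le> exp (- 1 / (4 * a + 1))"
  proof -
    have "a / (a + 1/4) = 1 + - 1 / (4 * a + 1)" using a by (simp add: field_simps)
    also have "\<dots> \<le> exp (- 1 / (4 * a + 1))" by (rule exp_ge_add_one_self)
    finally show ?thesis .
  qed
  have "(a / (a + 1/4)) ^ Suc k \<le> (a / (a + 1/4)) ^ k"
    using a by (intro power_decreasing) (auto simp: field_simps)
  also have "\<dots> \<le> exp (- 1 / (4 * a + 1)) ^ k"
    using r a by (intro power_mono) auto
  also have "\<dots> = exp (- (a * l) / (4 * a + 1))"
    using k by (simp flip: exp_of_nat_mult)
  also have "\<dots> \<le> exp (- l / 5)"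
  proof -
    have "l * 1 \<le> l * a" using a l by (intro mult_left_mono) auto
    thus ?thesis using a l by (simp add: field_simps)
  qed
  finally have pw: "(a / (a + 1/4)) ^ Suc k \<le> exp (- l / 5)" .
  have ap: "a ^ Suc k > 0" "(a + 1/4) ^ Suc k > 0" using a by (auto intro!: zero_less_power)
  have "kerr (a + 1) k Q = fact (Suc k) * L / (a + 1/4) ^ Suc k"
  proof -
    have "a + 1 - 3/4 = a + 1/4" by simp
    thus ?thesis by (simp only: kerr_def L_def)
  qed
  also have "\<dots> = fact k / a ^ Suc k * (a / (a + 1/4)) ^ Suc k * (real (Suc k) * L)"
    using ap a unfolding power_divide fact_Suc by (simp add: divide_simps del: power_Suc)
  also have "\<dots> \<le> fact k / a ^ Suc k * exp (- l / 5) * (real (Suc k) * L)"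
    using pw L a by (intro mult_left_mono mult_right_mono) auto
  finally show ?thesis by (simp add: L_def)
qed

text \<open>With k near 300 l^3 the quotient a = k / l is near 300 l^2, above the 288 l^2 demanded
  by \<open>kweight_tail\<close>. Defining a from the rounded k keeps k = a l exact.\<close>

definition kparam :: "real \<Rightarrow> nat" where "kparam l = nat \<lceil>300 * l ^ 3\<rceil>"
definition aparam :: "real \<Rightarrow> real" where "aparam l = real (kparam l) / l"

lemma params:
  assumes l: "l \<ge> 1"
  shows "real (kparam l) = aparam l * l" "aparam l \<ge> 288 * l\<^sup>2" "aparam l \<ge> 1" "aparam l \<le> 301 * l\<^sup>2"
    "real (Suc (kparam l)) \<le> 302 * l ^ 3" "aparam l + 1 \<le> 302 * l\<^sup>2"
proof -
  have l3: "l ^ 3 \<ge> 1" "l\<^sup>2 \<ge> 1" using l by (auto simp: one_le_power)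
  have k: "real (kparam l) \<ge> 300 * l ^ 3" "real (kparam l) \<le> 300 * l ^ 3 + 1"
    unfolding kparam_def using l3 by linarith+
  show "real (kparam l) = aparam l * l" using l by (simp add: aparam_def)
  have "300 * l ^ 3 / l \<le> aparam l" unfolding aparam_def using k l by (intro divide_right_mono) auto
  hence a: "300 * l\<^sup>2 \<le> aparam l" using l by (simp add: power3_eq_cube power2_eq_square)
  thus "aparam l \<ge> 288 * l\<^sup>2" "aparam l \<ge> 1" using l3 by linarith+
  have "real (kparam l) \<le> 300 * l ^ 3 + l ^ 3" using k(2) l3(1) by linarith
  hence "aparam l \<le> (300 * l ^ 3 + l ^ 3) / l"
    unfolding aparam_def using l by (intro divide_right_mono) auto
  also have "\<dots> = 301 * l\<^sup>2" using l by (simp add: power3_eq_cube power2_eq_square)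
  finally show "aparam l \<le> 301 * l\<^sup>2" .
  thus "aparam l + 1 \<le> 302 * l\<^sup>2" using l3 by linarith
  show "real (Suc (kparam l)) \<le> 302 * l ^ 3" using k(2) l3(1) unfolding of_nat_Suc by linarith
qed

definition mainterm :: "real \<Rightarrow> real" where
  "mainterm l = fact (kparam l) / aparam l ^ Suc (kparam l)"

definition lweight :: "real \<Rightarrow> nat \<Rightarrow> real" where
  "lweight l = kweight (aparam l + 1) (kparam l)"

text \<open>The saving exp(-l/5) absorbs all polynomial losses and leaves exp(-l/6); a modulus up to
  exp(l^4) costs only a factor polynomial in l. The 1/8 anticipates
  \<open>lweight_kronecker_bound\<close>, where the total weight is shown to be at least
  \<open>mainterm l / 8\<close>.\<close>

lemma error_eventually:
  "\<forall>\<^sub>F l in at_top. l \<ge> 1 \<and> (\<forall>Q. 1 \<le> Q \<and> Q \<le> exp (l ^ 4) \<longrightarrow>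
     kerr (aparam l + 1) (kparam l) Q + 4 * (l / exp 1) ^ kparam l * exp (- l / 5) * (\<Sum>m. tail_fun m)
      \<le> mainterm l * (exp (- l / 6) / 8))"
proof -
  define T where "T = (\<Sum>m. tail_fun m) + 1"
  have T: "T > 0" "(\<Sum>m. tail_fun m) \<le> T"
    unfolding T_def using suminf_nonneg[OF tail_fun_summable] tail_fun_nonneg by (auto intro: add_nonneg_pos)
  define Z where "Z = Z32 + 1"
  have Z: "Z > 0" "Z32 \<le> Z" unfolding Z_def using Z32_nonneg by auto
  \<comment> \<open>302 l^3 and 302 l^2 bound k + 1 and a + 1, the 605 is 2 * 302 + 1, and 301 l^2
    bounds the factor a lost in \<open>peak_le_main\<close>.\<close>
  have "\<forall>\<^sub>F l in at_top. exp (- l / 5) * (302 * l ^ 3 * (16 * (302 * l\<^sup>2) * (l ^ 4 + ln (2 * (1 + (605 * l\<^sup>2) ^ 2 * Z)))))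
     + 4 * (301 * l\<^sup>2) * exp (- l / 5) * T \<le> exp (- l / 6) / 8"
    using T(1) Z(1) by real_asymp
  moreover have "\<forall>\<^sub>F l in at_top. l \<ge> (1::real)" by (rule eventually_ge_at_top)
  ultimately show ?thesis
  proof eventually_elim
    case (elim l)
    note l = elim(2) and p = params[OF elim(2)]
    define a where "a = aparam l"
    define k where "k = kparam l"
    have mt: "mainterm l \<ge> 0" unfolding mainterm_def using p by simp
    show ?case
    proof (intro conjI allI impI l)
      fix Q :: real assume Q: "1 \<le> Q \<and> Q \<le> exp (l ^ 4)"
      have "2 * (1 + Q * (2 * (a + 1) + 1) ^ 2 * Z32) \<le> exp (l ^ 4) * (2 * (1 + (605 * l\<^sup>2) ^ 2 * Z))"
      proof -
        have "2 * (a + 1) + 1 \<le> 605 * l\<^sup>2" 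
        proof -
          have "2 * x + 1 \<le> 605 * y" if "x \<le> 302 * y" "1 \<le> y" for x y :: real
            using that by linarith
          from this[OF p(6) one_le_power[OF l]] show ?thesis by (simp add: a_def)
        qed
        hence "(2 * (a + 1) + 1) ^ 2 * Z32 \<le> (605 * l\<^sup>2) ^ 2 * Z"
          using p Z Z32_nonneg by (intro mult_mono power_mono) (auto simp: a_def)
        hence "Q * ((2 * (a + 1) + 1) ^ 2 * Z32) \<le> exp (l ^ 4) * ((605 * l\<^sup>2) ^ 2 * Z)"
          using Q Z32_nonneg by (intro mult_mono[of Q "exp (l ^ 4)"]) (auto simp del: power_mult_numeral)
        moreover have "1 \<le> exp (l ^ 4)" using l by simp
        moreover have "2 * (1 + Q * x * z) \<le> E * (2 * (1 + y))" if "Q * (x * z) \<le> E * y" "1 \<le> E" for x y z E :: real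
          using that by (simp add: algebra_simps)
        ultimately show ?thesis by blast
      qed
      moreover have "0 < 2 * (1 + Q * (2 * (a + 1) + 1) ^ 2 * Z32)"
        using Q Z32_nonneg by (intro mult_pos_pos add_pos_nonneg) auto
      ultimately have "ln (2 * (1 + Q * (2 * (a + 1) + 1) ^ 2 * Z32)) \<le> ln (exp (l ^ 4) * (2 * (1 + (605 * l\<^sup>2) ^ 2 * Z)))"
        by (subst ln_le_cancel_iff) auto
      also have "\<dots> = l ^ 4 + ln (2 * (1 + (605 * l\<^sup>2) ^ 2 * Z))"
      proof -
        have "2 * (1 + (605 * l\<^sup>2) ^ 2 * Z) > 0"
          using Z by (intro mult_pos_pos add_pos_nonneg mult_nonneg_nonneg) auto
        from ln_mult_pos[OF exp_gt_zero this] show ?thesis by simp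
      qed
      finally have L: "ln (2 * (1 + Q * (2 * (a + 1) + 1) ^ 2 * Z32)) \<le> l ^ 4 + ln (2 * (1 + (605 * l\<^sup>2) ^ 2 * Z))" .
      have L0: "0 \<le> ln (2 * (1 + Q * (2 * (a + 1) + 1) ^ 2 * Z32))"
      proof (rule ln_ge_zero)
        have "Q * (2 * (a + 1) + 1) ^ 2 * Z32 \<ge> 0" using Q Z32_nonneg by simp
        thus "1 \<le> 2 * (1 + Q * (2 * (a + 1) + 1) ^ 2 * Z32)" by simp
      qed
      have "kerr (a + 1) k Q \<le> fact k / a ^ Suc k * exp (- l / 5) *
           (real (Suc k) * (16 * (a + 1) * ln (2 * (1 + Q * (2 * (a + 1) + 1) ^ 2 * Z32))))"
        by (rule kerr_le_main) (use p l Q in \<open>auto simp: a_def k_def\<close>)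
      also have "fact k / a ^ Suc k = mainterm l" by (simp add: mainterm_def a_def k_def)
      also have "mainterm l * exp (- l / 5) * (real (Suc k) * (16 * (a + 1) * ln (2 * (1 + Q * (2 * (a + 1) + 1) ^ 2 * Z32))))
         \<le> mainterm l * exp (- l / 5) * (302 * l ^ 3 * (16 * (302 * l\<^sup>2) * (l ^ 4 + ln (2 * (1 + (605 * l\<^sup>2) ^ 2 * Z)))))"
        by (rule mult_left_mono, intro mult_mono)
           (use p l L L0 mt in \<open>auto simp: a_def k_def simp del: of_nat_Suc intro!: mult_nonneg_nonneg\<close>)
      finally have 1: "kerr (a + 1) k Q \<le> mainterm l * (exp (- l / 5) * (302 * l ^ 3 * (16 * (302 * l\<^sup>2) * (l ^ 4 + ln (2 * (1 + (605 * l\<^sup>2) ^ 2 * Z))))))"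
        by (simp only: mult.assoc)
      have "(l / exp 1) ^ k \<le> a * mainterm l"
        unfolding mainterm_def a_def k_def by (rule peak_le_main) (use p l in auto)
      also have "\<dots> \<le> 301 * l\<^sup>2 * mainterm l" using p mt by (intro mult_right_mono) (auto simp: a_def)
      finally have "4 * (l / exp 1) ^ k * exp (- l / 5) * (\<Sum>m. tail_fun m) \<le> 4 * (301 * l\<^sup>2 * mainterm l) * exp (- l / 5) * T"
        using T suminf_nonneg[OF tail_fun_summable] tail_fun_nonneg mt l
        by (intro mult_mono mult_nonneg_nonneg) auto
      hence 2: "4 * (l / exp 1) ^ k * exp (- l / 5) * (\<Sum>m. tail_fun m) \<le> mainterm l * (4 * (301 * l\<^sup>2) * exp (- l / 5) * T)"
        by (simp add: mult_ac)
      have "kerr (a + 1) k Q + 4 * (l / exp 1) ^ k * exp (- l / 5) * (\<Sum>m. tail_fun m) \<le>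
         mainterm l * (exp (- l / 5) * (302 * l ^ 3 * (16 * (302 * l\<^sup>2) * (l ^ 4 + ln (2 * (1 + (605 * l\<^sup>2) ^ 2 * Z)))))
           + 4 * (301 * l\<^sup>2) * exp (- l / 5) * T)"
        using add_mono[OF 1 2] by (simp only: distrib_left)
      also have "\<dots> \<le> mainterm l * (exp (- l / 6) / 8)"
        by (rule mult_left_mono[OF elim(1) mt])
      finally show "kerr (aparam l + 1) (kparam l) Q + 4 * (l / exp 1) ^ kparam l * exp (- l / 5) * (\<Sum>m. tail_fun m)
        \<le> mainterm l * (exp (- l / 6) / 8)" by (simp add: a_def k_def)
    qed
  qed
qed

section \<open>Kronecker symbols as characters\<close>

lemma Legendre_cong:
  assumes "[a = b] (mod p)"
  shows "Legendre a p = Legendre b p"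
proof -
  have "[a = 0] (mod p) \<longleftrightarrow> [b = 0] (mod p)" using assms cong_trans cong_sym by blast
  moreover have "QuadRes p a \<longleftrightarrow> QuadRes p b" unfolding QuadRes_def using assms cong_trans cong_sym by blast
  ultimately show ?thesis by (simp add: Legendre_def)
qed

text \<open>Euler's criterion gives the congruence modulo p. Both sides lie in {-1, 0, 1}, so they
  differ by at most 2 < p.\<close>

lemma Legendre_mult:
  assumes p: "prime p" "2 < p"
  shows "Legendre (a * b) (int p) = Legendre a (int p) * Legendre b (int p)"
proof -
  have "[Legendre (a * b) (int p) = (a * b) ^ ((p - 1) div 2)] (mod int p)"
    by (rule euler_criterion[OF p])
  moreover have "[Legendre a (int p) * Legendre b (int p) = (a * b) ^ ((p - 1) div 2)] (mod int p)"
    unfolding power_mult_distrib by (intro cong_mult euler_criterion[OF p])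
  ultimately have "[Legendre (a * b) (int p) = Legendre a (int p) * Legendre b (int p)] (mod int p)"
    using cong_trans cong_sym by blast
  hence d: "int p dvd Legendre (a * b) (int p) - Legendre a (int p) * Legendre b (int p)"
    by (simp add: cong_iff_dvd_diff)
  have "\<bar>Legendre (a * b) (int p) - Legendre a (int p) * Legendre b (int p)\<bar> < int p"
    using p by (auto simp: Legendre_def)
  with d show ?thesis using zdvd_not_zless[of "\<bar>Legendre (a * b) (int p) - Legendre a (int p) * Legendre b (int p)\<bar>" "int p"]
    by fastforce
qed

text \<open>Otherwise squaring would map {1..<p} onto itself, hence injectively, although 1 and p -
  1 have the same square.\<close>

lemma ex_nonresidue:
  assumes p: "prime p" "2 < (p::nat)"
  shows "\<exists>g::nat. Legendre (int g) (int p) = -1"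
proof (rule ccontr)
  assume no: "\<nexists>g::nat. Legendre (int g) (int p) = -1"
  define f where "f = (\<lambda>x. x\<^sup>2 mod p)"
  have fin: "finite {1..<p}" by simp
  have surj: "{1..<p} \<subseteq> f ` {1..<p}"
  proof
    fix a assume a: "a \<in> {1..<p}"
    hence nd: "\<not> int p dvd int a" using nat_dvd_not_less[of a p] by auto
    have "QuadRes (int p) (int a)"
      using no nd by (auto simp: Legendre_def cong_0_iff split: if_splits)
    then obtain y where y: "[y\<^sup>2 = int a] (mod int p)" unfolding QuadRes_def by blast
    define x where "x = nat (y mod int p)"
    have x: "int x = y mod int p" "x < p" using p by (auto simp: x_def nat_less_iff)
    have "int (x\<^sup>2 mod p) = y\<^sup>2 mod int p"
      by (simp add: x zmod_int power_mod)
    also have "\<dots> = int a" using y a by (simp add: cong_def)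
    finally have "f x = a" by (simp add: f_def)
    moreover have "x \<noteq> 0"
    proof
      assume "x = 0"
      thus False using \<open>f x = a\<close> a by (simp add: f_def)
    qed
    ultimately show "a \<in> f ` {1..<p}" using x by force
  qed
  have "f ` {1..<p} \<subseteq> {1..<p}"
  proof
    fix b assume "b \<in> f ` {1..<p}"
    then obtain x where x: "x \<in> {1..<p}" "b = x\<^sup>2 mod p" by (auto simp: f_def)
    have "\<not> p dvd x\<^sup>2" using x p nat_dvd_not_less[of x p] prime_dvd_power[of p x 2] by auto
    thus "b \<in> {1..<p}" using x p by (auto simp: dvd_eq_mod_eq_0 Suc_le_eq)
  qed
  with surj have "f ` {1..<p} = {1..<p}" by blast
  hence inj: "inj_on f {1..<p}" by (intro eq_card_imp_inj_on) auto
  have "f (p - 1) = f 1"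
  proof -
    have "[int (p - 1) = -1] (mod int p)" using p by (simp add: cong_iff_dvd_diff of_nat_diff)
    hence "[int (p - 1) ^ 2 = (-1) ^ 2] (mod int p)" by (rule cong_pow)
    hence "[(p - 1)\<^sup>2 = 1\<^sup>2] (mod p)" by (simp flip: cong_int_iff)
    thus ?thesis by (simp add: f_def cong_def)
  qed
  moreover have "p - 1 \<in> {1..<p}" "1 \<in> {1..<p}" "p - 1 \<noteq> 1" using p by auto
  ultimately show False using inj by (metis inj_onD)
qed

lemma kronecker_prime_mult:
  assumes "prime p"
  shows "kronecker_prime (a * b) p = kronecker_prime a p * kronecker_prime b p"
proof (cases "p = 2")
  case True
  show ?thesis
  proof (cases "even a \<or> even b")
    case False
    hence "a mod 8 = 1 \<or> a mod 8 = 3 \<or> a mod 8 = 5 \<or> a mod 8 = 7"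
      "b mod 8 = 1 \<or> b mod 8 = 3 \<or> b mod 8 = 5 \<or> b mod 8 = 7" by presburger+
    moreover have "(a * b) mod 8 = ((a mod 8) * (b mod 8)) mod 8" by (simp add: mod_mult_eq)
    ultimately show ?thesis using False True unfolding kronecker_prime_def
      by (elim disjE) (simp_all del: mod_mult_eq)
  qed (use True in \<open>auto simp: kronecker_prime_def\<close>)
next
  case False
  hence "2 < p" using assms prime_ge_2_nat[of p] by linarith
  thus ?thesis using False assms by (simp add: kronecker_prime_def Legendre_mult)
qed

lemma kronecker_prime_cong:
  assumes "prime p" "[a = b] (mod (8 * int p))"
  shows "kronecker_prime a p = kronecker_prime b p"
proof (cases "p = 2")
  case True
  hence "[a = b] (mod 8)" using assms(2) cong_dvd_modulus[of a b "8 * int p" 8] by simp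
  hence "a mod 8 = b mod 8" by (simp add: cong_def)
  moreover from this have "even a \<longleftrightarrow> even b" by presburger
  ultimately show ?thesis using True by (simp add: kronecker_prime_def)
next
  case False
  have "[a = b] (mod int p)" by (rule cong_dvd_modulus[OF assms(2)]) simp
  thus ?thesis using False by (simp add: kronecker_prime_def Legendre_cong)
qed

lemma kronecker_prime_range: "kronecker_prime a p \<in> {-1, 0, 1}"
  by (auto simp: kronecker_prime_def Legendre_def)

lemma kronecker_prime_eq_0_iff:
  assumes "prime p"
  shows "kronecker_prime (int m) p = 0 \<longleftrightarrow> p dvd m"
  using assms by (auto simp: kronecker_prime_def Legendre_def cong_0_iff)

lemma kronecker_prime_one: "prime p \<Longrightarrow> kronecker_prime 1 p = 1"
proof (cases "p = 2")
  case False
  assume p: "prime p"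
  have "\<not> [1 = 0] (mod int p)" using p by (auto simp: cong_0_iff)
  moreover have "QuadRes (int p) 1" unfolding QuadRes_def by (rule exI[of _ 1]) simp
  ultimately show ?thesis using False by (simp add: kronecker_prime_def Legendre_def)
qed (simp add: kronecker_prime_def)

lemma kronecker_mult_left: "kronecker (a * b) n = kronecker a n * kronecker b n"
proof -
  have "kronecker (a * b) n = (\<Prod>p\<in>prime_factors n. kronecker_prime a p ^ multiplicity p n * kronecker_prime b p ^ multiplicity p n)"
    unfolding kronecker_def
    by (intro prod.cong refl) (simp add: kronecker_prime_mult power_mult_distrib in_prime_factors_iff)
  thus ?thesis by (simp add: kronecker_def prod.distrib)
qed

lemma kronecker_mult_right:
  assumes "m > 0" "n > 0"
  shows "kronecker d (m * n) = kronecker d m * kronecker d n"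
proof -
  let ?f = "\<lambda>k p. kronecker_prime d p ^ multiplicity p k"
  have ext: "kronecker d k = (\<Prod>p\<in>prime_factors (m * n). ?f k p)" if "k dvd m * n" for k
  proof -
    have k: "k \<noteq> 0" using that assms by (metis dvd_0_left_iff mult_is_0 not_gr_zero)
    have "prime_factors k \<subseteq> prime_factors (m * n)"
      by (rule dvd_prime_factors) (use that assms in auto)
    thus ?thesis unfolding kronecker_def using k
      by (intro prod.mono_neutral_left)
         (auto simp: in_prime_factors_iff not_dvd_imp_multiplicity_0)
  qed
  have "kronecker d (m * n) = (\<Prod>p\<in>prime_factors (m * n). ?f m p * ?f n p)"
    unfolding kronecker_def using assms
    by (intro prod.cong refl)
       (auto simp: prime_elem_multiplicity_mult_distrib in_prime_factors_iff power_add)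
  thus ?thesis using ext[of m] ext[of n] by (simp add: prod.distrib)
qed

lemma kronecker_Suc_0 [simp]: "kronecker d (Suc 0) = 1"
  by (simp add: kronecker_def)

lemma kronecker_prime_right: "prime p \<Longrightarrow> kronecker d p = kronecker_prime d p"
  by (simp add: kronecker_def prime_factorization_prime)

lemma kronecker_range: "kronecker a n \<in> {-1, 0, 1}"
proof -
  have "\<bar>kronecker a n\<bar> \<le> 1"
    unfolding kronecker_def abs_prod power_abs
  proof (rule prod_le_1)
    fix p assume "p \<in> prime_factors n"
    have "\<bar>kronecker_prime a p\<bar> \<le> 1" using kronecker_prime_range[of a p] by auto
    thus "0 \<le> \<bar>kronecker_prime a p\<bar> ^ multiplicity p n \<and> \<bar>kronecker_prime a p\<bar> ^ multiplicity p n \<le> 1"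
      by (simp add: power_le_one)
  qed
  thus ?thesis by auto
qed

lemma kronecker_one_left: "kronecker 1 n = 1"
  unfolding kronecker_def by (rule prod.neutral) (simp add: kronecker_prime_one in_prime_factors_iff)

text \<open>This periodicity in d turns averages over discriminants into character sums. The factor
  8 accounts for the prime 2.\<close>

lemma kronecker_cong:
  assumes "[a = b] (mod (8 * int n))"
  shows "kronecker a n = kronecker b n"
  unfolding kronecker_def
proof (rule prod.cong[OF refl])
  fix p assume p: "p \<in> prime_factors n"
  have "[a = b] (mod (8 * int p))"
    by (rule cong_dvd_modulus[OF assms]) (use p in \<open>auto simp: in_prime_factors_iff intro!: mult_dvd_mono\<close>)
  thus "kronecker_prime a p ^ multiplicity p n = kronecker_prime b p ^ multiplicity p n"
    using kronecker_prime_cong p by (auto simp: in_prime_factors_iff)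
qed

lemma kronecker_eq_0_iff:
  assumes "n > 0"
  shows "kronecker (int m) n = 0 \<longleftrightarrow> \<not> coprime m n"
proof -
  have "kronecker (int m) n = 0 \<longleftrightarrow> (\<exists>p\<in>prime_factors n. p dvd m)"
  proof -
    have "kronecker_prime (int m) p ^ multiplicity p n = 0 \<longleftrightarrow> p dvd m" if "p \<in> prime_factors n" for p
    proof -
      have "prime p" "multiplicity p n > 0" using that by (auto simp: prime_factors_multiplicity)
      thus ?thesis by (simp add: kronecker_prime_eq_0_iff)
    qed
    thus ?thesis unfolding kronecker_def by (simp add: prod_zero_iff)
  qed
  also have "\<dots> \<longleftrightarrow> \<not> coprime m n"
  proof (rule iffI)
    assume "\<exists>p\<in>prime_factors n. p dvd m"
    then obtain p where p: "prime p" "p dvd n" "p dvd m" by (auto simp: in_prime_factors_iff)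
    show "\<not> coprime m n"
    proof
      assume "coprime m n"
      from coprime_common_divisor[OF this p(3,2)] p(1) show False by (simp add: not_prime_unit)
    qed
  next
    assume "\<not> coprime m n"
    hence "gcd m n \<noteq> 1" unfolding coprime_iff_gcd_eq_1 .
    then obtain p where p: "prime p" "p dvd gcd m n" using prime_factor_nat by blast
    have pm: "p dvd m" by (rule dvd_trans[OF p(2) gcd_dvd1])
    have "p dvd n" by (rule dvd_trans[OF p(2) gcd_dvd2])
    hence "p \<in> prime_factors n" using p(1) assms by (simp add: in_prime_factors_iff)
    with pm show "\<exists>p\<in>prime_factors n. p dvd m" by blast
  qed
  finally show ?thesis .
qed

section \<open>Nonprincipality for nonsquare n\<close>

lemma odd_multiplicity_of_nonsquare:
  assumes n: "n > (0::nat)" "\<nexists>m. n = m\<^sup>2"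
  obtains p where "prime p" "odd (multiplicity p n)"
proof (rule ccontr)
  assume "\<not> thesis"
  hence ev: "even (multiplicity p n)" if "prime p" for p using that \<open>\<And>p. prime p \<Longrightarrow> odd (multiplicity p n) \<Longrightarrow> thesis\<close> by blast
  have "n = (\<Prod>p\<in>prime_factors n. p ^ multiplicity p n)"
    using prime_factorization_nat[OF n(1)] .
  also have "\<dots> = (\<Prod>p\<in>prime_factors n. (p ^ (multiplicity p n div 2))\<^sup>2)"
    by (intro prod.cong refl) (use ev in \<open>auto simp: in_prime_factors_iff simp flip: power_mult\<close>)
  also have "\<dots> = (\<Prod>p\<in>prime_factors n. p ^ (multiplicity p n div 2))\<^sup>2"
    by (simp add: prod_power_distrib)
  finally show False using n(2) by blast
qed

text \<open>A residue that is 1 modulo 8 (modulo 4 if the distinguished prime is 2) and modulo every other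
  prime factor of \<open>n\<close>, so only the distinguished prime contributes.\<close>

lemma ex_kronecker_minus_one:
  assumes n: "n > (0::nat)" "\<nexists>m. n = m\<^sup>2"
  shows "\<exists>x::nat. kronecker (int x) n = -1 \<and> x mod 4 = 1"
proof -
  obtain p where p: "prime p" "odd (multiplicity p n)"
    using odd_multiplicity_of_nonsquare[OF n] .
  obtain n' where n': "n = p ^ multiplicity p n * n'" "\<not> p dvd n'"
    using multiplicity_decompose'[of n p] n(1) p by (metis not_prime_unit gr_implies_not0)
  have n'0: "n' > 0" using n' n(1) by (auto intro!: Nat.gr0I)
  have split: "kronecker d n = kronecker_prime d p ^ multiplicity p n * kronecker d n'" for d
  proof -
    have pw: "kronecker d (p ^ i) = kronecker_prime d p ^ i" for i
    proof (induction i)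
      case (Suc i)
      have "p ^ i > 0" "p > 0" using p prime_gt_0_nat by auto
      thus ?case using Suc kronecker_mult_right[of p "p ^ i" d] p by (simp add: kronecker_prime_right)
    qed simp
    have "p ^ multiplicity p n > 0" using p prime_gt_0_nat by simp
    thus ?thesis using kronecker_mult_right[of "p ^ multiplicity p n" n' d] n' n'0 pw by metis
  qed
  obtain x where x: "kronecker_prime (int x) p = -1" "kronecker (int x) n' = 1" "x mod 4 = 1"
  proof (cases "p = 2")
    case True
    have "coprime 8 n'"
    proof -
      have "coprime 2 n'" using n'(2) True prime_imp_coprime[of 2 n'] by auto
      hence "coprime (2 ^ 3) n'" by (intro coprime_power_left_iff[THEN iffD2] disjI1)
      thus ?thesis by simp
    qed
    \<comment> \<open>Of the two classes 3 and 5 modulo 8 with symbol -1 at 2, only 5 is 1 modulo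
      4.\<close>
    then obtain x where x: "[x = 5] (mod 8)" "[x = 1] (mod n')"
      using binary_chinese_remainder_nat by blast
    have x8: "x mod 8 = 5" using x(1) by (simp add: cong_def)
    have "kronecker (int x) n' = kronecker 1 n'"
      unfolding kronecker_def
    proof (rule prod.cong[OF refl])
      fix r assume r: "r \<in> prime_factors n'"
      hence "r \<noteq> 2" using n' True by (auto simp: in_prime_factors_iff)
      moreover have "[int x = 1] (mod int r)"
        using x(2) r cong_dvd_modulus_nat[of x 1 n' r] cong_int_iff[of x 1 r] by (auto simp: in_prime_factors_iff)
      ultimately show "kronecker_prime (int x) r ^ multiplicity r n' = kronecker_prime 1 r ^ multiplicity r n'"
        by (simp add: kronecker_prime_def Legendre_cong)
    qed
    hence "kronecker (int x) n' = 1" by (simp add: kronecker_one_left)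
    moreover have "int x mod 8 = 5" using x8 by presburger
    hence "kronecker_prime (int x) p = -1"
      using True by (simp add: kronecker_prime_def) presburger
    moreover have "x mod 4 = 1" using x8 by presburger
    ultimately show ?thesis using that by blast
  next
    case False
    hence p2: "2 < p" using p prime_ge_2_nat[of p] by linarith
    obtain g where g: "Legendre (int g) (int p) = -1" using ex_nonresidue[OF p(1) p2] by blast
    have "coprime p 2" using p p2 by (intro primes_coprime) auto
    hence "coprime p (2 ^ 3)" by (intro coprime_power_right_iff[THEN iffD2] disjI1)
    moreover have "coprime p n'" using n'(2) p prime_imp_coprime by blast
    ultimately have "coprime p (8 * n')" by simp
    then obtain x where x: "[x = g] (mod p)" "[x = 1] (mod (8 * n'))"
      using binary_chinese_remainder_nat by blast
    have "kronecker (int x) n' = kronecker 1 n'"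
      by (rule kronecker_cong) (use x(2) cong_int_iff[of x 1 "8 * n'"] in simp)
    hence "kronecker (int x) n' = 1" by (simp add: kronecker_one_left)
    moreover have "kronecker_prime (int x) p = -1"
      using False g x(1) Legendre_cong[of "int x" "int g" "int p"] by (simp add: kronecker_prime_def cong_int_iff)
    moreover have "[x = 1] (mod 4)" by (rule cong_dvd_modulus_nat[OF x(2)]) simp
    hence "x mod 4 = 1" by (simp add: cong_def)
    ultimately show ?thesis using that by blast
  qed
  thus ?thesis using split[of "int x"] p(2) by (intro exI[of _ x]) simp
qed

text \<open>The nonprincipal character modulo 4; (chi4^2 + chi4) / 2 is the indicator of 1 modulo
  4.\<close>

definition chi4 :: "nat \<Rightarrow> int" where
  "chi4 m = (if m mod 4 = 1 then 1 else if m mod 4 = 3 then -1 else 0)"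

lemma chi4_mult: "chi4 (m * n) = chi4 m * chi4 n"
proof -
  have "m mod 4 = 0 \<or> m mod 4 = 1 \<or> m mod 4 = 2 \<or> m mod 4 = 3"
    "n mod 4 = 0 \<or> n mod 4 = 1 \<or> n mod 4 = 2 \<or> n mod 4 = 3" by presburger+
  moreover have "(m * n) mod 4 = ((m mod 4) * (n mod 4)) mod 4" by (simp add: mod_mult_eq)
  ultimately show ?thesis unfolding chi4_def
    by (elim disjE) (simp_all del: mod_mult_eq)
qed

lemma coprime_pow2_iff: "k > 0 \<Longrightarrow> coprime (m::nat) (2 ^ k) \<longleftrightarrow> odd m"
  by (simp add: coprime_commute)

lemma chi4_eq_0_iff: "chi4 m = 0 \<longleftrightarrow> even m"
proof -
  have "even m \<longleftrightarrow> m mod 4 = 0 \<or> m mod 4 = 2" by presburger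
  moreover have "m mod 4 \<in> {0,1,2,3}" by auto
  ultimately show ?thesis by (auto simp: chi4_def)
qed

lemma chi4_char: "real_nonprincipal_char 4 chi4"
proof
  show "chi4 (m * n) = chi4 m * chi4 n" for m n by (rule chi4_mult)
  show "chi4 (n + 4) = chi4 n" for n by (simp add: chi4_def)
  show "chi4 n = 0 \<longleftrightarrow> \<not> coprime n 4" for n
    using coprime_pow2_iff[of 2 n] by (simp add: chi4_eq_0_iff)
  show "\<exists>m. chi4 m = -1" by (rule exI[of _ 3]) (simp add: chi4_def)
qed (auto simp: chi4_def)

lemma odd_iff_chi4_sq: "chi4 m ^ 2 = (if odd m then 1 else 0)"
  using chi4_eq_0_iff[of m] by (auto simp: chi4_def)

text \<open>Multiplying by \<open>chi4\<close> or its square kills even arguments, so that the zeros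
  fit the modulus 8 n also for odd n. The witness of \<open>ex_kronecker_minus_one\<close> is 1
  modulo 4, so its value -1 survives the twist.\<close>

lemma kronecker_char:
  assumes n: "n > (0::nat)" "\<nexists>m. n = m\<^sup>2" and e: "e \<in> {1, 2::nat}"
  shows "real_nonprincipal_char (8 * n) (\<lambda>m. kronecker (int m) n * chi4 m ^ e)"
proof
  show "8 * n > 0" using n by simp
  show "kronecker (int 1) n * chi4 1 ^ e = 1" by (simp add: kronecker_one_left chi4_def)
  show "kronecker (int (a * b)) n * chi4 (a * b) ^ e = kronecker (int a) n * chi4 a ^ e * (kronecker (int b) n * chi4 b ^ e)" for a b
    by (simp add: kronecker_mult_left chi4_mult power_mult_distrib)
  show "kronecker (int (a + 8 * n)) n * chi4 (a + 8 * n) ^ e = kronecker (int a) n * chi4 a ^ e" for a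
  proof -
    have "(a + 8 * n) mod 4 = a mod 4" using mod_mult_self1[of a "2 * n" 4] by (simp add: mult.assoc[symmetric])
    moreover have "kronecker (int (a + 8 * n)) n = kronecker (int a) n"
      by (rule kronecker_cong) (simp add: cong_def)
    ultimately show ?thesis by (simp add: chi4_def)
  qed
  show "kronecker (int a) n * chi4 a ^ e = 0 \<longleftrightarrow> \<not> coprime a (8 * n)" for a
  proof -
    have "coprime a 8 \<longleftrightarrow> odd a" using coprime_pow2_iff[of 3 a] by simp
    thus ?thesis using e n by (auto simp: kronecker_eq_0_iff chi4_eq_0_iff)
  qed
  show "\<bar>kronecker (int a) n * chi4 a ^ e\<bar> \<le> 1" for a
    using kronecker_range[of "int a" n] e by (auto simp: chi4_def)
  obtain x where "kronecker (int x) n = -1" "x mod 4 = 1" using ex_kronecker_minus_one[OF n] by blast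
  thus "\<exists>m. kronecker (int m) n * chi4 m ^ e = -1" by (intro exI[of _ x]) (simp add: chi4_def)
qed

section \<open>Averaging over prime discriminants\<close>

definition split_primes :: "real \<Rightarrow> nat set" where
  "split_primes l = {m \<in> good_primes l. m mod 4 = 1}"

text \<open>Split the indicator of 1 modulo 4 as (chi4^2 + chi4) / 2. Times
  \<open>kronecker d n\<close> both parts are nonprincipal characters. For the total weight the
  first part is the sum over all primes of the window and the second is small, so about half of the
  main term remains.\<close>

lemma lweight_kronecker_bound:
  assumes GRH
  shows "\<forall>\<^sub>F l in at_top. 0 < (\<Sum>d\<in>split_primes l. lweight l d) \<and>
    (\<forall>n>0. (\<nexists>m. n = m\<^sup>2) \<and> real (8 * n) \<le> exp (l ^ 4) \<longrightarrow>
       \<bar>\<Sum>d\<in>split_primes l. lweight l d * kronecker (int d) n\<bar> \<le> (\<Sum>d\<in>split_primes l. lweight l d) * exp (- l / 6))"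
  using error_eventually eventually_ge_at_top[of "2::real"]
proof eventually_elim
  case (elim l)
  hence l: "l \<ge> 2" "l \<ge> 1" by auto
  note p = params[OF l(2)]
  define E where "E = 4 * (l / exp 1) ^ kparam l * exp (- l / 5) * (\<Sum>m. tail_fun m)"
  define \<delta> where "\<delta> = exp (- l / 6) / 8"
  have err: "kerr (aparam l + 1) (kparam l) Q + E \<le> mainterm l * \<delta>" if "1 \<le> Q" "Q \<le> exp (l ^ 4)" for Q
    using elim(1) that unfolding E_def \<delta>_def by blast
  have \<delta>: "0 < \<delta>" "\<delta> \<le> 1 / 8" using l by (auto simp: \<delta>_def)
  have "aparam l \<ge> 288 * 1" using p(2) one_le_power[OF l(2), of 2] by linarith
  hence \<sigma>: "aparam l + 1 > 3" by simp
  have mt: "mainterm l > 0" unfolding mainterm_def using p by (intro divide_pos_pos zero_less_power) auto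
  have l4: "1 \<le> exp (l ^ 4)" "4 \<le> exp (l ^ 4)"
  proof -
    have "16 \<le> l ^ 4" using power_mono[of 2 l 4] l by simp
    moreover have "1 + l ^ 4 \<le> exp (l ^ 4)" by (rule exp_ge_add_one_self)
    ultimately show "1 \<le> exp (l ^ 4)" "4 \<le> exp (l ^ 4)" by linarith+
  qed
  define G where "G = good_primes l"
  have finG: "finite G" unfolding G_def by (rule finite_good_primes)
  define S where "S = (\<lambda>f::nat \<Rightarrow> real. \<Sum>m\<in>G. lweight l m * f m)"
  have char: "\<bar>S (\<lambda>m. of_int (c m))\<bar> \<le> mainterm l * \<delta>"
    if "real_nonprincipal_char q c" "real q \<le> exp (l ^ 4)" for q c
  proof -
    interpret real_nonprincipal_char q c by fact
    have s: "summable (\<lambda>m. kweight (aparam l + 1) (kparam l) m * of_int (c m))"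
      and b: "\<bar>\<Sum>m. kweight (aparam l + 1) (kparam l) m * of_int (c m)\<bar> \<le> kerr (aparam l + 1) (kparam l) q"
      using kweight_char_sum[OF \<open>GRH\<close> \<sigma>] by blast+
    have "\<bar>real_of_int (c m)\<bar> \<le> 1" for m using abs_le[of m] by linarith
    from good_primes_sum_approx[OF l(2) p(2,1) this s]
    have "\<bar>(\<Sum>m. kweight (aparam l + 1) (kparam l) m * of_int (c m)) - S (\<lambda>m. of_int (c m))\<bar> \<le> E"
      unfolding S_def lweight_def G_def E_def .
    with b err[of "real q"] that q show ?thesis by linarith
  qed
  have one: "S (\<lambda>_. 1) \<ge> mainterm l * (1 - \<delta>)"
  proof -
    have s: "summable (\<lambda>m. kweight (aparam l + 1) (kparam l) m * 1)"
      and b: "\<bar>(\<Sum>m. kweight (aparam l + 1) (kparam l) m * 1) - mainterm l\<bar> \<le> kerr (aparam l + 1) (kparam l) 1"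
      using kweight_main_sum[OF \<open>GRH\<close> \<sigma>, of "kparam l"] by (auto simp: mainterm_def)
    have "\<bar>(\<Sum>m. kweight (aparam l + 1) (kparam l) m * 1) - S (\<lambda>_. 1)\<bar> \<le> E"
      unfolding S_def lweight_def G_def E_def
      by (rule good_primes_sum_approx[OF l(2) p(2,1) _ s]) simp
    with b err[of 1] l4 show ?thesis by (simp add: algebra_simps)
  qed
  have odd: "odd m" if "m \<in> G" for m
  proof -
    have m: "prime m" "exp (l - ln 2 / 2) < real m" using that by (auto simp: G_def good_primes_def)
    have "2 \<le> 1 + (l - ln 2 / 2)" using l ln_le_minus_one[of 2] by simp
    also have "\<dots> \<le> exp (l - ln 2 / 2)" by (rule exp_ge_add_one_self)
    finally have "m > 2" using m by linarith
    thus ?thesis using m prime_odd_nat by blast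
  qed
  have ind: "(\<Sum>d\<in>split_primes l. lweight l d * f d) = (S (\<lambda>m. f m * of_int (chi4 m ^ 2)) + S (\<lambda>m. f m * of_int (chi4 m))) / 2" for f
  proof -
    have "(\<Sum>d\<in>split_primes l. lweight l d * f d) = (\<Sum>m\<in>G. if m mod 4 = 1 then lweight l m * f m else 0)"
      unfolding split_primes_def G_def using finite_good_primes by (simp add: sum.inter_filter)
    also have "\<dots> = (\<Sum>m\<in>G. (lweight l m * (f m * of_int (chi4 m ^ 2)) + lweight l m * (f m * of_int (chi4 m))) / 2)"
    proof (rule sum.cong[OF refl])
      fix m assume "m \<in> G"
      hence "m mod 4 = 1 \<or> m mod 4 = 3" using odd[of m] by presburger
      thus "(if m mod 4 = 1 then lweight l m * f m else 0) = (lweight l m * (f m * of_int (chi4 m ^ 2)) + lweight l m * (f m * of_int (chi4 m))) / 2"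
        by (auto simp: chi4_def)
    qed
    finally show ?thesis by (simp add: S_def sum.distrib flip: sum_divide_distrib)
  qed
  define W where "W = (\<Sum>d\<in>split_primes l. lweight l d)"
  have sq1: "S (\<lambda>m. of_int (chi4 m ^ 2)) = S (\<lambda>_. 1)"
    unfolding S_def by (intro sum.cong refl) (simp only: odd_iff_chi4_sq odd if_True of_int_1 not_False_eq_True)
  have "\<bar>S (\<lambda>m. of_int (chi4 m))\<bar> \<le> mainterm l * \<delta>"
    by (rule char[OF chi4_char]) (use l4 in simp)
  hence "W \<ge> (mainterm l * (1 - \<delta>) - mainterm l * \<delta>) / 2"
    using ind[of "\<lambda>_. 1"] one sq1 unfolding W_def by simp
  also have "(mainterm l * (1 - \<delta>) - mainterm l * \<delta>) / 2 = mainterm l * (1 - 2 * \<delta>) / 2" by (simp add: algebra_simps)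
  also have "mainterm l * (1 - 2 * \<delta>) / 2 \<ge> mainterm l * (1 / 4) / 2"
    using \<delta> mt by (intro divide_right_mono mult_left_mono) auto
  finally have W: "W \<ge> mainterm l / 8" by simp
  show ?case
  proof (intro conjI allI impI)
    show "0 < (\<Sum>d\<in>split_primes l. lweight l d)" using W mt unfolding W_def by linarith
    fix n :: nat assume n: "0 < n" and n': "(\<nexists>m. n = m\<^sup>2) \<and> real (8 * n) \<le> exp (l ^ 4)"
    have "\<bar>S (\<lambda>m. of_int (kronecker (int m) n * chi4 m ^ e))\<bar> \<le> mainterm l * \<delta>" if "e \<in> {1, 2}" for e
      by (rule char[OF kronecker_char[OF n _ that]]) (use n' in auto)
    from this[of 1] this[of 2]
    have "\<bar>\<Sum>d\<in>split_primes l. lweight l d * kronecker (int d) n\<bar> \<le> mainterm l * \<delta>"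
      unfolding ind by simp
    also have "\<dots> = mainterm l / 8 * exp (- l / 6)" by (simp add: \<delta>_def)
    also have "\<dots> \<le> W * exp (- l / 6)" using W by (intro mult_right_mono) auto
    finally show "\<bar>\<Sum>d\<in>split_primes l. lweight l d * kronecker (int d) n\<bar> \<le> (\<Sum>d\<in>split_primes l. lweight l d) * exp (- l / 6)"
      by (simp add: W_def)
  qed
qed

section \<open>The weighted average over discriminants\<close>

lemma kronecker_prod_right:
  assumes "finite A" "\<And>p. p \<in> A \<Longrightarrow> prime p"
  shows "kronecker d (\<Prod>A) = (\<Prod>p\<in>A. kronecker d p)"
  using assms
proof (induction A rule: finite_induct)
  case (insert p A)
  have "\<Prod>A > 0" using insert by (intro prod_pos) (auto simp: prime_gt_0_nat)
  thus ?case using insert kronecker_mult_right[of p "\<Prod>A" d] by (simp add: prime_gt_0_nat)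
qed simp

text \<open>As D and Q are disjoint, every symbol at p in Q is 1 or -1, so the product weight is 0
  or \<open>2 ^ card Q\<close> times w. Of the N + 1 errors allowed in \<open>small\<close>, at most
  N come from the nonsmooth n and one from the total weight \<open>V\<close>.\<close>

lemma resonance_average:
  fixes w :: "nat \<Rightarrow> real" and D Q :: "nat set"
  assumes D: "finite D" "\<And>d. d \<in> D \<Longrightarrow> prime d" "D \<inter> Q = {}"
    and Q: "finite Q" "\<And>p. p \<in> Q \<Longrightarrow> prime p"
    and w: "\<And>d. d \<in> D \<Longrightarrow> w d \<ge> 0"
    and \<eta>: "\<eta> \<ge> 0" "\<And>n. n > 0 \<Longrightarrow> \<nexists>m. n = m\<^sup>2 \<Longrightarrow> n \<le> \<Prod>Q * N \<or> n \<le> \<Prod>Q \<Longrightarrow>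
                 \<bar>\<Sum>d\<in>D. w d * kronecker (int d) n\<bar> \<le> \<eta>"
    and small: "2 ^ card Q * \<eta> * (real N + 1) < (\<Sum>d\<in>D. w d)"
  shows "\<exists>d\<in>D. int (card {n\<in>{1..N}. prime_factors n \<subseteq> Q}) \<le> (\<Sum>n\<in>{1..N}. kronecker (int d) n)"
proof -
  let ?k = "\<lambda>d n. real_of_int (kronecker (int d) n)"
  define B where "B = {n\<in>{1..N}. prime_factors n \<subseteq> Q}"
  define R where "R = {1..N} - B"
  define v where "v = (\<lambda>d. w d * (\<Prod>p\<in>Q. 1 + ?k d p))"
  have prodQ: "\<Prod>Q > 0" using Q by (intro prod_pos) (auto simp: prime_gt_0_nat)
  have posA: "\<Prod>A > 0 \<and> \<Prod>A \<le> \<Prod>Q" if "A \<subseteq> Q" for A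
  proof -
    have "\<Prod>A dvd \<Prod>Q" using Q(1) that by (intro prod_dvd_prod_subset)
    thus ?thesis using prodQ by (metis dvd_0_left_iff dvd_imp_le gr0I less_numeral_extra(3))
  qed
  \<comment> \<open>Squares give a nonnegative sum, so one lower bound covers squares and nonsquares
    alike.\<close>
  have lower: "(\<Sum>d\<in>D. w d * ?k d n) \<ge> - \<eta>" if "n > 0" "n \<le> \<Prod>Q * N \<or> n \<le> \<Prod>Q" for n
  proof (cases "\<exists>m. n = m\<^sup>2")
    case True
    then obtain m where m: "n = m\<^sup>2" by blast
    hence "m > 0" using that by (auto intro!: Nat.gr0I)
    hence "kronecker (int d) n = kronecker (int d) m ^ 2" for d
      using kronecker_mult_right[of m m "int d"] m by (simp add: power2_eq_square)
    hence "(\<Sum>d\<in>D. w d * ?k d n) \<ge> 0" using w by (intro sum_nonneg mult_nonneg_nonneg) auto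
    thus ?thesis using \<eta>(1) by linarith
  qed (use \<eta>(2)[OF that(1) _ that(2)] in \<open>auto simp: abs_le_iff\<close>)
  have expand: "v d = (\<Sum>A\<in>Pow Q. w d * ?k d (\<Prod>A))" for d
  proof -
    have "(\<Prod>p\<in>Q. 1 + ?k d p) = (\<Sum>A\<in>Pow Q. \<Prod>p\<in>A. ?k d p)"
      using prod_add[OF Q(1), of "\<lambda>p. ?k d p" "\<lambda>_. 1"] by (simp add: add.commute)
    also have "\<dots> = (\<Sum>A\<in>Pow Q. ?k d (\<Prod>A))"
      using Q by (intro sum.cong refl) (auto simp: kronecker_prod_right finite_subset subsetD)
    finally show ?thesis by (simp add: v_def sum_distrib_left)
  qed
  have kpm: "kronecker (int d) p = 1 \<or> kronecker (int d) p = -1" if "d \<in> D" "p \<in> Q" for d p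
  proof -
    have "\<not> p dvd d" using D that Q primes_dvd_imp_eq[of p d] by blast
    hence "kronecker (int d) p \<noteq> 0"
      using Q(2)[OF that(2)] by (simp add: kronecker_prime_right kronecker_prime_eq_0_iff)
    thus ?thesis using kronecker_range[of "int d" p] by auto
  qed
  have v0: "v d \<ge> 0" if "d \<in> D" for d
    unfolding v_def using w[OF that] kpm[OF that] by (intro mult_nonneg_nonneg prod_nonneg) force+
  have smooth: "v d * ?k d n = v d" if "d \<in> D" "n \<in> B" for d n
  proof (cases "\<forall>p\<in>Q. kronecker (int d) p = 1")
    case True
    have "kronecker (int d) n = 1"
      unfolding kronecker_def
    proof (rule prod.neutral, rule ballI)
      fix p assume p: "p \<in> prime_factors n"
      hence "kronecker (int d) p = 1" using that True by (auto simp: B_def)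
      thus "kronecker_prime (int d) p ^ multiplicity p n = 1"
        using p by (simp add: kronecker_prime_right in_prime_factors_iff)
    qed
    thus ?thesis by simp
  next
    case False
    then obtain p where "p \<in> Q" "kronecker (int d) p = -1" using kpm[OF \<open>d \<in> D\<close>] by blast
    hence "(\<Prod>p\<in>Q. 1 + ?k d p) = 0" using Q(1) by (intro prod_zero) force+
    hence "v d = 0" by (simp add: v_def)
    thus ?thesis by simp
  qed
  have rough: "(\<Sum>d\<in>D. v d * ?k d n) \<ge> - (2 ^ card Q * \<eta>)" if n: "n > 0" "n \<le> N \<or> n = 1" for n
  proof -
    have "(\<Sum>d\<in>D. v d * ?k d n) = (\<Sum>A\<in>Pow Q. \<Sum>d\<in>D. w d * ?k d (\<Prod>A * n))"
    proof -
      have "v d * ?k d n = (\<Sum>A\<in>Pow Q. w d * ?k d (\<Prod>A * n))" for d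
        unfolding expand sum_distrib_right
        by (intro sum.cong refl) (use posA n in \<open>simp add: kronecker_mult_right\<close>)
      thus ?thesis by (simp add: sum.swap[of _ "Pow Q" D])
    qed
    also have "\<dots> \<ge> (\<Sum>A\<in>Pow Q. - \<eta>)"
    proof (rule sum_mono, rule lower)
      fix A assume "A \<in> Pow Q"
      hence A: "\<Prod>A > 0" "\<Prod>A \<le> \<Prod>Q" using posA by auto
      show "\<Prod>A * n > 0" using A n by simp
      show "\<Prod>A * n \<le> \<Prod>Q * N \<or> \<Prod>A * n \<le> \<Prod>Q" using A n by (auto intro: mult_le_mono)
    qed
    finally show ?thesis using Q(1) by (simp add: card_Pow)
  qed
  define V where "V = (\<Sum>d\<in>D. v d)"
  define W where "W = (\<Sum>d\<in>D. w d)"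
  have V: "V \<ge> W - 2 ^ card Q * \<eta>"
  proof -
    have "V = (\<Sum>A\<in>Pow Q. \<Sum>d\<in>D. w d * ?k d (\<Prod>A))"
      unfolding V_def expand by (rule sum.swap)
    also have "\<dots> = W + (\<Sum>A\<in>Pow Q - {{}}. \<Sum>d\<in>D. w d * ?k d (\<Prod>A))"
      using Q(1) by (subst sum.remove[of _ "{}"]) (auto simp: W_def)
    also have "(\<Sum>A\<in>Pow Q - {{}}. \<Sum>d\<in>D. w d * ?k d (\<Prod>A)) \<ge> (\<Sum>A\<in>Pow Q - {{}}. - \<eta>)"
      by (intro sum_mono lower) (use posA in auto)
    moreover have "(\<Sum>A\<in>Pow Q - {{}}. - \<eta>) \<ge> - (2 ^ card Q * \<eta>)"
    proof -
      have "real (card (Pow Q - {{}})) \<le> real (card (Pow Q))"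
        using Q(1) by (intro of_nat_mono card_mono) auto
      thus ?thesis using \<eta>(1) Q(1) by (simp add: card_Pow mult_right_mono)
    qed
    ultimately show ?thesis by linarith
  qed
  have "(\<Sum>d\<in>D. v d * (\<Sum>n\<in>{1..N}. ?k d n)) = (\<Sum>n\<in>{1..N}. \<Sum>d\<in>D. v d * ?k d n)"
    unfolding sum_distrib_left by (rule sum.swap)
  also have "\<dots> = (\<Sum>n\<in>R. \<Sum>d\<in>D. v d * ?k d n) + (\<Sum>n\<in>B. \<Sum>d\<in>D. v d * ?k d n)"
    unfolding R_def by (rule sum.subset_diff) (auto simp: B_def)
  also have "(\<Sum>n\<in>B. \<Sum>d\<in>D. v d * ?k d n) = (\<Sum>n\<in>B. V)"
    unfolding V_def by (intro sum.cong refl smooth)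
  also have "(\<Sum>n\<in>R. \<Sum>d\<in>D. v d * ?k d n) \<ge> (\<Sum>n\<in>R. - (2 ^ card Q * \<eta>))"
    by (intro sum_mono rough) (auto simp: R_def)
  moreover have "(\<Sum>n\<in>R. - (2 ^ card Q * \<eta>)) \<ge> - (real N * (2 ^ card Q * \<eta>))"
  proof -
    have "card R \<le> card {1..N}" unfolding R_def by (intro card_mono) auto
    hence "real (card R) * (2 ^ card Q * \<eta>) \<le> real N * (2 ^ card Q * \<eta>)"
      using \<eta>(1) by (intro mult_right_mono) auto
    thus ?thesis by (simp only: sum_constant mult_minus_right neg_le_iff_le)
  qed
  moreover have "(\<Sum>n\<in>B. V) = real (card B) * V" by simp
  ultimately have main: "(\<Sum>d\<in>D. v d * (\<Sum>n\<in>{1..N}. ?k d n)) \<ge> real (card B) * V - real N * (2 ^ card Q * \<eta>)"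
    by linarith
  \<comment> \<open>All errors together are less than one unit of \<open>V\<close>: the average
    exceeds card B - 1, and integrality recovers card B.\<close>
  have "real N * (2 ^ card Q * \<eta>) < V"
    using V small by (simp add: W_def algebra_simps)
  with main have "(\<Sum>d\<in>D. v d * (\<Sum>n\<in>{1..N}. ?k d n)) > (real (card B) - 1) * V"
    by (simp add: algebra_simps)
  hence "(\<Sum>d\<in>D. v d * (real (card B) - 1)) < (\<Sum>d\<in>D. v d * (\<Sum>n\<in>{1..N}. ?k d n))"
    by (simp add: V_def sum_distrib_right[symmetric] mult.commute)
  then obtain d where d: "d \<in> D" "v d * (real (card B) - 1) < v d * (\<Sum>n\<in>{1..N}. ?k d n)"
    by (meson not_le sum_mono)
  hence "real (card B) - 1 < (\<Sum>n\<in>{1..N}. ?k d n)"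
    using v0[OF d(1)] by (simp add: mult_less_cancel_left)
  hence "real_of_int (int (card B)) - 1 < real_of_int (\<Sum>n\<in>{1..N}. kronecker (int d) n)" by simp
  hence "int (card B) \<le> (\<Sum>n\<in>{1..N}. kronecker (int d) n)" by linarith
  thus ?thesis using d(1) unfolding B_def by blast
qed

section \<open>Chebyshev's upper bound for the number of primes\<close>

lemma prod_primes_dvd:
  assumes "finite A" "\<And>p. p \<in> A \<Longrightarrow> prime p" "\<And>p. p \<in> A \<Longrightarrow> p dvd (n::nat)"
  shows "\<Prod>A dvd n"
  using assms
proof (induction A rule: finite_induct)
  case (insert p A)
  have "coprime p (\<Prod>A)"
    by (rule prod_coprime_right) (use insert in \<open>auto intro!: primes_coprime\<close>)
  thus ?case using insert by (simp add: divides_mult)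
qed simp

text \<open>Primes in (n, 2 n] divide the central binomial coefficient, which is at most 4^n; so
  each doubling of n squares the bound.\<close>

lemma prod_primes_pow2_le: "\<Prod>{p. prime p \<and> p \<le> 2 ^ j} \<le> (4::nat) ^ (2 ^ j)"
proof (induction j)
  case 0
  have "{p::nat. prime p \<and> p \<le> 2 ^ 0} = {}" by (auto dest: prime_gt_1_nat)
  thus ?case by (simp only: prod.empty) simp
next
  case (Suc j)
  define n :: nat where "n = 2 ^ j"
  have fin: "finite {p. prime p \<and> p \<le> n}" "finite {p. prime p \<and> n < p \<and> p \<le> 2 * n}" by simp_all
  have "{p. prime p \<and> p \<le> 2 ^ Suc j} = {p. prime p \<and> p \<le> n} \<union> {p. prime p \<and> n < p \<and> p \<le> 2 * n}"
    by (auto simp: n_def)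
  hence "\<Prod>{p. prime p \<and> p \<le> 2 ^ Suc j} = \<Prod>{p. prime p \<and> p \<le> n} * \<Prod>{p. prime p \<and> n < p \<and> p \<le> 2 * n}"
    using fin by (simp add: prod.union_disjoint disjoint_iff)
  also have "\<dots> \<le> 4 ^ n * 4 ^ n"
  proof (rule mult_le_mono)
    show "\<Prod>{p. prime p \<and> p \<le> n} \<le> 4 ^ n" using Suc by (simp add: n_def)
    have "\<Prod>{p. prime p \<and> n < p \<and> p \<le> 2 * n} dvd (2 * n choose n)"
    proof (rule prod_primes_dvd[OF fin(2)])
      fix p assume p: "p \<in> {p. prime p \<and> n < p \<and> p \<le> 2 * n}"
      have "fact n * fact n * (2 * n choose n) = (fact (2 * n) :: nat)"
        using binomial_fact_lemma[of n "2 * n"] by simp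
      moreover have "p dvd fact (2 * n)" using p by (simp add: prime_dvd_fact_iff)
      ultimately have "p dvd fact n * fact n * (2 * n choose n)" by simp
      moreover have "\<not> p dvd fact n" using p by (simp add: prime_dvd_fact_iff)
      ultimately show "p dvd (2 * n choose n)" using p by (auto simp: prime_dvd_mult_iff)
    qed auto
    hence "\<Prod>{p. prime p \<and> n < p \<and> p \<le> 2 * n} \<le> (2 * n choose n)"
      by (rule dvd_imp_le) simp
    also have "\<dots> \<le> 2 ^ (2 * n)" by (rule binomial_le_pow2)
    also have "\<dots> = 4 ^ n" by (simp add: power_mult)
    finally show "\<Prod>{p. prime p \<and> n < p \<and> p \<le> 2 * n} \<le> 4 ^ n" .
  qed
  also have "\<dots> = 4 ^ (2 ^ Suc j)" by (simp add: n_def flip: power_add mult_2)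
  finally show ?case .
qed

text \<open>Primes up to sqrt y are counted trivially. Each larger one has ln p \<ge> ln y / 2, and
  these logarithms add up to at most 2^j ln 4 with y \<le> 2^j \<le> 2 y. Estimating ln 2 by 1 gives
  4 y, hence the 8.\<close>

lemma prime_count_le:
  fixes y :: real
  assumes y: "y > 1"
  shows "real (card {p. prime p \<and> real p \<le> y}) \<le> sqrt y + 8 * y / ln y"
proof -
  define P where "P = {p::nat. prime p \<and> real p \<le> y}"
  define P1 where "P1 = {p \<in> P. real p \<le> sqrt y}"
  define P2 where "P2 = P - P1"
  have fin: "finite P"
    by (rule finite_subset[of _ "{..nat \<lfloor>y\<rfloor>}"]) (auto simp: P_def le_nat_floor)
  have "P1 \<subseteq> {1..nat \<lfloor>sqrt y\<rfloor>}" by (auto simp: P1_def P_def le_nat_floor Suc_le_eq prime_gt_0_nat)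
  hence "card P1 \<le> nat \<lfloor>sqrt y\<rfloor>" using card_mono[of "{1..nat \<lfloor>sqrt y\<rfloor>}" P1] by simp
  hence "real (card P1) \<le> real (nat \<lfloor>sqrt y\<rfloor>)" by (rule of_nat_mono)
  also have "\<dots> \<le> sqrt y" by (rule of_nat_floor) (use y in simp)
  finally have c1: "real (card P1) \<le> sqrt y" .
  have c2: "real (card P2) * (ln y / 2) \<le> 4 * y"
  proof -
    define j where "j = nat \<lceil>log 2 y\<rceil>"
    have lg: "log 2 y > 0" using y by simp
    have "y = 2 powr log 2 y" using y by simp
    also have "\<dots> \<le> 2 powr real j" unfolding j_def by (intro powr_mono) linarith+
    finally have yj: "y \<le> 2 ^ j" by (simp add: powr_realpow)
    have "real j \<le> log 2 y + 1" unfolding j_def using lg by linarith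
    hence "(2::real) powr real j \<le> 2 powr (log 2 y + 1)" by (intro powr_mono) auto
    hence j2: "2 ^ j \<le> 2 * y" using y by (simp add: powr_realpow powr_add)
    have "real (card P2) * (ln y / 2) = (\<Sum>p\<in>P2. ln (sqrt y))" using y by (simp add: ln_sqrt)
    also have "\<dots> \<le> (\<Sum>p\<in>P2. ln (real p))"
      using y by (intro sum_mono) (auto simp: P2_def P1_def P_def prime_gt_0_nat)
    also have "\<dots> \<le> (\<Sum>p\<in>{p. prime p \<and> p \<le> 2 ^ j}. ln (real p))"
    proof (rule sum_mono2)
      show "P2 \<subseteq> {p. prime p \<and> p \<le> 2 ^ j}"
      proof
        fix p assume "p \<in> P2"
        hence p: "prime p" "real p \<le> y" by (auto simp: P2_def P_def)
        have "real p \<le> real (2 ^ j)" using p(2) yj unfolding of_nat_power of_nat_numeral by (rule order_trans)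
        hence "p \<le> 2 ^ j" by (simp only: of_nat_le_iff)
        thus "p \<in> {p. prime p \<and> p \<le> 2 ^ j}" using p(1) by simp
      qed
    qed (auto simp: Suc_le_eq prime_gt_0_nat)
    also have "\<dots> = ln (real (\<Prod>{p. prime p \<and> p \<le> 2 ^ j}))"
      unfolding of_nat_prod by (subst ln_prod) (auto simp: prime_gt_0_nat)
    also have "\<dots> \<le> ln (real (4 ^ 2 ^ j))"
    proof -
      have "\<Prod>{p::nat. prime p \<and> p \<le> 2 ^ j} > 0" by (intro prod_pos) (auto simp: prime_gt_0_nat)
      moreover have "real (\<Prod>{p. prime p \<and> p \<le> 2 ^ j}) \<le> real (4 ^ 2 ^ j)"
        by (intro of_nat_mono prod_primes_pow2_le)
      ultimately show ?thesis by (subst ln_le_cancel_iff) (simp_all del: of_nat_prod of_nat_power)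
    qed
    also have "\<dots> = 2 ^ j * ln 4" by (simp add: ln_realpow)
    also have "ln 4 = 2 * ln (2 :: real)" using ln_realpow[of 2 2] by simp
    also have "2 ^ j * (2 * ln 2) \<le> (2 * y) * (2 * 1)"
      using j2 y ln_le_minus_one[of 2] by (intro mult_mono) auto
    finally show ?thesis by simp
  qed
  have "real (card P) = real (card P1) + real (card P2)"
    unfolding P2_def using fin by (subst card_Diff_subset) (auto simp: P1_def card_mono of_nat_diff)
  also have "real (card P2) \<le> 8 * y / ln y"
    using c2 y by (simp add: field_simps)
  finally show ?thesis using c1 by (simp add: P_def)
qed

section \<open>Choice of the smoothness bound and conclusion\<close>

theorem theorem1p1:
  assumes "GRH"
  shows "\<exists>\<epsilon>::real \<Rightarrow> real. (\<epsilon> \<longlongrightarrow> 0) at_top \<and>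
    (\<forall>\<^sub>F X in at_top. \<forall>x::real. ln X \<le> x \<and> x \<le> exp (sqrt (ln X)) \<longrightarrow>
       Max ((\<lambda>d. real_of_int (\<Sum>n\<in>{1..nat \<lfloor>x\<rfloor>}. kronecker d n)) `
              {d::int. X < real_of_int d \<and> real_of_int d \<le> 2 * X \<and> fundamental_disc d})
       \<ge> real (Psi x ((1/4 + \<epsilon> X) * ln X * ln (ln X)
                 / max (ln (ln x) - ln (ln (ln X))) (ln (ln (ln X))))))"
proof (rule exI[of _ "\<lambda>_. 0"], rule conjI)
  \<comment> \<open>The smoothness bound with the maximum replaced by its second entry, which can
    only enlarge it. Then 8 Y / ln Y is asymptotic to 2 ln X / ln (ln (ln X)), which is o(ln X); the
    triple logarithm absorbs any constant.\<close>
  define Y where "Y = (\<lambda>X::real. ln X * ln (ln X) / (4 * ln (ln (ln X))))"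
  have lim: "filterlim (\<lambda>X::real. ln X + ln 2 / 2) at_top at_top" by real_asymp
  \<comment> \<open>The last two conditions are logarithms: \<open>2 ^ card Q * (N + 1)\<close>
    stays below X^(1/6), and 8 n stays below exp(l^4), with e^3 for the 8, y^y for the product of Q
    and exp(sqrt (ln X)) for N. \<open>Y X < X\<close> keeps Q disjoint from the
    discriminants.\<close>
  have ev: "\<forall>\<^sub>F X::real in at_top. X > 2" "\<forall>\<^sub>F X::real in at_top. ln (ln (ln X)) > 0"
    "\<forall>\<^sub>F X::real in at_top. ln (ln X) > 0"
    "\<forall>\<^sub>F X::real in at_top. ln X > 1"
    "\<forall>\<^sub>F X::real in at_top. Y X > 1" "\<forall>\<^sub>F X::real in at_top. Y X < X"
    "\<forall>\<^sub>F X::real in at_top. sqrt (Y X) + 8 * Y X / ln (Y X) + sqrt (ln X) + 2 \<le> ln X / 6"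
    "\<forall>\<^sub>F X::real in at_top. Y X * ln (Y X) + sqrt (ln X) + 3 \<le> ln X ^ 4"
    unfolding Y_def by real_asymp+
  show "\<forall>\<^sub>F X in at_top. \<forall>x::real. ln X \<le> x \<and> x \<le> exp (sqrt (ln X)) \<longrightarrow>
       Max ((\<lambda>d. real_of_int (\<Sum>n\<in>{1..nat \<lfloor>x\<rfloor>}. kronecker d n)) `
              {d::int. X < real_of_int d \<and> real_of_int d \<le> 2 * X \<and> fundamental_disc d})
       \<ge> real (Psi x ((1/4 + 0) * ln X * ln (ln X)
                 / max (ln (ln x) - ln (ln (ln X))) (ln (ln (ln X)))))"
    using ev eventually_compose_filterlim[OF lweight_kronecker_bound[OF assms] lim]
  proof eventually_elim
    case (elim X)
    define l where "l = ln X + ln 2 / 2"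
    define y where "y = Y X"
    define Q where "Q = {p. prime p \<and> real p \<le> y}"
    define D where "D = split_primes l"
    define W where "W = (\<Sum>d\<in>D. lweight l d)"
    have W: "W > 0" using elim(9) by (simp add: W_def D_def l_def)
    have y: "y > 1" "y < X" using elim by (auto simp: y_def)
    have ln2: "0 \<le> ln (2::real)" by simp
    have expl: "exp (l - ln 2 / 2) = X" "exp (l + ln 2 / 2) = 2 * X"
      using elim(1) by (auto simp: l_def exp_add)
    have Dmem: "prime d \<and> X < real d \<and> real d \<le> 2 * X \<and> d mod 4 = 1" if "d \<in> D" for d
      using that expl by (auto simp: D_def split_primes_def good_primes_def)
    have finQ: "finite Q"
      by (rule finite_subset[of _ "{..nat \<lfloor>y\<rfloor>}"]) (auto simp: Q_def le_nat_floor)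
    have cardQ: "real (card Q) \<le> sqrt y + 8 * y / ln y"
      unfolding Q_def by (rule prime_count_le) (use y in simp)
    have prodQ: "real (\<Prod>Q) \<le> exp (y * ln y)"
    proof -
      have "Q \<subseteq> {1..nat \<lfloor>y\<rfloor>}" by (auto simp: Q_def le_nat_floor Suc_le_eq prime_gt_0_nat)
      hence "card Q \<le> nat \<lfloor>y\<rfloor>" using card_mono[of "{1..nat \<lfloor>y\<rfloor>}" Q] by simp
      hence cy: "real (card Q) \<le> y" by (rule order_trans[OF of_nat_mono of_nat_floor]) (use y in simp)
      have "real (\<Prod>Q) = (\<Prod>p\<in>Q. real p)" by simp
      also have "\<dots> \<le> (\<Prod>p\<in>Q. y)" by (rule prod_mono) (auto simp: Q_def)
      also have "\<dots> = y powr real (card Q)" using y by (simp add: powr_realpow)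
      also have "\<dots> \<le> y powr y" using y cy by (intro powr_mono) auto
      finally show ?thesis using y by (simp add: powr_def)
    qed
    show ?case
    proof (intro allI impI)
      fix x :: real assume x: "ln X \<le> x \<and> x \<le> exp (sqrt (ln X))"
      define N where "N = nat \<lfloor>x\<rfloor>"
      have N: "real N \<le> exp (sqrt (ln X))" unfolding N_def by (rule order_trans[OF of_nat_floor]) (use x elim(4) in auto)
      have e1: "exp (sqrt (ln X)) \<ge> 1" using elim(4) by simp
      have "\<exists>d\<in>D. int (card {n\<in>{1..N}. prime_factors n \<subseteq> Q}) \<le> (\<Sum>n\<in>{1..N}. kronecker (int d) n)"
      proof (rule resonance_average[where w = "lweight l" and \<eta> = "W * exp (- l / 6)"])
        show "finite D" unfolding D_def split_primes_def using finite_good_primes by simp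
        show "prime d" if "d \<in> D" for d using Dmem that by blast
        show "D \<inter> Q = {}" using Dmem y by (fastforce simp: Q_def)
        show "prime p" if "p \<in> Q" for p using that by (simp add: Q_def)
        show "0 \<le> lweight l d" for d by (simp add: lweight_def kweight_nonneg)
        show "0 \<le> W * exp (- l / 6)" using W by simp
      next
        fix n :: nat assume n: "n > 0" "\<nexists>m. n = m\<^sup>2" "n \<le> \<Prod>Q * N \<or> n \<le> \<Prod>Q"
        have "real n \<le> real (\<Prod>Q) * exp (sqrt (ln X))"
        proof -
          have "real (\<Prod>Q) * 1 \<le> real (\<Prod>Q) * exp (sqrt (ln X))"
            "real (\<Prod>Q) * real N \<le> real (\<Prod>Q) * exp (sqrt (ln X))"
            by (rule mult_left_mono[OF e1 of_nat_0_le_iff] mult_left_mono[OF N of_nat_0_le_iff])+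
          moreover have "real n \<le> real (\<Prod>Q) * real N \<or> real n \<le> real (\<Prod>Q)"
            using n(3) by (metis of_nat_le_iff of_nat_mult)
          ultimately show ?thesis by linarith
        qed
        also have "\<dots> \<le> exp (y * ln y) * exp (sqrt (ln X))"
          by (rule mult_right_mono[OF prodQ]) simp
        finally have "8 * real n \<le> exp 3 * (exp (y * ln y) * exp (sqrt (ln X)))"
        proof (intro mult_mono)
          have "(2::real) ^ 3 \<le> exp 1 ^ 3" using exp_ge_add_one_self[of 1] by (intro power_mono) auto
          also have "exp 1 ^ 3 = exp (3::real)" by (simp flip: exp_of_nat_mult)
          finally show "(8::real) \<le> exp 3" by simp
        qed auto
        also have "\<dots> = exp (y * ln y + sqrt (ln X) + 3)" by (simp add: exp_add)
        also have "\<dots> \<le> exp (l ^ 4)"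
        proof -
          have "ln X ^ 4 \<le> l ^ 4" using elim(4) ln2 unfolding l_def by (intro power_mono) auto
          thus ?thesis using elim(8) by (simp add: y_def)
        qed
        finally have "real (8 * n) \<le> exp (l ^ 4)" by simp
        thus "\<bar>\<Sum>d\<in>D. lweight l d * real_of_int (kronecker (int d) n)\<bar> \<le> W * exp (- l / 6)"
          using elim(9) n unfolding W_def D_def l_def by blast
      next
        have "2 ^ card Q \<le> exp (real (card Q))"
        proof -
          have "(2::real) ^ card Q \<le> exp 1 ^ card Q" using exp_ge_add_one_self[of 1] by (intro power_mono) auto
          thus ?thesis by (simp flip: exp_of_nat_mult)
        qed
        also have "\<dots> \<le> exp (sqrt y + 8 * y / ln y)" using cardQ by simp
        finally have p: "2 ^ card Q \<le> exp (sqrt y + 8 * y / ln y)" .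
        have "real N + 1 \<le> exp (sqrt (ln X)) * exp 1"
        proof -
          have "exp (sqrt (ln X)) * 2 \<le> exp (sqrt (ln X)) * exp 1"
            using exp_ge_add_one_self[of 1] by (intro mult_left_mono) auto
          thus ?thesis using N e1 by linarith
        qed
        with p have "2 ^ card Q * exp (- l / 6) * (real N + 1) \<le>
            exp (sqrt y + 8 * y / ln y) * exp (- l / 6) * (exp (sqrt (ln X)) * exp 1)"
          by (intro mult_mono mult_right_mono) auto
        also have "\<dots> = exp (sqrt y + 8 * y / ln y + sqrt (ln X) + 1 - l / 6)"
          by (simp add: algebra_simps flip: exp_add)
        also have "\<dots> < exp 0"
        proof -
          \<comment> \<open>The condition in \<open>ev\<close> has a + 2 where a + 1 occurs here;
            the spare 1 gives strictness.\<close>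
          have "a + 1 - (b + c / 2) / 6 < 0" if "a + 2 \<le> b / 6" "0 \<le> c" for a b c :: real
            using that by simp
          from this[OF elim(7) ln2] show ?thesis unfolding exp_less_cancel_iff y_def l_def .
        qed
        finally have "2 ^ card Q * exp (- l / 6) * (real N + 1) < 1" by simp
        hence "W * (2 ^ card Q * exp (- l / 6) * (real N + 1)) < W * 1"
          using W by (intro mult_strict_left_mono) auto
        thus "2 ^ card Q * (W * exp (- l / 6)) * (real N + 1) < (\<Sum>d\<in>D. lweight l d)"
          by (simp add: W_def mult_ac)
      qed (rule finQ)
      then obtain d where d: "d \<in> D"
        "int (card {n\<in>{1..N}. prime_factors n \<subseteq> Q}) \<le> (\<Sum>n\<in>{1..N}. kronecker (int d) n)" by blast
      let ?y = "(1/4 + 0) * ln X * ln (ln X) / max (ln (ln x) - ln (ln (ln X))) (ln (ln (ln X)))"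
      have "?y \<le> (1/4 + 0) * ln X * ln (ln X) / ln (ln (ln X))"
      proof (rule divide_left_mono)
        show "0 < max (ln (ln x) - ln (ln (ln X))) (ln (ln (ln X))) * ln (ln (ln X))"
          by (intro mult_pos_pos elim(2) less_le_trans[OF elim(2) max.cobounded2])
        show "0 \<le> (1/4 + 0) * ln X * ln (ln X)"
          using elim(3,4) by (intro mult_nonneg_nonneg) linarith+
      qed (rule max.cobounded2)
      also have "\<dots> = y" by (simp add: y_def Y_def)
      finally have yy: "?y \<le> y" .
      have "Psi x ?y \<le> card {n\<in>{1..N}. prime_factors n \<subseteq> Q}"
        unfolding Psi_def
      proof (rule card_mono)
        show "{n. 1 \<le> n \<and> real n \<le> x \<and> (\<forall>p\<in>prime_factors n. real p \<le> ?y)} \<subseteq> {n\<in>{1..N}. prime_factors n \<subseteq> Q}"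
          using yy by (force simp: N_def Q_def le_nat_floor in_prime_factors_iff)
      qed simp
      hence "real (Psi x ?y) \<le> real_of_int (\<Sum>n\<in>{1..N}. kronecker (int d) n)"
        using d(2) by linarith
      also have "\<dots> \<le> Max ((\<lambda>d. real_of_int (\<Sum>n\<in>{1..nat \<lfloor>x\<rfloor>}. kronecker d n)) `
              {d::int. X < real_of_int d \<and> real_of_int d \<le> 2 * X \<and> fundamental_disc d})"
      proof (rule Max_ge)
        have "{d::int. X < real_of_int d \<and> real_of_int d \<le> 2 * X \<and> fundamental_disc d} \<subseteq> {\<lfloor>X\<rfloor>..\<lfloor>2 * X\<rfloor>}"
          by (auto simp: le_floor_iff floor_le_iff)
        thus "finite ((\<lambda>d. real_of_int (\<Sum>n\<in>{1..nat \<lfloor>x\<rfloor>}. kronecker d n)) `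
              {d::int. X < real_of_int d \<and> real_of_int d \<le> 2 * X \<and> fundamental_disc d})"
          by (intro finite_imageI) (rule finite_subset, auto)
        have "fundamental_disc (int d)"
        proof -
          have p: "prime d" "d mod 4 = 1" using Dmem[OF d(1)] by auto
          have "squarefree (int d)" using p(1) by (intro squarefree_prime) simp
          moreover have "int d mod 4 = 1" using p(2) by presburger
          moreover have "int d \<noteq> 1" using p(1) by auto
          ultimately show ?thesis by (simp add: fundamental_disc_def)
        qed
        thus "real_of_int (\<Sum>n\<in>{1..N}. kronecker (int d) n) \<in> (\<lambda>d. real_of_int (\<Sum>n\<in>{1..nat \<lfloor>x\<rfloor>}. kronecker d n)) `
              {d::int. X < real_of_int d \<and> real_of_int d \<le> 2 * X \<and> fundamental_disc d}"
          using Dmem[OF d(1)] unfolding N_def by (intro image_eqI[of _ _ "int d"]) auto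
      qed
      finally show "real (Psi x ?y) \<le> Max ((\<lambda>d. real_of_int (\<Sum>n\<in>{1..nat \<lfloor>x\<rfloor>}. kronecker d n)) `
              {d::int. X < real_of_int d \<and> real_of_int d \<le> 2 * X \<and> fundamental_disc d})" .
    qed
  qed
qed simp

end
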